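(* Let $\Gamma$ be a finite, simplicial, triangle free graph with vertex set $S$, let $G_\Gamma$ be the associated right-angled Coxeter group, and let $K$ be the subgroup of $G_\Gamma$ generated by some subset $S_1$ of $S$. Then the following conditions are equivalent: (1) The subgroup $K$ is strongly quasiconvex in $G_\Gamma$. (2) If $S_1$ contains two non-adjacent vertices of an induced 4-cycle $\sigma$ of $\Gamma$, then $S_1$ contains all vertices of $\sigma$. (3) Either $|K|<\infty$ or the lower relative divergence of $G_\Gamma$ with respect to $K$ is at least quadratic.
   Context: The right-angled Coxeter group $G_\Gamma$ has generating set $S$ the vertices of $\Gamma$ and relations $s^2=1$ for all $s\in S$ and $st=ts$ whenever $s,t$ are adjacent. A $(K,L)$-quasi-geodesic is a map $c$ from an interval of $\mathbb{R}$ to a metric space with $\frac1K|s-t|-L\le d(c(s),c(t))\le K|s-t|+L$. A subgroup $H$ of a finitely generated group $G$ is strongly quasiconvex if, in the Cayley graph of $G$ for some (any) finite generating set, for every $K\ge1$, $C\ge0$ there is $M(K,C)$ such that every $(K,C)$-quasi-geodesic with endpoints on $H$ lies in the $M(K,C)$-neighborhood of $H$. Lower relative divergence: let $X$ be a geodesic space, $A\subset X$ of infinite diameter. Put $N_r(A)=\{x: d(x,A)<r\}$, $\partial N_r(A)=\{x: d(x,A)=r\}$, and let $d_r$ be the induced length metric on $X-N_r(A)$ (value $\infty$ if there is no connecting rectifiable path). For $\rho\in(0,1]$, integer $n\ge2$ and $r>0$ let $\sigma^n_\rho(r)=\inf d_{\rho r}(x_1,x_2)$ over all $x_1,x_2\in\partial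 N_r(A)$ with $d_r(x_1,x_2)<\infty$ and $d(x_1,x_2)\ge nr$, and $\sigma^n_\rho(r)=\infty$ if no such pair exists. The family $\{\sigma^n_\rho\}$ is $div(X,A)$; $div(G,H)$ is $div$ of a Cayley graph of $G$ (finite generating set) with respect to the infinite subgroup $H$. For $f,g:[0,\infty)\to[0,\infty]$, $f\preceq g$ means there are positive constants $A,B,C,D$ with $f(x)\le Ag(Bx)+Cx$ for all $x>D$. For families, $\{\delta^n_\rho\}\preceq\{\delta'^n_\rho\}$ means there are $L\in(0,1]$ and a positive integer $M$ with $\delta^n_{L\rho}\preceq\delta'^{Mn}_\rho$ for all $n,\rho$. A function $f$ is viewed as the constant family $\delta^n_\rho=f$. A family is at least quadratic if it dominates ($\succeq$) the function $r\mapsto r^2$. *)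

theory Defs
  imports
    "HOL-Analysis.Analysis"
    "HOL-Algebra.Generated_Groups"
    "Graph_Theory.Pair_Digraph"
begin

section \<open>Groups given by generators and relations\<close>

text \<open>A letter \<open>(s, True)\<close> stands for the generator \<open>s\<close> and \<open>(s, False)\<close> for its formal
  inverse. A relation is an equation between two words.\<close>

type_synonym 'a gword = "('a \<times> bool) list"

definition gwords :: "'a set \<Rightarrow> 'a gword set" where
  "gwords S = lists (S \<times> UNIV)"

inductive pres_eq :: "'a set \<Rightarrow> ('a gword \<times> 'a gword) set \<Rightarrow> 'a gword \<Rightarrow> 'a gword \<Rightarrow> bool"
  for S R where
  refl: "w \<in> gwords S \<Longrightarrow> pres_eq S R w w"
| sym: "pres_eq S R v w \<Longrightarrow> pres_eq S R w v"
| trans: "pres_eq S R u v \<Longrightarrow> pres_eq S R v w \<Longrightarrow> pres_eq S R u w"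
| cancel: "u \<in> gwords S \<Longrightarrow> v \<in> gwords S \<Longrightarrow> s \<in> S \<Longrightarrow>
    pres_eq S R (u @ [(s, b), (s, \<not> b)] @ v) (u @ v)"
| relation: "u \<in> gwords S \<Longrightarrow> v \<in> gwords S \<Longrightarrow> (l, r) \<in> R \<Longrightarrow> l \<in> gwords S \<Longrightarrow> r \<in> gwords S \<Longrightarrow>
    pres_eq S R (u @ l @ v) (u @ r @ v)"

definition pres_class :: "'a set \<Rightarrow> ('a gword \<times> 'a gword) set \<Rightarrow> 'a gword \<Rightarrow> 'a gword set" where
  "pres_class S R w = {v. pres_eq S R w v}"

definition presented_group :: "'a set \<Rightarrow> ('a gword \<times> 'a gword) set \<Rightarrow> 'a gword set monoid" where
  "presented_group S R =
     \<lparr> carrier = pres_class S R ` gwords S,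
       mult = (\<lambda>A B. \<Union>u\<in>A. \<Union>v\<in>B. pres_class S R (u @ v)),
       one = pres_class S R [] \<rparr>"

lemma pres_eq_gwords: "pres_eq S R v w \<Longrightarrow> v \<in> gwords S \<and> w \<in> gwords S"
  by (induction rule: pres_eq.induct) (auto simp: gwords_def)

lemma gwords_append [simp]: "u @ v \<in> gwords S \<longleftrightarrow> u \<in> gwords S \<and> v \<in> gwords S"
  by (auto simp: gwords_def)

lemma gwords_Nil [simp]: "[] \<in> gwords S"
  by (auto simp: gwords_def)

lemma pres_eq_append_left: "pres_eq S R v w \<Longrightarrow> u \<in> gwords S \<Longrightarrow> pres_eq S R (u @ v) (u @ w)"
proof (induction rule: pres_eq.induct)
  case (cancel a b s c)
  then show ?case using pres_eq.cancel[of "u @ a" S b s R c] by simp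
next
  case (relation a b l r)
  then show ?case using pres_eq.relation[of "u @ a" S b l r R] by simp
qed (simp_all add: pres_eq.refl pres_eq.sym, meson pres_eq.trans)

lemma pres_eq_append_right: "pres_eq S R v w \<Longrightarrow> u \<in> gwords S \<Longrightarrow> pres_eq S R (v @ u) (w @ u)"
proof (induction rule: pres_eq.induct)
  case (cancel a b s c)
  then show ?case using pres_eq.cancel[of a S "b @ u" s R c] by simp
next
  case (relation a b l r)
  then show ?case using pres_eq.relation[of a S "b @ u" l r R] by simp
qed (simp_all add: pres_eq.refl pres_eq.sym, meson pres_eq.trans)

lemma pres_eq_append:
  assumes "pres_eq S R u u'" "pres_eq S R v v'"
  shows "pres_eq S R (u @ v) (u' @ v')"
  using pres_eq_append_right[OF assms(1)] pres_eq_append_left[OF assms(2)]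
    pres_eq_gwords[OF assms(1)] pres_eq_gwords[OF assms(2)] pres_eq.trans by blast

lemma pres_class_eqI:
  assumes "pres_eq S R v w"
  shows "pres_class S R v = pres_class S R w"
  unfolding pres_class_def
  using pres_eq.trans[OF assms] pres_eq.trans[OF pres_eq.sym[OF assms]] by blast

lemma mult_pres_class:
  assumes "u \<in> gwords S" "v \<in> gwords S"
  shows "pres_class S R u \<otimes>\<^bsub>presented_group S R\<^esub> pres_class S R v = pres_class S R (u @ v)"
proof -
  have eq: "pres_class S R (u' @ v') = pres_class S R (u @ v)"
    if "u' \<in> pres_class S R u" "v' \<in> pres_class S R v" for u' v'
    using that by (intro pres_class_eqI[symmetric] pres_eq_append) (simp_all add: pres_class_def)
  have ne: "u \<in> pres_class S R u" "v \<in> pres_class S R v"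
    using assms by (auto simp: pres_class_def intro: pres_eq.refl)
  have "(\<Union>u'\<in>pres_class S R u. \<Union>v'\<in>pres_class S R v. pres_class S R (u' @ v')) =
      (\<Union>u'\<in>pres_class S R u. \<Union>v'\<in>pres_class S R v. pres_class S R (u @ v))"
    by (intro SUP_cong HOL.refl eq)
  also have "\<dots> = pres_class S R (u @ v)" using ne by blast
  finally show ?thesis by (simp add: presented_group_def)
qed

lemma pres_eq_inverse:
  "w \<in> gwords S \<Longrightarrow> pres_eq S R (rev (map (\<lambda>(s, b). (s, \<not> b)) w) @ w) []"
proof (induction w)
  case Nil
  then show ?case by (auto intro: pres_eq.refl)
next
  case (Cons x w)
  obtain s b where x: "x = (s, b)" by (cases x)
  let ?r = "rev (map (\<lambda>(s, b). (s, \<not> b)) w)"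
  have w: "w \<in> gwords S" "s \<in> S" using Cons.prems x by (auto simp: gwords_def)
  have r: "?r \<in> gwords S" using w by (auto simp: gwords_def)
  have "pres_eq S R (?r @ [(s, \<not> b), (s, \<not> \<not> b)] @ w) (?r @ w)"
    by (rule pres_eq.cancel) (use w r in auto)
  then show ?case using Cons.IH[OF w(1)] pres_eq.trans x by fastforce
qed

lemma group_presented_group: "group (presented_group S R)"
proof (rule groupI)
  fix x assume "x \<in> carrier (presented_group S R)"
  then obtain u where u: "u \<in> gwords S" "x = pres_class S R u"
    by (auto simp: presented_group_def)
  let ?r = "rev (map (\<lambda>(s, b). (s, \<not> b)) u)"
  have r: "?r \<in> gwords S" using u by (auto simp: gwords_def)
  have "pres_class S R ?r \<otimes>\<^bsub>presented_group S R\<^esub> x = \<one>\<^bsub>presented_group S R\<^esub>"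
    using mult_pres_class[OF r u(1), of R] u pres_class_eqI[OF pres_eq_inverse[OF u(1), of R]]
    by (simp add: presented_group_def)
  then show "\<exists>y\<in>carrier (presented_group S R). y \<otimes>\<^bsub>presented_group S R\<^esub> x = \<one>\<^bsub>presented_group S R\<^esub>"
    using r by (auto simp: presented_group_def)
  show "\<one>\<^bsub>presented_group S R\<^esub> \<otimes>\<^bsub>presented_group S R\<^esub> x = x"
    using mult_pres_class[of "[]" S u R] u by (simp add: presented_group_def)
next
  fix x y assume "x \<in> carrier (presented_group S R)" "y \<in> carrier (presented_group S R)"
  then obtain u v where uv: "u \<in> gwords S" "x = pres_class S R u" "v \<in> gwords S" "y = pres_class S R v"
    by (auto simp: presented_group_def)
  then have "x \<otimes>\<^bsub>presented_group S R\<^esub> y = pres_class S R (u @ v)" by (simp add: mult_pres_class)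
  then show "x \<otimes>\<^bsub>presented_group S R\<^esub> y \<in> carrier (presented_group S R)"
    using uv by (auto simp: presented_group_def)
  fix z assume "z \<in> carrier (presented_group S R)"
  then obtain w where "w \<in> gwords S" "z = pres_class S R w"
    by (auto simp: presented_group_def)
  with uv show "x \<otimes>\<^bsub>presented_group S R\<^esub> y \<otimes>\<^bsub>presented_group S R\<^esub> z =
      x \<otimes>\<^bsub>presented_group S R\<^esub> (y \<otimes>\<^bsub>presented_group S R\<^esub> z)"
    by (simp add: mult_pres_class)
qed (auto simp: presented_group_def)


section \<open>Graphs and right-angled Coxeter groups\<close>

text \<open>Finite simplicial graphs are the \<^locale>\<open>pair_graph\<close>s of the library: \<open>parcs\<close> is a finite,
  symmetric and irreflexive relation on the finite set \<open>pverts\<close>.\<close>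

definition triangle_free :: "'v pair_pre_digraph \<Rightarrow> bool" where
  "triangle_free \<Gamma> \<longleftrightarrow>
     \<not> (\<exists>a b c. (a, b) \<in> parcs \<Gamma> \<and> (b, c) \<in> parcs \<Gamma> \<and> (c, a) \<in> parcs \<Gamma>)"

definition induced_4_cycle :: "'v pair_pre_digraph \<Rightarrow> 'v \<Rightarrow> 'v \<Rightarrow> 'v \<Rightarrow> 'v \<Rightarrow> bool" where
  "induced_4_cycle \<Gamma> a b c d \<longleftrightarrow>
     {a, b, c, d} \<subseteq> pverts \<Gamma> \<and> distinct [a, b, c, d] \<and>
     (a, b) \<in> parcs \<Gamma> \<and> (b, c) \<in> parcs \<Gamma> \<and> (c, d) \<in> parcs \<Gamma> \<and> (d, a) \<in> parcs \<Gamma> \<and>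
     (a, c) \<notin> parcs \<Gamma> \<and> (b, d) \<notin> parcs \<Gamma>"

definition racg_relations :: "'v pair_pre_digraph \<Rightarrow> ('v gword \<times> 'v gword) set" where
  "racg_relations \<Gamma> =
     {([(s, True), (s, True)], []) | s. s \<in> pverts \<Gamma>} \<union>
     {([(s, True), (t, True)], [(t, True), (s, True)]) | s t. (s, t) \<in> parcs \<Gamma>}"

definition racg :: "'v pair_pre_digraph \<Rightarrow> 'v gword set monoid" where
  "racg \<Gamma> = presented_group (pverts \<Gamma>) (racg_relations \<Gamma>)"

definition racg_gen :: "'v pair_pre_digraph \<Rightarrow> 'v \<Rightarrow> 'v gword set" where
  "racg_gen \<Gamma> s = pres_class (pverts \<Gamma>) (racg_relations \<Gamma>) [(s, True)]"

lemma group_racg: "group (racg \<Gamma>)"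
  by (simp add: racg_def group_presented_group)


section \<open>Graphs as geodesic metric spaces\<close>

text \<open>Points of the geometric realization are barycentric coordinate functions on the vertices;
  \<open>graph_cell u v\<close> is the closed edge joining \<open>u\<close> to \<open>v\<close>, and the single vertex \<open>u\<close> if \<open>v = u\<close>.
  For two points of one closed edge, \<open>edge_dist\<close> is their distance in that edge, identified
  with the unit interval. The metric is the path metric, i.e. the infimum of
  the lengths of chains in which consecutive points share a closed edge.\<close>

definition graph_vertex :: "'v \<Rightarrow> 'v \<Rightarrow> real" where
  "graph_vertex u = indicator {u}"

definition graph_cell :: "'v \<Rightarrow> 'v \<Rightarrow> ('v \<Rightarrow> real) set" where
  "graph_cell u v = {(\<lambda>w. (1 - t) * graph_vertex u w + t * graph_vertex v w) | t. 0 \<le> t \<and> t \<le> 1}"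

definition graph_cells :: "'v pair_pre_digraph \<Rightarrow> ('v \<Rightarrow> real) set set" where
  "graph_cells \<Gamma> = {graph_cell u v | u v. u \<in> pverts \<Gamma> \<and> (v = u \<or> (u, v) \<in> parcs \<Gamma>)}"

definition edge_dist :: "('v \<Rightarrow> real) \<Rightarrow> ('v \<Rightarrow> real) \<Rightarrow> real" where
  "edge_dist x y = (\<Sum>w | x w \<noteq> 0 \<or> y w \<noteq> 0. \<bar>x w - y w\<bar>) / 2"

inductive graph_chain :: "'v pair_pre_digraph \<Rightarrow> ('v \<Rightarrow> real) \<Rightarrow> real \<Rightarrow> ('v \<Rightarrow> real) \<Rightarrow> bool"
  for \<Gamma> where
  start: "x \<in> \<Union> (graph_cells \<Gamma>) \<Longrightarrow> graph_chain \<Gamma> x 0 x"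
| step: "graph_chain \<Gamma> x l y \<Longrightarrow> c \<in> graph_cells \<Gamma> \<Longrightarrow> y \<in> c \<Longrightarrow> z \<in> c \<Longrightarrow>
    graph_chain \<Gamma> x (l + edge_dist y z) z"

definition graph_dist :: "'v pair_pre_digraph \<Rightarrow> ('v \<Rightarrow> real) \<Rightarrow> ('v \<Rightarrow> real) \<Rightarrow> real" where
  "graph_dist \<Gamma> x y =
     (if x \<in> \<Union> (graph_cells \<Gamma>) \<and> y \<in> \<Union> (graph_cells \<Gamma>) then Inf {l. graph_chain \<Gamma> x l y} else 0)"

definition graph_space :: "'v pair_pre_digraph \<Rightarrow> ('v \<Rightarrow> real) metric" where
  "graph_space \<Gamma> = metric (\<Union> (graph_cells \<Gamma>), graph_dist \<Gamma>)"

text \<open>The value of \<^const>\<open>metric\<close> is only meaningful on actual metrics, which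
  \<open>Metric_space_graph\<close> provides for connected graphs.\<close>

lemma graph_cell_sym: "graph_cell u v \<subseteq> graph_cell v u"
proof
  fix x assume "x \<in> graph_cell u v"
  then obtain t where "0 \<le> t" "t \<le> 1" "x = (\<lambda>w. (1 - t) * graph_vertex u w + t * graph_vertex v w)"
    by (auto simp: graph_cell_def)
  then show "x \<in> graph_cell v u"
    unfolding graph_cell_def by (intro CollectI exI[of _ "1 - t"]) auto
qed

lemma graph_vertex_in_cell: "graph_vertex u \<in> graph_cell u v"
  unfolding graph_cell_def by (intro CollectI exI[of _ "0::real"]) simp

lemma graph_vertex_in_cell': "graph_vertex v \<in> graph_cell u v"
  by (rule subsetD[OF graph_cell_sym graph_vertex_in_cell])

lemma finite_support_cell:
  assumes "x \<in> \<Union> (graph_cells \<Gamma>)"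
  shows "finite {w. x w \<noteq> 0}"
proof -
  obtain u v where "x \<in> graph_cell u v" using assms by (auto simp: graph_cells_def)
  then have "{w. x w \<noteq> 0} \<subseteq> {u, v}"
    by (auto simp: graph_cell_def graph_vertex_def indicator_def split: if_splits)
  then show ?thesis using finite_subset by blast
qed

lemma edge_dist_superset:
  assumes "finite F" "{w. x w \<noteq> 0} \<subseteq> F" "{w. y w \<noteq> 0} \<subseteq> F"
  shows "edge_dist x y = (\<Sum>w\<in>F. \<bar>x w - y w\<bar>) / 2"
  unfolding edge_dist_def using assms
  by (intro arg_cong[where f = "\<lambda>s. s / 2"] sum.mono_neutral_left) auto

lemma edge_dist_nonneg: "0 \<le> edge_dist x y"
  unfolding edge_dist_def by (simp add: sum_nonneg)

lemma edge_dist_commute: "edge_dist x y = edge_dist y x"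
  unfolding edge_dist_def by (simp add: abs_minus_commute disj_commute)

lemma edge_dist_self [simp]: "edge_dist x x = 0"
  unfolding edge_dist_def by simp

lemma edge_dist_triangle:
  assumes "finite {w. x w \<noteq> 0}" "finite {w. y w \<noteq> 0}" "finite {w. z w \<noteq> 0}"
  shows "edge_dist x z \<le> edge_dist x y + edge_dist y z"
proof -
  let ?F = "{w. x w \<noteq> 0} \<union> {w. y w \<noteq> 0} \<union> {w. z w \<noteq> 0}"
  have F: "finite ?F" using assms by auto
  have "edge_dist x z = (\<Sum>w\<in>?F. \<bar>x w - z w\<bar>) / 2"
    "edge_dist x y = (\<Sum>w\<in>?F. \<bar>x w - y w\<bar>) / 2"
    "edge_dist y z = (\<Sum>w\<in>?F. \<bar>y w - z w\<bar>) / 2"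
    by (rule edge_dist_superset[OF F]; blast)+
  moreover have "(\<Sum>w\<in>?F. \<bar>x w - z w\<bar>) \<le> (\<Sum>w\<in>?F. \<bar>x w - y w\<bar> + \<bar>y w - z w\<bar>)"
    by (intro sum_mono) auto
  ultimately show ?thesis by (simp add: sum.distrib)
qed

lemma edge_dist_eq_0:
  assumes "finite {w. x w \<noteq> 0}" "finite {w. y w \<noteq> 0}" "edge_dist x y \<le> 0"
  shows "x = y"
proof
  fix w
  have fin: "finite {w. x w \<noteq> 0 \<or> y w \<noteq> 0}"
    using finite_UnI[OF assms(1,2)] by (simp only: Collect_disj_eq)
  have "edge_dist x y = 0" using assms(3) edge_dist_nonneg[of x y] by linarith
  then have "(\<Sum>w | x w \<noteq> 0 \<or> y w \<noteq> 0. \<bar>x w - y w\<bar>) = 0" by (simp add: edge_dist_def)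
  then have "\<forall>w\<in>{w. x w \<noteq> 0 \<or> y w \<noteq> 0}. \<bar>x w - y w\<bar> = 0"
    using sum_nonneg_eq_0_iff[OF fin, of "\<lambda>w. \<bar>x w - y w\<bar>"] by simp
  then show "x w = y w" by force
qed

lemma graph_chain_points:
  "graph_chain \<Gamma> x l y \<Longrightarrow> x \<in> \<Union> (graph_cells \<Gamma>) \<and> y \<in> \<Union> (graph_cells \<Gamma>)"
  by (induction rule: graph_chain.induct) auto

lemma graph_chain_trans:
  "graph_chain \<Gamma> y k z \<Longrightarrow> graph_chain \<Gamma> x l y \<Longrightarrow> graph_chain \<Gamma> x (l + k) z"
proof (induction rule: graph_chain.induct)
  case (step y k z c z')
  from graph_chain.step[OF step.IH[OF step.prems] step.hyps(2-4)] show ?case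
    by (simp add: add.assoc)
qed simp

lemma graph_chain_cell: "c \<in> graph_cells \<Gamma> \<Longrightarrow> x \<in> c \<Longrightarrow> y \<in> c \<Longrightarrow> graph_chain \<Gamma> x (edge_dist x y) y"
  using graph_chain.step[OF graph_chain.start[of x \<Gamma>], of c y] by auto

lemma graph_chain_sym: "graph_chain \<Gamma> x l y \<Longrightarrow> graph_chain \<Gamma> y l x"
proof (induction rule: graph_chain.induct)
  case (step x l y c z)
  from graph_chain_trans[OF step.IH graph_chain_cell[OF step.hyps(2,4,3)]] show ?case
    by (simp add: add.commute edge_dist_commute)
qed (rule graph_chain.start)

lemma graph_chain_lower: "graph_chain \<Gamma> x l y \<Longrightarrow> edge_dist x y \<le> l"
proof (induction rule: graph_chain.induct)
  case (step x l y c z)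
  have "finite {w. x w \<noteq> 0}" "finite {w. y w \<noteq> 0}" "finite {w. z w \<noteq> 0}"
    using graph_chain_points[OF step.hyps(1)] step.hyps finite_support_cell by blast+
  from edge_dist_triangle[OF this] step.IH show ?case by linarith
qed simp

lemma graph_chain_exists:
  assumes conn: "\<And>u v. u \<in> pverts \<Gamma> \<Longrightarrow> v \<in> pverts \<Gamma> \<Longrightarrow> (u, v) \<in> (parcs \<Gamma>)\<^sup>*"
    and verts: "parcs \<Gamma> \<subseteq> pverts \<Gamma> \<times> pverts \<Gamma>"
    and x: "x \<in> \<Union> (graph_cells \<Gamma>)" and y: "y \<in> \<Union> (graph_cells \<Gamma>)"
  shows "\<exists>l. graph_chain \<Gamma> x l y"
proof -
  have ex: "\<exists>l u. u \<in> pverts \<Gamma> \<and> graph_chain \<Gamma> z l (graph_vertex u)"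
    if "z \<in> \<Union> (graph_cells \<Gamma>)" for z
  proof -
    obtain u v where uv: "z \<in> graph_cell u v" "graph_cell u v \<in> graph_cells \<Gamma>" "u \<in> pverts \<Gamma>"
      using \<open>z \<in> _\<close> by (auto simp: graph_cells_def)
    then show ?thesis using graph_chain_cell graph_vertex_in_cell by metis
  qed
  have vert: "\<exists>l. graph_chain \<Gamma> (graph_vertex u) l (graph_vertex v)"
    if "(u, v) \<in> (parcs \<Gamma>)\<^sup>*" "u \<in> pverts \<Gamma>" for u v
    using that(1)
  proof (induction rule: rtrancl_induct)
    case base
    have "graph_cell u u \<in> graph_cells \<Gamma>" using that(2) by (auto simp: graph_cells_def)
    then show ?case using graph_chain_cell graph_vertex_in_cell by metis
  next
    case (step v w)
    have "graph_cell v w \<in> graph_cells \<Gamma>" using step.hyps verts by (auto simp: graph_cells_def)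
    then show ?case using step.IH graph_chain.step graph_vertex_in_cell graph_vertex_in_cell' by metis
  qed
  obtain k u l v where "u \<in> pverts \<Gamma>" "graph_chain \<Gamma> x k (graph_vertex u)"
    "v \<in> pverts \<Gamma>" "graph_chain \<Gamma> y l (graph_vertex v)"
    using ex[OF x] ex[OF y] by blast
  then show ?thesis using vert[OF conn[of u v]] graph_chain_trans graph_chain_sym by metis
qed

lemma Metric_space_graph:
  assumes conn: "\<And>u v. u \<in> pverts \<Gamma> \<Longrightarrow> v \<in> pverts \<Gamma> \<Longrightarrow> (u, v) \<in> (parcs \<Gamma>)\<^sup>*"
    and verts: "parcs \<Gamma> \<subseteq> pverts \<Gamma> \<times> pverts \<Gamma>"
  shows "Metric_space (\<Union> (graph_cells \<Gamma>)) (graph_dist \<Gamma>)"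
proof
  let ?P = "\<Union> (graph_cells \<Gamma>)"
  have ne: "{l. graph_chain \<Gamma> x l y} \<noteq> {}" if "x \<in> ?P" "y \<in> ?P" for x y
    using graph_chain_exists[OF conn verts that] by auto
  have low: "edge_dist x y \<le> graph_dist \<Gamma> x y" if "x \<in> ?P" "y \<in> ?P" for x y
    using that cInf_greatest[OF ne[OF that], of "edge_dist x y"] graph_chain_lower[of \<Gamma> x _ y]
    by (simp add: graph_dist_def)
  have bdd: "bdd_below {l. graph_chain \<Gamma> x l y}" for x y
    using graph_chain_lower by (auto intro!: bdd_belowI[of _ "edge_dist x y"])
  have up: "graph_dist \<Gamma> x y \<le> l" if "graph_chain \<Gamma> x l y" for x y l
    using that graph_chain_points[OF that] cInf_lower[OF _ bdd, of l x y] by (simp add: graph_dist_def)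
  fix x y z
  show "0 \<le> graph_dist \<Gamma> x y"
  proof (cases "x \<in> ?P \<and> y \<in> ?P")
    case True
    then show ?thesis using low[of x y] edge_dist_nonneg[of x y] by linarith
  next
    case False
    then show ?thesis unfolding graph_dist_def by (simp only: if_False order.refl)
  qed
  have "{l. graph_chain \<Gamma> x l y} = {l. graph_chain \<Gamma> y l x}" using graph_chain_sym by blast
  then show "graph_dist \<Gamma> x y = graph_dist \<Gamma> y x"
    unfolding graph_dist_def by (simp only: conj_commute)
  assume x: "x \<in> ?P" and y: "y \<in> ?P"
  show "(graph_dist \<Gamma> x y = 0) = (x = y)"
  proof
    assume "graph_dist \<Gamma> x y = 0"
    then have "edge_dist x y \<le> 0" using low[OF x y] by simp
    then show "x = y" using edge_dist_eq_0 finite_support_cell x y by metis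
  next
    assume "x = y"
    then have "graph_dist \<Gamma> x y \<le> 0" using up[OF graph_chain.start[OF x]] by simp
    then show "graph_dist \<Gamma> x y = 0" using low[OF x y] edge_dist_nonneg[of x y] by linarith
  qed
  assume z: "z \<in> ?P"
  have "graph_dist \<Gamma> x z - l \<le> graph_dist \<Gamma> x y" if l: "graph_chain \<Gamma> y l z" for l
  proof -
    have "graph_dist \<Gamma> x z - l \<le> k" if "graph_chain \<Gamma> x k y" for k
      using up[OF graph_chain_trans[OF l that]] by linarith
    then show ?thesis using cInf_greatest[OF ne[OF x y], of "graph_dist \<Gamma> x z - l"] x y
      by (simp add: graph_dist_def[of \<Gamma> x y])
  qed
  then have "graph_dist \<Gamma> x z - graph_dist \<Gamma> x y \<le> l" if "graph_chain \<Gamma> y l z" for l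
    using that by fastforce
  then have "graph_dist \<Gamma> x z - graph_dist \<Gamma> x y \<le> graph_dist \<Gamma> y z"
    using cInf_greatest[OF ne[OF y z], of "graph_dist \<Gamma> x z - graph_dist \<Gamma> x y"] y z
    by (simp add: graph_dist_def[of \<Gamma> y z])
  then show "graph_dist \<Gamma> x z \<le> graph_dist \<Gamma> x y + graph_dist \<Gamma> y z" by linarith
qed


section \<open>Cayley graphs\<close>

text \<open>The simplicial Cayley graph: generators equal to the identity give no loops, and a generator
  and its inverse give the same edge.\<close>

definition finite_generating_set :: "('g, 'b) monoid_scheme \<Rightarrow> 'g set \<Rightarrow> bool" where
  "finite_generating_set G T \<longleftrightarrow> finite T \<and> T \<subseteq> carrier G \<and> generate G T = carrier G"

definition cayley_graph :: "('g, 'b) monoid_scheme \<Rightarrow> 'g set \<Rightarrow> 'g pair_pre_digraph" where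
  "cayley_graph G T =
     \<lparr> pverts = carrier G,
       parcs = {(g, h). g \<in> carrier G \<and> h \<in> carrier G \<and> g \<noteq> h \<and>
                        (\<exists>t\<in>T. h = g \<otimes>\<^bsub>G\<^esub> t \<or> g = h \<otimes>\<^bsub>G\<^esub> t)} \<rparr>"

definition cayley_space :: "('g, 'b) monoid_scheme \<Rightarrow> 'g set \<Rightarrow> ('g \<Rightarrow> real) metric" where
  "cayley_space G T = graph_space (cayley_graph G T)"

lemma cayley_graph_connected:
  fixes G (structure)
  assumes G: "group G" and T: "finite_generating_set G T"
    and u: "u \<in> carrier G" and v: "v \<in> carrier G"
  shows "(u, v) \<in> (parcs (cayley_graph G T))\<^sup>*"
proof -
  interpret Group.group G by (rule G)
  let ?E = "(parcs (cayley_graph G T))\<^sup>*"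
  have sub: "T \<subseteq> carrier G" and gen: "generate G T = carrier G"
    using T unfolding finite_generating_set_def by blast+
  have edge: "(g, g \<otimes> t) \<in> ?E \<and> (g \<otimes> t, g) \<in> ?E" if "g \<in> carrier G" "t \<in> T" for g t
  proof (cases "g = g \<otimes> t")
    case False
    then have "(g, g \<otimes> t) \<in> parcs (cayley_graph G T)" "(g \<otimes> t, g) \<in> parcs (cayley_graph G T)"
      using that sub by (auto simp: cayley_graph_def)
    then show ?thesis by blast
  qed simp
  have "(g, g \<otimes> w) \<in> ?E" if "w \<in> generate G T" "g \<in> carrier G" for g w
    using that
  proof (induction arbitrary: g rule: generate.induct)
    case (inv h)
    then have h: "h \<in> carrier G" using sub by auto
    then have "g \<otimes> inv h \<otimes> h = g" using inv by (simp add: m_assoc)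
    then show ?case using edge[of "g \<otimes> inv h" h] inv h by simp
  next
    case (eng h1 h2)
    have h: "h1 \<in> carrier G" "h2 \<in> carrier G" using eng.hyps gen by auto
    have "(g, g \<otimes> h1) \<in> ?E" "(g \<otimes> h1, g \<otimes> h1 \<otimes> h2) \<in> ?E" using eng h by auto
    then show ?case using h eng.prems by (simp add: m_assoc)
  qed (use edge in auto)
  from this[of "inv u \<otimes> v" u] u v gen show ?thesis by (simp add: m_assoc[symmetric])
qed

lemma finite_generating_set_racg:
  assumes "finite (pverts \<Gamma>)"
  shows "finite_generating_set (racg \<Gamma>) (racg_gen \<Gamma> ` pverts \<Gamma>)"
proof -
  interpret Group.group "racg \<Gamma>" by (rule group_racg)
  let ?S = "pverts \<Gamma>" and ?R = "racg_relations \<Gamma>"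
  let ?T = "racg_gen \<Gamma> ` ?S"
  have sub: "?T \<subseteq> carrier (racg \<Gamma>)"
    by (auto simp: racg_def racg_gen_def presented_group_def gwords_def)
  have letter: "pres_class ?S ?R [(s, b)] \<in> generate (racg \<Gamma>) ?T" if s: "s \<in> ?S" for s b
  proof (cases b)
    case True
    then show ?thesis using s generate.incl[of "racg_gen \<Gamma> s" ?T] by (simp add: racg_gen_def)
  next
    case False
    have "pres_eq ?S ?R ([] @ [(s, False), (s, \<not> False)] @ []) ([] @ [])"
      by (rule pres_eq.cancel) (use s in auto)
    then have "pres_class ?S ?R [(s, False), (s, True)] = pres_class ?S ?R []"
      by (intro pres_class_eqI) simp
    moreover have "[(s, False)] \<in> gwords ?S" "[(s, True)] \<in> gwords ?S"
      using s by (auto simp: gwords_def)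
    ultimately have "pres_class ?S ?R [(s, False)] \<otimes>\<^bsub>racg \<Gamma>\<^esub> racg_gen \<Gamma> s = \<one>\<^bsub>racg \<Gamma>\<^esub>"
      using mult_pres_class[of "[(s, False)]" ?S "[(s, True)]" ?R]
      by (simp add: racg_def racg_gen_def presented_group_def)
    moreover have "pres_class ?S ?R [(s, False)] \<in> carrier (racg \<Gamma>)" "racg_gen \<Gamma> s \<in> carrier (racg \<Gamma>)"
      using s sub by (auto simp: racg_def presented_group_def gwords_def)
    ultimately have "pres_class ?S ?R [(s, False)] = inv\<^bsub>racg \<Gamma>\<^esub> racg_gen \<Gamma> s"
      using inv_equality by metis
    then show ?thesis using False s generate.inv[of "racg_gen \<Gamma> s" ?T] by simp
  qed
  have "pres_class ?S ?R w \<in> generate (racg \<Gamma>) ?T" if "w \<in> gwords ?S" for w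
    using that
  proof (induction w)
    case Nil
    then show ?case using generate.one[of "racg \<Gamma>" ?T] by (simp add: racg_def presented_group_def)
  next
    case (Cons x w)
    obtain s b where x: "x = (s, b)" by (cases x)
    have w: "s \<in> ?S" "w \<in> gwords ?S" "[x] \<in> gwords ?S"
      using Cons.prems x by (auto simp: gwords_def)
    then show ?case
      using generate.eng[OF letter[OF w(1), of b] Cons.IH[OF w(2)]]
        mult_pres_class[OF w(3,2), of ?R] x
      by (simp add: racg_def)
  qed
  then have "carrier (racg \<Gamma>) \<subseteq> generate (racg \<Gamma>) ?T"
    by (auto simp: racg_def presented_group_def)
  then show ?thesis
    using assms sub generate_incl[OF sub] by (auto simp: finite_generating_set_def)
qed

lemma
  assumes "group G" "finite_generating_set G T"
  shows mspace_cayley_space: "mspace (cayley_space G T) = \<Union> (graph_cells (cayley_graph G T))"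
    and mdist_cayley_space: "mdist (cayley_space G T) = graph_dist (cayley_graph G T)"
proof -
  interpret Metric_space "\<Union> (graph_cells (cayley_graph G T))" "graph_dist (cayley_graph G T)"
    by (rule Metric_space_graph)
      (use cayley_graph_connected[OF assms] in \<open>auto simp: cayley_graph_def\<close>)
  show "mspace (cayley_space G T) = \<Union> (graph_cells (cayley_graph G T))"
    "mdist (cayley_space G T) = graph_dist (cayley_graph G T)"
    using mspace_metric mdist_metric by (simp_all add: cayley_space_def graph_space_def)
qed


section \<open>Strong quasiconvexity\<close>

definition mdist_to_set :: "'a metric \<Rightarrow> 'a \<Rightarrow> 'a set \<Rightarrow> real" where
  "mdist_to_set X x A = (INF a\<in>A. mdist X x a)"

definition open_nbhd :: "'a metric \<Rightarrow> 'a set \<Rightarrow> real \<Rightarrow> 'a set" where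
  "open_nbhd X A r = {x \<in> mspace X. mdist_to_set X x A < r}"

definition quasi_geodesic :: "'a metric \<Rightarrow> real \<Rightarrow> real \<Rightarrow> real set \<Rightarrow> (real \<Rightarrow> 'a) \<Rightarrow> bool" where
  "quasi_geodesic X K L I c \<longleftrightarrow>
     is_interval I \<and> c ` I \<subseteq> mspace X \<and>
     (\<forall>s\<in>I. \<forall>t\<in>I. \<bar>s - t\<bar> / K - L \<le> mdist X (c s) (c t) \<and>
                   mdist X (c s) (c t) \<le> K * \<bar>s - t\<bar> + L)"

definition strongly_quasiconvex_subset :: "'a metric \<Rightarrow> 'a set \<Rightarrow> bool" where
  "strongly_quasiconvex_subset X A \<longleftrightarrow>
     (\<forall>K\<ge>1. \<forall>C\<ge>0. \<exists>M. \<forall>a b c.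
        a \<le> b \<and> quasi_geodesic X K C {a..b} c \<and> c a \<in> A \<and> c b \<in> A \<longrightarrow>
        c ` {a..b} \<subseteq> open_nbhd X A M)"

definition strongly_quasiconvex :: "('g, 'b) monoid_scheme \<Rightarrow> 'g set \<Rightarrow> 'g set \<Rightarrow> bool" where
  "strongly_quasiconvex G T H \<longleftrightarrow>
     subgroup H G \<and> strongly_quasiconvex_subset (cayley_space G T) (graph_vertex ` H)"


section \<open>Lower relative divergence\<close>

definition curve_length :: "'a metric \<Rightarrow> (real \<Rightarrow> 'a) \<Rightarrow> ennreal" where
  "curve_length X p =
     (SUP ts\<in>{ts. sorted ts \<and> set ts \<subseteq> {0..1}}.
        \<Sum>i<length ts - 1. ennreal (mdist X (p (ts ! i)) (p (ts ! Suc i))))"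

text \<open>The length metric induced on a subset \<open>Y\<close>. The infimum is \<open>\<infinity>\<close> if there is no
  rectifiable path in \<open>Y\<close>.\<close>

definition length_dist :: "'a metric \<Rightarrow> 'a set \<Rightarrow> 'a \<Rightarrow> 'a \<Rightarrow> ennreal" where
  "length_dist X Y x y =
     (INF p\<in>{p. pathin (subtopology (mtopology_of X) Y) p \<and> p 0 = x \<and> p 1 = y}. curve_length X p)"

definition nbhd_boundary :: "'a metric \<Rightarrow> 'a set \<Rightarrow> real \<Rightarrow> 'a set" where
  "nbhd_boundary X A r = {x \<in> mspace X. mdist_to_set X x A = r}"

definition complement_dist :: "'a metric \<Rightarrow> 'a set \<Rightarrow> real \<Rightarrow> 'a \<Rightarrow> 'a \<Rightarrow> ennreal" where
  "complement_dist X A r = length_dist X (mspace X - open_nbhd X A r)"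

type_synonym div_family = "nat \<Rightarrow> real \<Rightarrow> real \<Rightarrow> ennreal"

definition lower_rel_divergence :: "'a metric \<Rightarrow> 'a set \<Rightarrow> div_family" where
  "lower_rel_divergence X A n \<rho> r =
     (INF (x1, x2) \<in> {(x1, x2). x1 \<in> nbhd_boundary X A r \<and> x2 \<in> nbhd_boundary X A r \<and>
                        complement_dist X A r x1 x2 < \<infinity> \<and> mdist X x1 x2 \<ge> real n * r}.
        complement_dist X A (\<rho> * r) x1 x2)"

definition fun_dominated :: "(real \<Rightarrow> ennreal) \<Rightarrow> (real \<Rightarrow> ennreal) \<Rightarrow> bool" where
  "fun_dominated f g \<longleftrightarrow>
     (\<exists>A>0. \<exists>B>0. \<exists>C>0. \<exists>D>0. \<forall>x>D. f x \<le> ennreal A * g (B * x) + ennreal (C * x))"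

definition family_dominated :: "div_family \<Rightarrow> div_family \<Rightarrow> bool" where
  "family_dominated \<delta> \<delta>' \<longleftrightarrow>
     (\<exists>L. 0 < L \<and> L \<le> 1 \<and> (\<exists>M\<ge>1. \<forall>n\<ge>2. \<forall>\<rho>. 0 < \<rho> \<and> \<rho> \<le> 1 \<longrightarrow>
        fun_dominated (\<delta> n (L * \<rho>)) (\<delta>' (M * n) \<rho>)))"

definition at_least_quadratic :: "div_family \<Rightarrow> bool" where
  "at_least_quadratic \<delta> \<longleftrightarrow> family_dominated (\<lambda>n \<rho> r. ennreal (r ^ 2)) \<delta>"

definition subgroup_divergence :: "('g, 'b) monoid_scheme \<Rightarrow> 'g set \<Rightarrow> 'g set \<Rightarrow> div_family" where
  "subgroup_divergence G T H = lower_rel_divergence (cayley_space G T) (graph_vertex ` H)"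

end

theory Submission
  imports Defs
begin

text \<open>Write \<open>g = k m\<close> with \<open>k \<in> K\<close> and \<open>m\<close> shortest in \<open>K g\<close>; the length of \<open>m\<close> is the distance of \<open>g\<close>
  from \<open>K\<close>. Along an edge of the Cayley graph either \<open>k\<close> is fixed, or \<open>m\<close> is fixed and \<open>k\<close> is
  multiplied by a generator \<open>s \<in> S1\<close> whose link contains all letters of \<open>m\<close>. If this happens for two
  different generators \<open>a\<close>, \<open>c\<close> with values \<open>m\<close>, \<open>m'\<close> of length at least \<open>r\<close>, then condition (2) and
  the absence of triangles leave at most one letter outside \<open>S1\<close> common to both links, so \<open>m\<close> and
  \<open>m'\<close> are at distance at least \<open>r - 1\<close>. Hence a path at distance at least \<open>r\<close> from \<open>K\<close> whose
  projection to \<open>K\<close> moves by \<open>n\<close> has length at least \<open>(n - 1) (r - 1)\<close>. This is the quadratic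
  divergence, and it also bounds the excursions of quasi-geodesics away from \<open>K\<close>.

  If (2) fails for a 4-cycle \<open>a, b, c, d\<close> with \<open>a, c \<in> S1\<close> and \<open>b \<notin> S1\<close>, then \<open>a, c\<close> and \<open>b, d\<close>
  span a flat that meets \<open>K\<close> in a bounded neighbourhood of a line; three sides of a square in this
  flat are a quasi-geodesic far from \<open>K\<close> and a path of linear length.\<close>

section \<open>Normal forms for cosets of special subgroups\<close>

text \<open>Every lower bound for a length is read off the stack action. The action respects the
  defining relations, so it can be evaluated on any word for \<open>g\<close>, and one letter
  enlarges the state by at most one. The parameter \<open>C\<close> varies with the use:
  \<open>S1\<close> for the distance to \<open>K\<close>, the link of a generator for the separation
  of two walls, \<open>{a, c}\<close> and \<open>{b, d}\<close> for the coordinates of a flat.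

  A path cannot be charged for every change of \<open>k\<close>: it may multiply \<open>k\<close> by
  the same generator back and forth at one step each. Such changes only move \<open>k\<close>
  between two elements; what is expensive is a change of the generator. This is why blocks of equal
  generators are counted.

  The generating set \<open>T\<close> is arbitrary, while the combinatorics lives in the word metric
  of \<open>S\<close>. The two metrics on the group are bilipschitz with a constant
  \<open>q\<close>, so the estimates have to be available for sequences with bounded jumps and not
  only for edge paths.\<close>

text \<open>A word, up to commuting adjacent letters, is encoded by its subwords \<open>M x y\<close> on the pairs
  \<open>{x, y}\<close> of non-adjacent vertices (\<open>x = y\<close> allowed), last letter first; \<open>M x y = []\<close> for adjacent
  \<open>x\<close>, \<open>y\<close>. The map \<open>step \<Gamma> C\<close> is the right action of the generators on the cosets of the subgroup
  generated by \<open>C\<close>, each coset being represented by its shortest element: a letter cancels, is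
  absorbed by the subgroup, or is appended.\<close>

definition touches :: "'v pair_pre_digraph \<Rightarrow> 'v \<Rightarrow> 'v \<Rightarrow> 'v \<Rightarrow> bool" where
  "touches \<Gamma> s x y \<longleftrightarrow> (x = s \<or> y = s) \<and> (x, y) \<notin> parcs \<Gamma>"

type_synonym 'v stacks = "'v \<Rightarrow> 'v \<Rightarrow> 'v list"

definition push :: "'v pair_pre_digraph \<Rightarrow> 'v \<Rightarrow> 'v stacks \<Rightarrow> 'v stacks" where
  "push \<Gamma> s M = (\<lambda>x y. if touches \<Gamma> s x y then s # M x y else M x y)"

definition pop :: "'v pair_pre_digraph \<Rightarrow> 'v \<Rightarrow> 'v stacks \<Rightarrow> 'v stacks" where
  "pop \<Gamma> s M = (\<lambda>x y. if touches \<Gamma> s x y then tl (M x y) else M x y)"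

text \<open>In the encoded word an occurrence of \<open>s\<close> commutes past everything after it,
  so that multiplication by \<open>s\<close> cancels it.\<close>

definition on_top :: "'v pair_pre_digraph \<Rightarrow> 'v \<Rightarrow> 'v stacks \<Rightarrow> bool" where
  "on_top \<Gamma> s M \<longleftrightarrow> (\<forall>x y. touches \<Gamma> s x y \<longrightarrow> M x y \<noteq> [] \<and> hd (M x y) = s)"

text \<open>For the state of a word this means that every letter is adjacent to \<open>s\<close>;
  then \<open>s\<close> can move to the front, where the subgroup may absorb it.\<close>

definition untouched :: "'v pair_pre_digraph \<Rightarrow> 'v \<Rightarrow> 'v stacks \<Rightarrow> bool" where
  "untouched \<Gamma> s M \<longleftrightarrow> (\<forall>x y. touches \<Gamma> s x y \<longrightarrow> M x y = [])"

definition absorbed :: "'v pair_pre_digraph \<Rightarrow> 'v set \<Rightarrow> 'v \<Rightarrow> 'v stacks \<Rightarrow> bool" where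
  "absorbed \<Gamma> C s M \<longleftrightarrow> s \<in> C \<and> untouched \<Gamma> s M"

definition step :: "'v pair_pre_digraph \<Rightarrow> 'v set \<Rightarrow> 'v stacks \<Rightarrow> 'v \<Rightarrow> 'v stacks" where
  "step \<Gamma> C M s = (if on_top \<Gamma> s M then pop \<Gamma> s M else if absorbed \<Gamma> C s M then M else push \<Gamma> s M)"

definition empty_stacks :: "'v stacks" where
  "empty_stacks = (\<lambda>x y. [])"

definition run :: "'v pair_pre_digraph \<Rightarrow> 'v set \<Rightarrow> 'v list \<Rightarrow> 'v stacks" where
  "run \<Gamma> C xs = foldl (step \<Gamma> C) empty_stacks xs"

text \<open>Words that arise by appending alone, without cancellation or absorption: the shortest
  words of the shortest coset representatives. Several words share one state, since adjacent letters
  may be exchanged.\<close>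

inductive built :: "'v pair_pre_digraph \<Rightarrow> 'v set \<Rightarrow> 'v stacks \<Rightarrow> 'v list \<Rightarrow> bool" for \<Gamma> C where
  built_empty: "built \<Gamma> C empty_stacks []"
| built_push: "built \<Gamma> C M xs \<Longrightarrow> s \<in> pverts \<Gamma> \<Longrightarrow> \<not> on_top \<Gamma> s M \<Longrightarrow> \<not> absorbed \<Gamma> C s M \<Longrightarrow>
    built \<Gamma> C (push \<Gamma> s M) (xs @ [s])"

text \<open>The diagonal stack \<open>M x x\<close> holds the occurrences of \<open>x\<close>, so
  the sum is the length of the encoded word.\<close>

definition stacks_size :: "'v pair_pre_digraph \<Rightarrow> 'v stacks \<Rightarrow> nat" where
  "stacks_size \<Gamma> M = (\<Sum>x\<in>pverts \<Gamma>. length (M x x))"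

definition racg_word :: "'v pair_pre_digraph \<Rightarrow> 'v list \<Rightarrow> 'v gword set" where
  "racg_word \<Gamma> xs = pres_class (pverts \<Gamma>) (racg_relations \<Gamma>) (map (\<lambda>s. (s, True)) xs)"

lemma untouched_empty [simp]: "untouched \<Gamma> s empty_stacks"
  by (simp add: untouched_def empty_stacks_def)

locale right_angled_coxeter =
  fixes \<Gamma> :: "'v pair_pre_digraph"
  assumes pair_graph: "pair_graph \<Gamma>"
begin

abbreviation "S \<equiv> pverts \<Gamma>"
abbreviation "E \<equiv> parcs \<Gamma>"
abbreviation "W \<equiv> racg \<Gamma>"
abbreviation "el \<equiv> racg_word \<Gamma>"

lemma finite_S: "finite S"
proof -
  interpret pair_graph \<Gamma> by (rule pair_graph)
  show ?thesis by simp
qed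

lemma E_sym: "(s, t) \<in> E \<Longrightarrow> (t, s) \<in> E"
proof -
  assume a: "(s, t) \<in> E"
  interpret pair_graph \<Gamma> by (rule pair_graph)
  show "(t, s) \<in> E" using a arcs_symmetric by simp
qed

lemma E_irrefl [simp]: "(s, s) \<notin> E"
proof -
  interpret pair_graph \<Gamma> by (rule pair_graph)
  show ?thesis using no_loops by fastforce
qed

lemma E_verts: "(s, t) \<in> E \<Longrightarrow> s \<in> S \<and> t \<in> S"
proof -
  assume a: "(s, t) \<in> E"
  interpret pair_graph \<Gamma> by (rule pair_graph)
  show ?thesis using a in_arcsD1 in_arcsD2 by blast
qed

lemma touches_self [simp]: "touches \<Gamma> s s s"
  by (simp add: touches_def)

text \<open>Only non-adjacent pairs carry a stack. Hence adjacent generators operate on disjoint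
  families of stacks, and their operations commute.\<close>

lemma touches_adjacent: "(s, t) \<in> E \<Longrightarrow> touches \<Gamma> s x y \<Longrightarrow> \<not> touches \<Gamma> t x y"
  using E_sym by (auto simp: touches_def)

lemma adjacent_simps:
  assumes "(s, t) \<in> E"
  shows "on_top \<Gamma> s (push \<Gamma> t M) = on_top \<Gamma> s M" "on_top \<Gamma> s (pop \<Gamma> t M) = on_top \<Gamma> s M"
    "untouched \<Gamma> s (push \<Gamma> t M) = untouched \<Gamma> s M" "untouched \<Gamma> s (pop \<Gamma> t M) = untouched \<Gamma> s M"
    "absorbed \<Gamma> C s (push \<Gamma> t M) = absorbed \<Gamma> C s M" "absorbed \<Gamma> C s (pop \<Gamma> t M) = absorbed \<Gamma> C s M"
    "pop \<Gamma> s (push \<Gamma> t M) = push \<Gamma> t (pop \<Gamma> s M)" "push \<Gamma> s (push \<Gamma> t M) = push \<Gamma> t (push \<Gamma> s M)"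
    "pop \<Gamma> s (pop \<Gamma> t M) = pop \<Gamma> t (pop \<Gamma> s M)"
  using touches_adjacent[OF assms]
  by (auto simp: on_top_def push_def pop_def untouched_def absorbed_def fun_eq_iff)

lemma step_commute:
  assumes "(s, t) \<in> E"
  shows "step \<Gamma> C (step \<Gamma> C M s) t = step \<Gamma> C (step \<Gamma> C M t) s"
  unfolding step_def using adjacent_simps[OF assms] adjacent_simps[OF E_sym[OF assms]]
  by (simp split: if_splits)

lemma on_top_push [simp]: "on_top \<Gamma> s (push \<Gamma> s M)"
  by (simp add: on_top_def push_def)

lemma pop_push [simp]: "pop \<Gamma> s (push \<Gamma> s M) = M"
  by (auto simp: pop_def push_def fun_eq_iff)

lemma push_pop: "on_top \<Gamma> s M \<Longrightarrow> push \<Gamma> s (pop \<Gamma> s M) = M"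
  unfolding on_top_def pop_def push_def fun_eq_iff by (metis list.collapse)

lemma on_top_not_untouched: "on_top \<Gamma> s M \<Longrightarrow> \<not> untouched \<Gamma> s M"
  unfolding on_top_def untouched_def using touches_self by blast

lemma not_on_top_empty [simp]: "\<not> on_top \<Gamma> s empty_stacks"
  using on_top_not_untouched by fastforce

text \<open>The stack of the pair \<open>{s, t}\<close> is the witness: its top is now
  \<open>t\<close>.\<close>

lemma not_on_top_push: "s \<noteq> t \<Longrightarrow> (s, t) \<notin> E \<Longrightarrow> \<not> on_top \<Gamma> s (push \<Gamma> t M)"
  unfolding on_top_def push_def not_all by (intro exI[of _ s] exI[of _ t]) (simp add: touches_def)

lemma not_untouched_push: "(s, t) \<notin> E \<Longrightarrow> \<not> untouched \<Gamma> s (push \<Gamma> t M)"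
  unfolding untouched_def push_def not_all by (intro exI[of _ s] exI[of _ t]) (simp add: touches_def)

lemma built_verts: "built \<Gamma> C M xs \<Longrightarrow> set xs \<subseteq> S"
  by (induction rule: built.induct) auto

lemma built_size: "built \<Gamma> C M xs \<Longrightarrow> stacks_size \<Gamma> M = length xs"
proof (induction rule: built.induct)
  case built_empty
  then show ?case by (simp add: stacks_size_def empty_stacks_def)
next
  case (built_push M xs s)
  have "stacks_size \<Gamma> (push \<Gamma> s M) = (\<Sum>x\<in>S. length (M x x) + (if x = s then 1 else 0))"
    unfolding stacks_size_def by (intro sum.cong) (auto simp: push_def touches_def)
  also have "\<dots> = stacks_size \<Gamma> M + 1"
    unfolding sum.distrib stacks_size_def using built_push.hyps(2) finite_S by simp
  finally show ?case using built_push by simp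
qed

text \<open>A pushed letter that is not adjacent to \<open>s\<close> fills a stack of
  \<open>s\<close>, and later pushes never empty it.\<close>

lemma built_untouched: "built \<Gamma> C M xs \<Longrightarrow> untouched \<Gamma> s M \<Longrightarrow> x \<in> set xs \<Longrightarrow> (s, x) \<in> E"
proof (induction rule: built.induct)
  case (built_push M xs t)
  have st: "(s, t) \<in> E" using built_push.prems(1) not_untouched_push by blast
  then show ?case using built_push adjacent_simps(3)[OF st] by auto
qed simp

lemma step_push: "\<not> on_top \<Gamma> s M \<Longrightarrow> \<not> absorbed \<Gamma> C s M \<Longrightarrow> step \<Gamma> C M s = push \<Gamma> s M"
  by (simp add: step_def)

section \<open>Group elements as words in the generators\<close>

lemma word_gwords: "set xs \<subseteq> S \<Longrightarrow> map (\<lambda>s. (s, True)) xs \<in> gwords S"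
  by (auto simp: gwords_def)

lemma el_append: "set xs \<subseteq> S \<Longrightarrow> set ys \<subseteq> S \<Longrightarrow> el (xs @ ys) = el xs \<otimes>\<^bsub>W\<^esub> el ys"
  unfolding racg_word_def racg_def by (subst mult_pres_class) (auto simp: gwords_def)

lemma el_carrier: "set xs \<subseteq> S \<Longrightarrow> el xs \<in> carrier W"
  unfolding racg_word_def racg_def presented_group_def using word_gwords by simp

lemma el_Nil [simp]: "el [] = \<one>\<^bsub>W\<^esub>"
  unfolding racg_word_def racg_def presented_group_def by simp

lemma el_relation:
  assumes "(map (\<lambda>s. (s, True)) l, map (\<lambda>s. (s, True)) r) \<in> racg_relations \<Gamma>" "set l \<subseteq> S" "set r \<subseteq> S"
  shows "el l = el r"
  unfolding racg_word_def
  using pres_eq.relation[of "[]" S "[]" _ _ "racg_relations \<Gamma>", OF _ _ assms(1)] assms(2,3)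
    word_gwords[of l] word_gwords[of r] by (intro pres_class_eqI) simp

lemma el_square: "s \<in> S \<Longrightarrow> el [s] \<otimes>\<^bsub>W\<^esub> el [s] = \<one>\<^bsub>W\<^esub>"
  using el_relation[of "[s, s]" "[]"] el_append[of "[s]" "[s]"] by (auto simp: racg_relations_def)

lemma el_commute: "(s, t) \<in> E \<Longrightarrow> el [s] \<otimes>\<^bsub>W\<^esub> el [t] = el [t] \<otimes>\<^bsub>W\<^esub> el [s]"
  using el_relation[of "[s, t]" "[t, s]"] el_append[of "[s]" "[t]"] el_append[of "[t]" "[s]"] E_verts
  by (auto simp: racg_relations_def)

sublocale W: Group.group W
  by (rule group_racg)

lemma el_gen_inv: "s \<in> S \<Longrightarrow> pres_class S (racg_relations \<Gamma>) [(s, b)] = el [s]"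
proof (cases b)
  case False
  assume s: "s \<in> S"
  have "pres_eq S (racg_relations \<Gamma>) ([] @ [(s, False), (s, \<not> False)] @ []) ([] @ [])"
    by (rule pres_eq.cancel) (use s in auto)
  then have "pres_class S (racg_relations \<Gamma>) [(s, False), (s, True)] = pres_class S (racg_relations \<Gamma>) []"
    by (intro pres_class_eqI) simp
  then have "pres_class S (racg_relations \<Gamma>) [(s, False)] \<otimes>\<^bsub>W\<^esub> el [s] = \<one>\<^bsub>W\<^esub>"
    using s mult_pres_class[of "[(s, False)]" S "[(s, True)]" "racg_relations \<Gamma>"]
    by (simp add: racg_word_def racg_def gwords_def) (simp add: presented_group_def)
  moreover have "pres_class S (racg_relations \<Gamma>) [(s, False)] \<in> carrier W"
    using s by (auto simp: racg_def presented_group_def gwords_def)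
  ultimately have "pres_class S (racg_relations \<Gamma>) [(s, False)] = el [s]"
    using W.right_cancel[of "el [s]" "pres_class S (racg_relations \<Gamma>) [(s, False)]" "el [s]"]
      el_square[OF s] el_carrier[of "[s]"] s by simp
  then show ?thesis using False by simp
qed (simp add: racg_word_def)

lemma carrier_el: "g \<in> carrier W \<Longrightarrow> \<exists>xs. set xs \<subseteq> S \<and> g = el xs"
proof -
  have "\<exists>xs. set xs \<subseteq> S \<and> pres_class S (racg_relations \<Gamma>) w = el xs" if "w \<in> gwords S" for w
  proof -
    have "pres_class S (racg_relations \<Gamma>) w = el (map fst w) \<and> set (map fst w) \<subseteq> S" using that
    proof (induction w)
      case (Cons x w)
      obtain s b where x: "x = (s, b)" by (cases x)
      have s: "s \<in> S" "w \<in> gwords S" using Cons.prems x by (auto simp: gwords_def)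
      have "pres_class S (racg_relations \<Gamma>) (x # w) =
          pres_class S (racg_relations \<Gamma>) [(s, b)] \<otimes>\<^bsub>W\<^esub> pres_class S (racg_relations \<Gamma>) w"
        unfolding racg_def using s x by (simp add: mult_pres_class gwords_def)
      also have "\<dots> = el (map fst (x # w))"
        using Cons.IH s x el_append[of "[s]" "map fst w"] el_gen_inv by simp
      finally show ?case using Cons.IH s x by simp
    qed (simp add: racg_word_def)
    then show ?thesis by blast
  qed
  moreover assume "g \<in> carrier W"
  ultimately show ?thesis by (auto simp: racg_def presented_group_def)
qed

text \<open>The exchange property in terms of stacks. Either \<open>s\<close> was pushed last, or
  the last letter is adjacent to \<open>s\<close> and the removal takes place below it. The first
  two conclusions say that a further step with \<open>s\<close> pushes it back, which makes
  \<open>step\<close> an involution.\<close>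

lemma built_pop:
  assumes "built \<Gamma> C M xs" "on_top \<Gamma> s M"
  shows "\<not> on_top \<Gamma> s (pop \<Gamma> s M) \<and> \<not> absorbed \<Gamma> C s (pop \<Gamma> s M) \<and>
    (\<exists>ys. built \<Gamma> C (pop \<Gamma> s M) ys \<and> el xs \<otimes>\<^bsub>W\<^esub> el [s] = el ys)"
  using assms
proof (induction rule: built.induct)
  case built_empty
  then show ?case by simp
next
  case (built_push M xs t)
  have v: "set xs \<subseteq> S" "t \<in> S" using built_verts[OF built_push.hyps(1)] built_push.hyps(2) by auto
  \<comment> \<open>Any other letter not adjacent to \<open>s\<close> would cover \<open>s\<close>
    in the stack of \<open>{s, t}\<close>.\<close>
  consider "s = t" | "(s, t) \<in> E" using not_on_top_push[of s t M] built_push.prems by argo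
  then show ?case
  proof cases
    case 1
    have "el (xs @ [t]) \<otimes>\<^bsub>W\<^esub> el [t] = el xs"
      using v el_append[of xs "[t]"] el_square[of t] by (simp add: W.m_assoc el_carrier)
    then show ?thesis using built_push.hyps 1 by auto
  next
    case 2
    have s: "s \<in> S" using 2 E_verts by blast
    note a = adjacent_simps(1,5,7)[OF 2] adjacent_simps(2,6)[OF E_sym[OF 2]]
    have top: "on_top \<Gamma> s M" using built_push.prems a(1) by simp
    then obtain ys where ys: "built \<Gamma> C (pop \<Gamma> s M) ys" "el xs \<otimes>\<^bsub>W\<^esub> el [s] = el ys"
      using built_push.IH by blast
    have "set ys \<subseteq> S" by (rule built_verts[OF ys(1)])
    then have "el (xs @ [t]) \<otimes>\<^bsub>W\<^esub> el [s] = el (ys @ [t])"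
      using v s el_append[of xs "[t]"] el_append[of ys "[t]"] el_commute[OF 2] ys(2)
        W.m_assoc[of "el xs" "el [t]" "el [s]"] W.m_assoc[of "el xs" "el [s]" "el [t]"]
      by (simp add: el_carrier)
    moreover have "built \<Gamma> C (push \<Gamma> t (pop \<Gamma> s M)) (ys @ [t])"
      using ys(1) v(2) built_push.hyps by (intro built.built_push) (simp_all add: a)
    ultimately show ?thesis using built_push.IH[OF top] by (auto simp: a)
  qed
qed

text \<open>For arbitrary stacks this fails: after a pop, \<open>s\<close> might be on top again or
  be absorbed. \<open>built_pop\<close> excludes both for states of built words.\<close>

lemma step_step:
  assumes "built \<Gamma> C M xs"
  shows "step \<Gamma> C (step \<Gamma> C M s) s = M"
proof (cases "on_top \<Gamma> s M")
  case True
  then show ?thesis using built_pop[OF assms True] push_pop[OF True] by (simp add: step_def)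
qed (auto simp: step_def)

lemma el_commute_word:
  assumes "s \<in> S" "\<And>x. x \<in> set xs \<Longrightarrow> (s, x) \<in> E"
  shows "el [s] \<otimes>\<^bsub>W\<^esub> el xs = el xs \<otimes>\<^bsub>W\<^esub> el [s]"
  using assms(2)
proof (induction xs)
  case (Cons x xs)
  have v: "x \<in> S" "set xs \<subseteq> S" using Cons.prems E_verts by auto
  have "el [s] \<otimes>\<^bsub>W\<^esub> el (x # xs) = el [s] \<otimes>\<^bsub>W\<^esub> el [x] \<otimes>\<^bsub>W\<^esub> el xs"
    using v el_append[of "[x]" xs] assms(1) by (simp add: W.m_assoc el_carrier)
  also have "\<dots> = el [x] \<otimes>\<^bsub>W\<^esub> (el [s] \<otimes>\<^bsub>W\<^esub> el xs)"
    using v assms(1) el_commute[of s x] Cons.prems by (simp add: W.m_assoc el_carrier)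
  also have "\<dots> = el (x # xs) \<otimes>\<^bsub>W\<^esub> el [s]"
    using Cons v el_append[of "[x]" xs] assms(1) by (simp add: W.m_assoc el_carrier)
  finally show ?case .
qed (use assms el_carrier in simp)

lemma built_step:
  assumes "built \<Gamma> C M xs" "s \<in> S"
  shows "(absorbed \<Gamma> C s M \<and> step \<Gamma> C M s = M) \<or>
    (\<exists>ys. built \<Gamma> C (step \<Gamma> C M s) ys \<and> el xs \<otimes>\<^bsub>W\<^esub> el [s] = el ys)"
proof (cases "on_top \<Gamma> s M")
  case True
  then show ?thesis using built_pop[OF assms(1) True] by (auto simp: step_def)
next
  case False
  show ?thesis
  proof (cases "absorbed \<Gamma> C s M")
    case True
    then show ?thesis using False by (simp add: step_def)
  next
    case nf: False
    show ?thesis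
      using built.built_push[OF assms False nf] el_append[of xs "[s]"] assms built_verts False nf
      by (auto simp: step_def)
  qed
qed

lemma built_step_ex: "built \<Gamma> C M xs \<Longrightarrow> s \<in> S \<Longrightarrow> \<exists>ys. built \<Gamma> C (step \<Gamma> C M s) ys"
  using built_step by metis

lemma run_append: "run \<Gamma> C (xs @ ys) = foldl (step \<Gamma> C) (run \<Gamma> C xs) ys"
  by (simp add: run_def)

lemma run_snoc: "run \<Gamma> C (xs @ [s]) = step \<Gamma> C (run \<Gamma> C xs) s"
  by (simp add: run_def)

lemma built_run: "set xs \<subseteq> S \<Longrightarrow> \<exists>ys. built \<Gamma> C (run \<Gamma> C xs) ys"
proof (induction xs rule: rev_induct)
  case Nil
  then show ?case using built_empty by (auto simp: run_def)
next
  case (snoc s xs)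
  then show ?case using built_step_ex run_snoc by auto
qed

text \<open>Van der Waerden's argument: the relations act trivially on states, so a state belongs to
  a group element. Signs are forgotten by \<open>map fst\<close>, as a generator and its formal
  inverse act alike; both cancellation and the relation \<open>s^2 = 1\<close> are then instances of
  \<open>step_step\<close>.\<close>

lemma run_pres_eq:
  "pres_eq S (racg_relations \<Gamma>) u v \<Longrightarrow> run \<Gamma> C (map fst u) = run \<Gamma> C (map fst v)"
proof (induction rule: pres_eq.induct)
  case (cancel u v s b)
  have "set (map fst u) \<subseteq> S" using cancel by (auto simp: gwords_def)
  then obtain ys where ys: "built \<Gamma> C (run \<Gamma> C (map fst u)) ys"
    using built_run by blast
  show ?case using step_step[OF ys] by (simp add: run_append)
next
  case (relation u v l r)
  have "set (map fst u) \<subseteq> S" using relation by (auto simp: gwords_def)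
  then obtain ys where ys: "built \<Gamma> C (run \<Gamma> C (map fst u)) ys"
    using built_run by blast
  let ?M = "run \<Gamma> C (map fst u)"
  consider s where "l = [(s, True), (s, True)]" "r = []"
    | s t where "l = [(s, True), (t, True)]" "r = [(t, True), (s, True)]" "(s, t) \<in> E"
    using relation(3) unfolding racg_relations_def by blast
  then have "foldl (step \<Gamma> C) ?M (map fst l) = foldl (step \<Gamma> C) ?M (map fst r)"
  proof cases
    case 1
    then show ?thesis using step_step[OF ys] by simp
  next
    case 2
    then show ?thesis using step_commute[of s t C ?M] by simp
  qed
  then show ?case by (simp add: run_append)
qed simp_all

lemma run_el:
  assumes "el xs = el ys" "set xs \<subseteq> S" "set ys \<subseteq> S"
  shows "run \<Gamma> C xs = run \<Gamma> C ys"
proof -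
  have "map (\<lambda>s. (s, True)) ys \<in> gwords S" using assms(3) by (auto simp: gwords_def)
  then have "map (\<lambda>s. (s, True)) ys \<in> pres_class S (racg_relations \<Gamma>) (map (\<lambda>s. (s, True)) xs)"
    using assms(1) unfolding racg_word_def pres_class_def by (auto intro: pres_eq.refl)
  then show ?thesis using run_pres_eq[of "map (\<lambda>s. (s, True)) xs"] unfolding pres_class_def
    by (auto simp: comp_def)
qed

section \<open>Word length, coset states and heights\<close>

definition word_subgroup :: "'v set \<Rightarrow> 'v gword set set" where
  "word_subgroup C = {el xs | xs. set xs \<subseteq> C}"

definition slen :: "'v gword set \<Rightarrow> nat" where
  "slen g = (LEAST n. \<exists>xs. set xs \<subseteq> S \<and> length xs = n \<and> el xs = g)"

text \<open>On the carrier the choice of the word is immaterial by \<open>run_el\<close>.\<close>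

definition state :: "'v set \<Rightarrow> 'v gword set \<Rightarrow> 'v stacks" where
  "state C g = run \<Gamma> C (SOME xs. set xs \<subseteq> S \<and> el xs = g)"

text \<open>The distance to \<open>word_subgroup C\<close> in the word metric of the generators, by
  \<open>height_attained\<close> and \<open>height_le\<close>.\<close>

definition height :: "'v set \<Rightarrow> 'v gword set \<Rightarrow> nat" where
  "height C g = stacks_size \<Gamma> (state C g)"

lemma slen_word:
  assumes "g \<in> carrier W"
  shows "\<exists>xs. set xs \<subseteq> S \<and> length xs = slen g \<and> el xs = g"
proof -
  obtain xs where "set xs \<subseteq> S" "el xs = g" using carrier_el[OF assms] by metis
  then have "\<exists>n xs. set xs \<subseteq> S \<and> length xs = n \<and> el xs = g" by blast
  then show ?thesis unfolding slen_def by (rule LeastI_ex)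
qed

lemma slen_le: "set xs \<subseteq> S \<Longrightarrow> slen (el xs) \<le> length xs"
  unfolding slen_def by (intro Least_le) blast

lemma slen_one [simp]: "slen \<one>\<^bsub>W\<^esub> = 0"
  using slen_le[of "[]"] by simp

lemma slen_mult:
  assumes "g \<in> carrier W" "h \<in> carrier W"
  shows "slen (g \<otimes>\<^bsub>W\<^esub> h) \<le> slen g + slen h"
proof -
  obtain xs ys where x: "set xs \<subseteq> S" "length xs = slen g" "el xs = g"
    and y: "set ys \<subseteq> S" "length ys = slen h" "el ys = h"
    using slen_word assms by metis
  have "slen (el (xs @ ys)) \<le> length (xs @ ys)" using x y by (intro slen_le) auto
  then show ?thesis using x y el_append by simp
qed

lemma el_rev: "set xs \<subseteq> S \<Longrightarrow> el (rev xs) \<otimes>\<^bsub>W\<^esub> el xs = \<one>\<^bsub>W\<^esub>"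
proof (induction xs)
  case (Cons x xs)
  have v: "x \<in> S" "set xs \<subseteq> S" using Cons.prems by auto
  have "el (rev (x # xs)) \<otimes>\<^bsub>W\<^esub> el (x # xs) =
      el (rev xs) \<otimes>\<^bsub>W\<^esub> (el [x] \<otimes>\<^bsub>W\<^esub> (el [x] \<otimes>\<^bsub>W\<^esub> el xs))"
    using v el_append[of "rev xs" "[x]"] el_append[of "[x]" xs] by (simp add: W.m_assoc el_carrier)
  also have "el [x] \<otimes>\<^bsub>W\<^esub> (el [x] \<otimes>\<^bsub>W\<^esub> el xs) = el xs"
    using v el_square[of x] el_carrier[of xs] el_carrier[of "[x]"] by (simp add: W.m_assoc[symmetric])
  finally show ?case using Cons.IH v by simp
qed simp

lemma inv_el: "set xs \<subseteq> S \<Longrightarrow> inv\<^bsub>W\<^esub> (el xs) = el (rev xs)"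
  using el_rev by (intro W.inv_equality) (auto simp: el_carrier)

lemma slen_inv:
  assumes "g \<in> carrier W"
  shows "slen (inv\<^bsub>W\<^esub> g) = slen g"
proof -
  have le: "slen (inv\<^bsub>W\<^esub> g) \<le> slen g" if g: "g \<in> carrier W" for g
  proof -
    obtain xs where "set xs \<subseteq> S" "length xs = slen g" "el xs = g" using slen_word[OF g] by blast
    then show ?thesis using slen_le[of "rev xs"] inv_el[of xs] by simp
  qed
  from le[OF assms] le[of "inv\<^bsub>W\<^esub> g"] assms show ?thesis by (intro antisym) simp_all
qed

lemma state_el: "set xs \<subseteq> S \<Longrightarrow> state C (el xs) = run \<Gamma> C xs"
  unfolding state_def
  by (rule someI2[of "\<lambda>ys. set ys \<subseteq> S \<and> el ys = el xs" xs]) (auto intro: run_el)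

lemma state_mult_gen:
  assumes "g \<in> carrier W" "s \<in> S"
  shows "state C (g \<otimes>\<^bsub>W\<^esub> el [s]) = step \<Gamma> C (state C g) s"
proof -
  obtain xs where "set xs \<subseteq> S" "g = el xs" using carrier_el[OF assms(1)] by blast
  then show ?thesis using assms state_el[of xs] state_el[of "xs @ [s]"] run_snoc el_append[of xs "[s]"]
    by simp
qed

lemma run_subgroup: "set zs \<subseteq> C \<Longrightarrow> run \<Gamma> C zs = empty_stacks"
proof (induction zs rule: rev_induct)
  case (snoc s zs)
  then show ?case using run_snoc[of C zs s] by (simp add: step_def absorbed_def)
qed (simp add: run_def)

lemma word_subgroup_carrier: "C \<subseteq> S \<Longrightarrow> word_subgroup C \<subseteq> carrier W"
  unfolding word_subgroup_def using el_carrier by auto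

lemma word_subgroup_mult:
  assumes "C \<subseteq> S" "g \<in> word_subgroup C" "h \<in> word_subgroup C"
  shows "g \<otimes>\<^bsub>W\<^esub> h \<in> word_subgroup C"
proof -
  obtain xs ys where xy: "g = el xs" "h = el ys" "set xs \<subseteq> C" "set ys \<subseteq> C"
    using assms by (auto simp: word_subgroup_def)
  then have "g \<otimes>\<^bsub>W\<^esub> h = el (xs @ ys)" using assms(1) el_append[of xs ys] by auto
  then show ?thesis unfolding word_subgroup_def using xy by force
qed

lemma word_subgroup_inv:
  assumes "C \<subseteq> S" "g \<in> word_subgroup C"
  shows "inv\<^bsub>W\<^esub> g \<in> word_subgroup C"
proof -
  obtain xs where xs: "g = el xs" "set xs \<subseteq> C" using assms by (auto simp: word_subgroup_def)
  then show ?thesis using assms(1) inv_el[of xs] unfolding word_subgroup_def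
    by (intro CollectI exI[of _ "rev xs"]) auto
qed

lemma word_subgroup_gen: "s \<in> C \<Longrightarrow> el [s] \<in> word_subgroup C"
  unfolding word_subgroup_def by force

lemma word_subgroup_one: "\<one>\<^bsub>W\<^esub> \<in> word_subgroup C"
  unfolding word_subgroup_def by (intro CollectI exI[of _ "[]"]) simp

text \<open>Words without inverse letters suffice because the generators are involutions; the
  inverse of a word is its reversal.\<close>

lemma word_subgroup_generate:
  assumes "C \<subseteq> S"
  shows "generate W (racg_gen \<Gamma> ` C) = word_subgroup C"
proof
  have gen: "racg_gen \<Gamma> s = el [s]" for s by (simp add: racg_gen_def racg_word_def)
  have "subgroup (word_subgroup C) W"
  proof (rule W.subgroupI)
    show "word_subgroup C \<noteq> {}" using word_subgroup_one by blast
  qed (use word_subgroup_carrier[OF assms] word_subgroup_mult[OF assms] word_subgroup_inv[OF assms] in auto)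
  then show "generate W (racg_gen \<Gamma> ` C) \<subseteq> word_subgroup C"
    using W.generate_subgroup_incl[of "racg_gen \<Gamma> ` C"] word_subgroup_gen gen by auto
  have "el xs \<in> generate W (racg_gen \<Gamma> ` C)" if "set xs \<subseteq> C" for xs
    using that
  proof (induction xs)
    case (Cons x xs)
    have x: "x \<in> S" "set xs \<subseteq> S" using Cons.prems assms by auto
    have "el [x] \<in> generate W (racg_gen \<Gamma> ` C)"
      using Cons.prems gen[of x] by (intro generate.incl) auto
    then show ?case using generate.eng Cons x el_append[of "[x]" xs] by fastforce
  qed (simp add: generate.one)
  then show "word_subgroup C \<subseteq> generate W (racg_gen \<Gamma> ` C)" by (auto simp: word_subgroup_def)
qed

text \<open>A word over \<open>C\<close> leaves the empty state fixed, so a word for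
  \<open>g\<close> read after a word for \<open>h\<close> ends in the same state as alone.\<close>

lemma height_mult_left:
  assumes "C \<subseteq> S" "h \<in> word_subgroup C" "g \<in> carrier W"
  shows "height C (h \<otimes>\<^bsub>W\<^esub> g) = height C g"
proof -
  obtain zs where zs: "h = el zs" "set zs \<subseteq> C" using assms by (auto simp: word_subgroup_def)
  obtain xs where xs: "g = el xs" "set xs \<subseteq> S" using carrier_el[OF assms(3)] by blast
  have "run \<Gamma> C (zs @ xs) = run \<Gamma> C xs"
    using run_subgroup[OF zs(2)] by (simp add: run_append) (simp add: run_def)
  then have "state C (el (zs @ xs)) = state C (el xs)"
    using zs xs assms(1) by (subst (1 2) state_el) auto
  then show ?thesis using zs xs assms(1) el_append[of zs xs] unfolding height_def by auto
qed

lemma stacks_size_step: "stacks_size \<Gamma> (step \<Gamma> C M s) \<le> stacks_size \<Gamma> M + 1"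
proof -
  have "stacks_size \<Gamma> (step \<Gamma> C M s) \<le> (\<Sum>x\<in>S. length (M x x) + (if x = s then 1 else 0))"
    unfolding stacks_size_def by (intro sum_mono) (auto simp: step_def push_def pop_def touches_def)
  also have "\<dots> \<le> stacks_size \<Gamma> M + 1"
    unfolding sum.distrib stacks_size_def using finite_S by simp
  finally show ?thesis .
qed

lemma run_size: "stacks_size \<Gamma> (run \<Gamma> C xs) \<le> length xs"
proof (induction xs rule: rev_induct)
  case (snoc s xs)
  then show ?case using stacks_size_step[of C "run \<Gamma> C xs" s] run_snoc[of C xs s] by simp
qed (simp add: run_def stacks_size_def empty_stacks_def)

lemma height_le_slen:
  assumes "g \<in> carrier W"
  shows "height C g \<le> slen g"
proof -
  obtain xs where "set xs \<subseteq> S" "length xs = slen g" "el xs = g" using slen_word[OF assms] by blast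
  then show ?thesis using state_el[of xs C] run_size[of C xs] by (auto simp: height_def)
qed

section \<open>Subgroup coordinate and transversal coordinate\<close>

definition decomposed :: "'v set \<Rightarrow> 'v gword set \<Rightarrow> 'v gword set \<Rightarrow> 'v list \<Rightarrow> bool" where
  "decomposed C g k ys \<longleftrightarrow> k \<in> word_subgroup C \<and> built \<Gamma> C (state C g) ys \<and> g = k \<otimes>\<^bsub>W\<^esub> el ys"

text \<open>An absorbed \<open>s\<close> commutes with all letters of \<open>ys\<close> and moves in
  front of them, into \<open>k\<close>. In every other case the letter acts on the transversal word
  only.\<close>

lemma decomposed_step:
  assumes C: "C \<subseteq> S" and d: "decomposed C g k ys" and s: "s \<in> S"
  shows "(\<exists>zs. decomposed C (g \<otimes>\<^bsub>W\<^esub> el [s]) k zs \<and> el zs = el ys \<otimes>\<^bsub>W\<^esub> el [s]) \<or>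
    (s \<in> C \<and> (\<forall>x\<in>set ys. (s, x) \<in> E) \<and> decomposed C (g \<otimes>\<^bsub>W\<^esub> el [s]) (k \<otimes>\<^bsub>W\<^esub> el [s]) ys)"
proof -
  have k: "k \<in> word_subgroup C" and b: "built \<Gamma> C (state C g) ys" and g: "g = k \<otimes>\<^bsub>W\<^esub> el ys"
    using d by (auto simp: decomposed_def)
  have kc: "k \<in> carrier W" using k word_subgroup_carrier[OF C] by blast
  have yc: "el ys \<in> carrier W" "el [s] \<in> carrier W" using built_verts[OF b] s el_carrier by auto
  have st: "state C (g \<otimes>\<^bsub>W\<^esub> el [s]) = step \<Gamma> C (state C g) s"
    using g kc yc s by (intro state_mult_gen) auto
  from built_step[OF b s] show ?thesis
  proof
    assume a: "absorbed \<Gamma> C s (state C g) \<and> step \<Gamma> C (state C g) s = state C g"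
    then have sC: "s \<in> C" and adj: "\<forall>x\<in>set ys. (s, x) \<in> E"
      using built_untouched[OF b] by (auto simp: absorbed_def)
    have "g \<otimes>\<^bsub>W\<^esub> el [s] = (k \<otimes>\<^bsub>W\<^esub> el [s]) \<otimes>\<^bsub>W\<^esub> el ys"
      unfolding g using kc yc el_commute_word[OF s, of ys] adj by (simp add: W.m_assoc)
    then show ?thesis
      using a b st sC adj word_subgroup_mult[OF C k word_subgroup_gen[OF sC]]
      by (auto simp: decomposed_def)
  next
    assume "\<exists>zs. built \<Gamma> C (step \<Gamma> C (state C g) s) zs \<and> el ys \<otimes>\<^bsub>W\<^esub> el [s] = el zs"
    then obtain zs where zs: "built \<Gamma> C (step \<Gamma> C (state C g) s) zs" "el ys \<otimes>\<^bsub>W\<^esub> el [s] = el zs" by blast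
    then have "g \<otimes>\<^bsub>W\<^esub> el [s] = k \<otimes>\<^bsub>W\<^esub> el zs" unfolding g using kc yc by (simp add: W.m_assoc)
    then show ?thesis using zs st k by (auto simp: decomposed_def)
  qed
qed

lemma decomposed_exists:
  assumes C: "C \<subseteq> S" and "g \<in> carrier W"
  shows "\<exists>k ys. decomposed C g k ys"
proof -
  have "\<exists>k ys. decomposed C (el xs) k ys" if "set xs \<subseteq> S" for xs
    using that
  proof (induction xs rule: rev_induct)
    case Nil
    have "built \<Gamma> C (state C (el [])) []" using state_el[of "[]" C] built_empty by (simp add: run_def)
    then show ?case using word_subgroup_one unfolding decomposed_def
      by (intro exI[of _ "\<one>\<^bsub>W\<^esub>"] exI[of _ "[]"]) simp
  next
    case (snoc s xs)
    then obtain k ys where "decomposed C (el xs) k ys" by auto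
    then show ?case using decomposed_step[OF C, of "el xs" k ys s] snoc.prems el_append[of xs "[s]"]
      by auto
  qed
  then show ?thesis using carrier_el[OF assms(2)] by blast
qed

lemma decomposed_simps:
  assumes "C \<subseteq> S" "decomposed C g k ys"
  shows "height C g = length ys" "g = k \<otimes>\<^bsub>W\<^esub> el ys" "k \<in> word_subgroup C" "k \<in> carrier W"
    "el ys \<in> carrier W" "set ys \<subseteq> S" "g \<in> carrier W"
  using assms word_subgroup_carrier[OF assms(1)] built_size[of C "state C g" ys] built_verts[of C "state C g" ys]
  by (auto simp: decomposed_def height_def el_carrier)

lemma height_attained:
  assumes "C \<subseteq> S" "g \<in> carrier W"
  shows "\<exists>k\<in>word_subgroup C. slen (inv\<^bsub>W\<^esub> k \<otimes>\<^bsub>W\<^esub> g) \<le> height C g"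
proof -
  obtain k ys where d: "decomposed C g k ys" using decomposed_exists[OF assms] by blast
  note s = decomposed_simps[OF assms(1) d]
  have "inv\<^bsub>W\<^esub> k \<otimes>\<^bsub>W\<^esub> g = el ys" using s by (simp add: W.m_assoc[symmetric])
  then show ?thesis using s slen_le[of ys] by (intro bexI[of _ k]) auto
qed

lemma height_le:
  assumes "C \<subseteq> S" "g \<in> carrier W" "k \<in> word_subgroup C"
  shows "height C g \<le> slen (inv\<^bsub>W\<^esub> k \<otimes>\<^bsub>W\<^esub> g)"
  using height_mult_left[OF assms(1) word_subgroup_inv[OF assms(1,3)] assms(2)]
    height_le_slen[of "inv\<^bsub>W\<^esub> k \<otimes>\<^bsub>W\<^esub> g" C] word_subgroup_carrier[OF assms(1)] assms by auto

lemma height_lipschitz: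
  assumes C: "C \<subseteq> S" and g: "g \<in> carrier W" and h: "h \<in> carrier W"
  shows "height C g \<le> height C h + slen (inv\<^bsub>W\<^esub> g \<otimes>\<^bsub>W\<^esub> h)"
proof -
  obtain k where k: "k \<in> word_subgroup C" "slen (inv\<^bsub>W\<^esub> k \<otimes>\<^bsub>W\<^esub> h) \<le> height C h"
    using height_attained[OF C h] by blast
  have kc: "k \<in> carrier W" using k word_subgroup_carrier[OF C] by blast
  have "inv\<^bsub>W\<^esub> k \<otimes>\<^bsub>W\<^esub> g = (inv\<^bsub>W\<^esub> k \<otimes>\<^bsub>W\<^esub> h) \<otimes>\<^bsub>W\<^esub> inv\<^bsub>W\<^esub> (inv\<^bsub>W\<^esub> g \<otimes>\<^bsub>W\<^esub> h)"
    using kc g h by (simp add: W.inv_mult_group W.m_assoc W.inv_solve_left)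
       (simp add: W.m_assoc[symmetric])
  then have "slen (inv\<^bsub>W\<^esub> k \<otimes>\<^bsub>W\<^esub> g) \<le> slen (inv\<^bsub>W\<^esub> k \<otimes>\<^bsub>W\<^esub> h) + slen (inv\<^bsub>W\<^esub> g \<otimes>\<^bsub>W\<^esub> h)"
    using slen_mult[of "inv\<^bsub>W\<^esub> k \<otimes>\<^bsub>W\<^esub> h" "inv\<^bsub>W\<^esub> (inv\<^bsub>W\<^esub> g \<otimes>\<^bsub>W\<^esub> h)"] slen_inv kc g h by simp
  then show ?thesis using height_le[OF C g k(1)] k(2) by linarith
qed

section \<open>Words in pairwise non-adjacent letters\<close>

text \<open>Nothing commutes here, so a letter can cancel only against an equal neighbour and be
  absorbed only at the front. The invariant behind both facts is that the state is a push of the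
  last letter.\<close>

lemma built_independent:
  assumes "set xs \<subseteq> S" "distinct_adj xs" "\<And>x y. x \<in> set xs \<Longrightarrow> y \<in> set xs \<Longrightarrow> (x, y) \<notin> E"
    "xs \<noteq> [] \<Longrightarrow> hd xs \<notin> C"
  shows "built \<Gamma> C (run \<Gamma> C xs) xs \<and> (xs \<noteq> [] \<longrightarrow> (\<exists>M. run \<Gamma> C xs = push \<Gamma> (last xs) M))"
  using assms
proof (induction xs rule: rev_induct)
  case Nil
  then show ?case using built_empty by (simp add: run_def)
next
  case (snoc s xs)
  have da: "distinct_adj xs" "xs = [] \<or> last xs \<noteq> s"
    using snoc.prems(2) by (auto simp: distinct_adj_append_iff)
  have IH: "built \<Gamma> C (run \<Gamma> C xs) xs \<and> (xs \<noteq> [] \<longrightarrow> (\<exists>M. run \<Gamma> C xs = push \<Gamma> (last xs) M))"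
    using snoc.prems da by (intro snoc.IH) (auto simp: hd_append)
  have no: "\<not> on_top \<Gamma> s (run \<Gamma> C xs) \<and> \<not> absorbed \<Gamma> C s (run \<Gamma> C xs)"
  proof (cases "xs = []")
    case True
    then show ?thesis using snoc.prems(4)
      by (auto simp: run_def absorbed_def)
  next
    case False
    then obtain M where M: "run \<Gamma> C xs = push \<Gamma> (last xs) M" using IH by blast
    have "(s, last xs) \<notin> E" using snoc.prems(3) False by auto
    then show ?thesis using M False da not_on_top_push[of s "last xs" M] not_untouched_push[of s "last xs" M]
      by (auto simp: absorbed_def)
  qed
  then have "run \<Gamma> C (xs @ [s]) = push \<Gamma> s (run \<Gamma> C xs)" using run_snoc step_push by simp
  then show ?case using built_push[of \<Gamma> C "run \<Gamma> C xs" xs s] IH no snoc.prems(1) by auto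
qed

lemma height_independent:
  assumes "set xs \<subseteq> S" "distinct_adj xs" "\<And>x y. x \<in> set xs \<Longrightarrow> y \<in> set xs \<Longrightarrow> (x, y) \<notin> E"
    "xs \<noteq> [] \<Longrightarrow> hd xs \<notin> C"
  shows "height C (el xs) = length xs"
  using built_independent[OF assms] built_size[of C "run \<Gamma> C xs" xs] state_el[of xs C] assms(1)
  by (auto simp: height_def)

lemma built_independentD:
  assumes "built \<Gamma> C M xs" "\<And>x y. x \<in> set xs \<Longrightarrow> y \<in> set xs \<Longrightarrow> (x, y) \<notin> E"
  shows "distinct_adj xs \<and> (if xs = [] then M = empty_stacks else hd xs \<notin> C \<and> (\<exists>N. M = push \<Gamma> (last xs) N))"
  using assms
proof (induction rule: built.induct)
  case (built_push M xs s)
  have IH: "distinct_adj xs \<and> (if xs = [] then M = empty_stacks else hd xs \<notin> C \<and> (\<exists>N. M = push \<Gamma> (last xs) N))"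
    using built_push.prems by (intro built_push.IH) auto
  show ?case
  proof (cases "xs = []")
    case True
    then show ?thesis using IH built_push.hyps(4) by (auto simp: absorbed_def)
  next
    case False
    then show ?thesis using IH built_push.hyps(3) by (auto simp: distinct_adj_append_iff)
  qed
qed simp

text \<open>The form in which condition (2) enters the geometry: it limits the letters outside
  \<open>C\<close> that the links of two generators can share.\<close>

definition link_condition :: "'v set \<Rightarrow> bool" where
  "link_condition C \<longleftrightarrow> (\<forall>a\<in>C. \<forall>c\<in>C. \<forall>x y. a \<noteq> c \<and> (a, x) \<in> E \<and> (c, x) \<in> E \<and> (a, y) \<in> E \<and> (c, y) \<in> E \<and> x \<notin> C
     \<longrightarrow> x = y)"

lemma link_independent:
  "triangle_free \<Gamma> \<Longrightarrow> (a, x) \<in> E \<Longrightarrow> (a, y) \<in> E \<Longrightarrow> (x, y) \<notin> E"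
  unfolding triangle_free_def using E_sym by blast

text \<open>The word \<open>xs\<close> is compared with the cosets of the subgroup generated by the link of \<open>c\<close>: that
  subgroup contains \<open>el ys\<close>, and it can absorb at most the first letter of \<open>xs\<close>.\<close>

lemma wall_separation:
  assumes tf: "triangle_free \<Gamma>" and lc: "link_condition C" and ac: "a \<in> C" "c \<in> C" "a \<noteq> c"
    and xs: "built \<Gamma> C M xs" "\<And>x. x \<in> set xs \<Longrightarrow> (a, x) \<in> E"
    and ys: "\<And>y. y \<in> set ys \<Longrightarrow> (c, y) \<in> E"
  shows "length xs \<le> slen (inv\<^bsub>W\<^esub> (el xs) \<otimes>\<^bsub>W\<^esub> el ys) + 1"
proof (cases "xs = []")
  case False
  let ?C = "{y. (c, y) \<in> E}"
  have CS: "?C \<subseteq> S" using E_verts by auto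
  have ind: "\<And>x y. x \<in> set xs \<Longrightarrow> y \<in> set xs \<Longrightarrow> (x, y) \<notin> E"
    using link_independent[OF tf] xs(2) by blast
  \<comment> \<open>\<open>xs\<close> is shortest modulo \<open>C\<close>, so its first letter lies
    outside \<open>C\<close>, as the application of \<open>link_condition\<close> below
    requires.\<close>
  have da: "distinct_adj xs" "hd xs \<notin> C" using built_independentD[OF xs(1) ind] False by auto
  have xS: "set xs \<subseteq> S" by (rule built_verts[OF xs(1)])
  have yS: "set ys \<subseteq> S" using ys CS by auto
  have yC: "el ys \<in> word_subgroup ?C" unfolding word_subgroup_def using ys by auto
  have c: "el xs \<in> carrier W" "el ys \<in> carrier W" using xS yS el_carrier by auto
  obtain x zs where x: "xs = x # zs" using False by (cases xs) auto
  have "length xs \<le> height ?C (el xs) + 1"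
  proof (cases "x \<in> ?C")
    case False
    then have "height ?C (el xs) = length xs"
      using xS da ind x by (intro height_independent) auto
    then show ?thesis by simp
  next
    case True
    \<comment> \<open>A second letter in the link of \<open>c\<close> would be another common
      neighbour of \<open>a\<close> and \<open>c\<close> besides \<open>x\<close>. So absorption
      ends after one letter; this is the \<open>+ 1\<close> of the claim.\<close>
    have zs: "hd zs \<notin> ?C" if "zs \<noteq> []"
    proof
      assume h: "hd zs \<in> ?C"
      have "x \<noteq> hd zs" using da(1) that x by (simp add: distinct_adj_Cons)
      moreover have "(a, x) \<in> E" "(a, hd zs) \<in> E" using xs(2) that x by auto
      moreover have "x \<notin> C" using da x by simp
      ultimately show False using lc ac True h unfolding link_condition_def by blast
    qed
    have "height ?C (el zs) = length zs"
      using xS da(1) ind x zs by (intro height_independent) (auto simp: distinct_adj_Cons)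
    moreover have "height ?C (el xs) = height ?C (el zs)"
      using height_mult_left[OF CS word_subgroup_gen[of x ?C], of "el zs"] True xS x
        el_append[of "[x]" zs] el_carrier[of zs] by simp
    ultimately show ?thesis using x by simp
  qed
  also have "height ?C (el xs) \<le> slen (inv\<^bsub>W\<^esub> (el ys) \<otimes>\<^bsub>W\<^esub> el xs)"
    by (rule height_le[OF CS c(1) yC])
  also have "\<dots> = slen (inv\<^bsub>W\<^esub> (el xs) \<otimes>\<^bsub>W\<^esub> el ys)"
    using slen_inv[of "inv\<^bsub>W\<^esub> (el xs) \<otimes>\<^bsub>W\<^esub> el ys"] c by (simp add: W.inv_mult_group)
  finally show ?thesis by simp
qed simp

end

section \<open>Divergence in the word metric\<close>

text \<open>Reduced words of an infinite dihedral group; they become the coordinate lines of the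
  flats.\<close>

fun alternating :: "'a \<Rightarrow> 'a \<Rightarrow> nat \<Rightarrow> 'a list" where
  "alternating a c 0 = []"
| "alternating a c (Suc n) = a # alternating c a n"

lemma length_alternating [simp]: "length (alternating a c n) = n"
  by (induction n arbitrary: a c) auto

lemma set_alternating: "set (alternating a c n) \<subseteq> {a, c}"
  by (induction n arbitrary: a c) auto

lemma hd_alternating: "alternating a c n \<noteq> [] \<Longrightarrow> hd (alternating a c n) = a"
  by (cases n) auto

lemma distinct_adj_alternating: "a \<noteq> c \<Longrightarrow> distinct_adj (alternating a c n)"
proof (induction n arbitrary: a c)
  case (Suc n)
  then show ?case using hd_alternating[of c a n] by (auto simp: distinct_adj_Cons)
qed simp

lemma alternating_add:
  "alternating a c (m + n) = alternating a c m @ (if even m then alternating a c n else alternating c a n)"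
  by (induction m arbitrary: a c) auto

context right_angled_coxeter
begin

abbreviation wdist :: "'v gword set \<Rightarrow> 'v gword set \<Rightarrow> nat" where
  "wdist g h \<equiv> slen (inv\<^bsub>W\<^esub> g \<otimes>\<^bsub>W\<^esub> h)"

lemma wdist_sym: "g \<in> carrier W \<Longrightarrow> h \<in> carrier W \<Longrightarrow> wdist g h = wdist h g"
  using slen_inv[of "inv\<^bsub>W\<^esub> g \<otimes>\<^bsub>W\<^esub> h"] by (simp add: W.inv_mult_group)

lemma inv_mult_split:
  assumes "g \<in> carrier W" "h \<in> carrier W" "k \<in> carrier W"
  shows "inv\<^bsub>W\<^esub> g \<otimes>\<^bsub>W\<^esub> k = (inv\<^bsub>W\<^esub> g \<otimes>\<^bsub>W\<^esub> h) \<otimes>\<^bsub>W\<^esub> (inv\<^bsub>W\<^esub> h \<otimes>\<^bsub>W\<^esub> k)"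
proof -
  have "h \<otimes>\<^bsub>W\<^esub> (inv\<^bsub>W\<^esub> h \<otimes>\<^bsub>W\<^esub> k) = k" using assms by (simp add: W.m_assoc[symmetric])
  then show ?thesis using assms by (simp add: W.m_assoc)
qed

lemma wdist_triangle:
  "g \<in> carrier W \<Longrightarrow> h \<in> carrier W \<Longrightarrow> k \<in> carrier W \<Longrightarrow> wdist g k \<le> wdist g h + wdist h k"
  using slen_mult[of "inv\<^bsub>W\<^esub> g \<otimes>\<^bsub>W\<^esub> h" "inv\<^bsub>W\<^esub> h \<otimes>\<^bsub>W\<^esub> k"] inv_mult_split[of g h k] by simp

lemma wdist_mult:
  "g \<in> carrier W \<Longrightarrow> h \<in> carrier W \<Longrightarrow> k \<in> carrier W \<Longrightarrow> wdist g (h \<otimes>\<^bsub>W\<^esub> k) \<le> wdist g h + slen k"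
  using slen_mult[of "inv\<^bsub>W\<^esub> g \<otimes>\<^bsub>W\<^esub> h" k] by (simp add: W.m_assoc)

lemma wdist_mult_same: "g \<in> carrier W \<Longrightarrow> h \<in> carrier W \<Longrightarrow> wdist g (g \<otimes>\<^bsub>W\<^esub> h) = slen h"
  by (simp add: W.m_assoc[symmetric])

lemma slen_gen: "s \<in> S \<Longrightarrow> slen (el [s]) \<le> 1"
  using slen_le[of "[s]"] by simp

text \<open>Along a path of length \<open>n\<close> far from \<open>word_subgroup C\<close>, the \<open>word_subgroup C\<close>-coordinate
  moves from \<open>k0\<close> to \<open>k\<close> by crossing \<open>B\<close> maximal blocks of equal walls before a block of type \<open>a\<close>;
  \<open>T\<close> is the time of the last crossing, and \<open>zs\<close> the transversal coordinate at that time.\<close>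

definition block :: "'v set \<Rightarrow> nat \<Rightarrow> 'v gword set \<Rightarrow> 'v gword set \<Rightarrow> 'v list \<Rightarrow> nat \<Rightarrow>
    nat \<Rightarrow> nat \<Rightarrow> 'v \<Rightarrow> 'v gword set \<Rightarrow> 'v list \<Rightarrow> bool" where
  "block C R k0 k ys n B T a p zs \<longleftrightarrow>
     a \<in> C \<and> p \<in> word_subgroup C \<and> (k = p \<or> k = p \<otimes>\<^bsub>W\<^esub> el [a]) \<and>
     wdist k0 p \<le> B \<and> B * (R - 1) \<le> T \<and> T \<le> n \<and> (\<forall>x\<in>set zs. (a, x) \<in> E) \<and>
     (\<exists>M. built \<Gamma> C M zs) \<and> R \<le> length zs \<and> wdist (el zs) (el ys) \<le> n - T"

text \<open>It suffices to remember the last crossing: while \<open>k\<close> is fixed, each step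
  moves the transversal word by at most one away from \<open>zs\<close>, so the distance between two
  walls is a lower bound for the time between their crossings.\<close>

lemma divergence_induction:
  assumes tf: "triangle_free \<Gamma>" and lc: "link_condition C" and C: "C \<subseteq> S"
    and d: "decomposed C g k0 ys0" and ws: "set ws \<subseteq> S"
    and far: "\<And>i. i \<le> length ws \<Longrightarrow> R \<le> height C (g \<otimes>\<^bsub>W\<^esub> el (take i ws))"
  shows "\<exists>k ys. decomposed C (g \<otimes>\<^bsub>W\<^esub> el ws) k ys \<and>
    (k = k0 \<or> (\<exists>B T a p zs. block C R k0 k ys (length ws) B T a p zs))"
  using ws far
proof (induction ws rule: rev_induct)
  case Nil
  have "g \<in> carrier W" using decomposed_simps[OF C d] by blast
  then show ?case using d by auto
next
  case (snoc s ws)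
  note g = decomposed_simps[OF C d]
  have s: "s \<in> S" "set ws \<subseteq> S" using snoc.prems by auto
  have far: "R \<le> height C (g \<otimes>\<^bsub>W\<^esub> el (take i ws))" if "i \<le> length ws" for i
    using snoc.prems(2)[of i] that by simp
  have gs: "g \<otimes>\<^bsub>W\<^esub> el (ws @ [s]) = g \<otimes>\<^bsub>W\<^esub> el ws \<otimes>\<^bsub>W\<^esub> el [s]"
    using g s el_append[of ws "[s]"] el_carrier[of ws] el_carrier[of "[s]"] by (simp add: W.m_assoc)
  obtain k ys where d': "decomposed C (g \<otimes>\<^bsub>W\<^esub> el ws) k ys"
    and inv: "k = k0 \<or> (\<exists>B T a p zs. block C R k0 k ys (length ws) B T a p zs)"
    using snoc.IH[OF s(2) far] by blast
  note k = decomposed_simps[OF C d']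
  have Ry: "R \<le> length ys" using far[of "length ws"] k by simp
  have sc: "el [s] \<in> carrier W" using s el_carrier by simp
  from decomposed_step[OF C d' s(1)] show ?case
  proof
    assume "\<exists>zs. decomposed C (g \<otimes>\<^bsub>W\<^esub> el ws \<otimes>\<^bsub>W\<^esub> el [s]) k zs \<and> el zs = el ys \<otimes>\<^bsub>W\<^esub> el [s]"
    then obtain ys' where ys': "decomposed C (g \<otimes>\<^bsub>W\<^esub> el (ws @ [s])) k ys'" "el ys' = el ys \<otimes>\<^bsub>W\<^esub> el [s]"
      using gs by auto
    have "block C R k0 k ys' (length (ws @ [s])) B T a p zs"
      if b: "block C R k0 k ys (length ws) B T a p zs" for B T a p zs
    proof -
      obtain M where "built \<Gamma> C M zs" using b by (auto simp: block_def)
      then have "wdist (el zs) (el ys') \<le> wdist (el zs) (el ys) + 1"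
        using wdist_mult[of "el zs" "el ys" "el [s]"] slen_gen[OF s(1)] el_carrier[OF built_verts] k(5) sc ys'(2)
        by fastforce
      then show ?thesis using b by (auto simp: block_def)
    qed
    then show ?thesis using inv ys'(1) by blast
  next
    assume "s \<in> C \<and> (\<forall>x\<in>set ys. (s, x) \<in> E) \<and>
      decomposed C (g \<otimes>\<^bsub>W\<^esub> el ws \<otimes>\<^bsub>W\<^esub> el [s]) (k \<otimes>\<^bsub>W\<^esub> el [s]) ys"
    then have sC: "s \<in> C" and adj: "\<forall>x\<in>set ys. (s, x) \<in> E"
      and dn: "decomposed C (g \<otimes>\<^bsub>W\<^esub> el (ws @ [s])) (k \<otimes>\<^bsub>W\<^esub> el [s]) ys"
      using gs by auto
    have bt: "\<exists>M. built \<Gamma> C M ys" using d' by (auto simp: decomposed_def)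
    \<comment> \<open>Records a crossing at the present time, with the present transversal word as
      the new reference.\<close>
    have goal: ?thesis if "p \<in> word_subgroup C" "k \<otimes>\<^bsub>W\<^esub> el [s] = p \<or> k \<otimes>\<^bsub>W\<^esub> el [s] = p \<otimes>\<^bsub>W\<^esub> el [s]"
      "wdist k0 p \<le> B" "B * (R - 1) \<le> length ws" for p B
    proof -
      have "block C R k0 (k \<otimes>\<^bsub>W\<^esub> el [s]) ys (length (ws @ [s])) B (length (ws @ [s])) s p ys"
        using that sC adj bt Ry k by (auto simp: block_def)
      then show ?thesis using dn by blast
    qed
    from inv show ?thesis
    proof
      assume "k = k0"
      then show ?thesis using goal[of k 0] k by simp
    next
      assume "\<exists>B T a p zs. block C R k0 k ys (length ws) B T a p zs"
      then obtain B T a p zs M where a: "a \<in> C" and p: "p \<in> word_subgroup C"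
        and kp: "k = p \<or> k = p \<otimes>\<^bsub>W\<^esub> el [a]"
        and B: "wdist k0 p \<le> B" "B * (R - 1) \<le> T" "T \<le> length ws"
        and zs: "\<forall>x\<in>set zs. (a, x) \<in> E" "built \<Gamma> C M zs" "R \<le> length zs"
          "wdist (el zs) (el ys) \<le> length ws - T" unfolding block_def by blast
      have pc: "p \<in> carrier W" using p word_subgroup_carrier[OF C] by blast
      show ?thesis
      proof (cases "a = s")
        case True
        \<comment> \<open>Crossings of one type keep \<open>k\<close> in \<open>{p, p s}\<close>:
          the block continues, \<open>B\<close> stays, and only \<open>T\<close> and
          \<open>zs\<close> are renewed.\<close>
        have "p \<otimes>\<^bsub>W\<^esub> el [s] \<otimes>\<^bsub>W\<^esub> el [s] = p"
          using pc sc el_square[OF s(1)] by (simp add: W.m_assoc)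
        then show ?thesis using goal[OF p, of B] kp True B by auto
      next
        case False
        have "length zs \<le> wdist (el zs) (el ys) + 1"
          using wall_separation[OF tf lc a sC False zs(2)] zs(1) adj by blast
        \<comment> \<open>The time since \<open>T\<close> pays for closing the old block, and a new
          one starts at \<open>k\<close>.\<close>
        then have "R - 1 \<le> length ws - T" using zs by linarith
        then have "(B + 1) * (R - 1) \<le> length ws" using B by simp
        moreover have "wdist k0 k \<le> B + 1"
        proof -
          have "a \<in> S" using a C by blast
          then have ac: "el [a] \<in> carrier W" "slen (el [a]) \<le> 1" using el_carrier slen_gen by auto
          then show ?thesis using kp B(1) wdist_mult[of k0 p "el [a]"] g(4) pc by auto
        qed
        ultimately show ?thesis using goal[of k "B + 1"] k by blast
      qed
    qed
  qed
qed

text \<open>The endpoints are within their heights of \<open>k0\<close> and \<open>k\<close>, hence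
  the two height terms. The further \<open>- 1\<close> is the possible step from \<open>p\<close> to
  \<open>k\<close> in the last block, which is still open. Because subtraction is truncated, the
  bound is trivial for short displacements.\<close>

lemma divergence:
  assumes tf: "triangle_free \<Gamma>" and lc: "link_condition C" and C: "C \<subseteq> S"
    and gc: "g \<in> carrier W" and ws: "set ws \<subseteq> S"
    and far: "\<And>i. i \<le> length ws \<Longrightarrow> R \<le> height C (g \<otimes>\<^bsub>W\<^esub> el (take i ws))"
  shows "(slen (el ws) - height C g - height C (g \<otimes>\<^bsub>W\<^esub> el ws) - 1) * (R - 1) \<le> length ws"
proof -
  obtain k0 ys0 where d: "decomposed C g k0 ys0" using decomposed_exists[OF C gc] by blast
  note g = decomposed_simps[OF C d]
  obtain k ys where d': "decomposed C (g \<otimes>\<^bsub>W\<^esub> el ws) k ys"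
    and inv: "k = k0 \<or> (\<exists>B T a p zs. block C R k0 k ys (length ws) B T a p zs)"
    using divergence_induction[OF tf lc C d ws far] by blast
  note k = decomposed_simps[OF C d']
  have bound: "(wdist k0 k - 1) * (R - 1) \<le> length ws"
    using inv
  proof
    assume "\<exists>B T a p zs. block C R k0 k ys (length ws) B T a p zs"
    then obtain B T a p where a: "a \<in> C" and p: "p \<in> word_subgroup C" "k = p \<or> k = p \<otimes>\<^bsub>W\<^esub> el [a]"
        and B: "wdist k0 p \<le> B" "B * (R - 1) \<le> T" "T \<le> length ws" unfolding block_def by blast
    have "a \<in> S" using a C by blast
    then have "el [a] \<in> carrier W" "slen (el [a]) \<le> 1" using el_carrier slen_gen by auto
    moreover have "p \<in> carrier W" using p word_subgroup_carrier[OF C] by blast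
    ultimately have "wdist k0 k \<le> B + 1" using p(2) B(1) wdist_mult[of k0 p "el [a]"] g(4) by auto
    then have "(wdist k0 k - 1) * (R - 1) \<le> B * (R - 1)" by (intro mult_right_mono) auto
    then show ?thesis using B by linarith
  qed (use g in simp)
  have wc: "el ws \<in> carrier W" using ws el_carrier by blast
  have "slen (el ws) = wdist g (g \<otimes>\<^bsub>W\<^esub> el ws)" using wdist_mult_same[OF gc wc] by simp
  also have "\<dots> \<le> wdist g k0 + (wdist k0 k + wdist k (g \<otimes>\<^bsub>W\<^esub> el ws))"
    using wdist_triangle[of g k0 "g \<otimes>\<^bsub>W\<^esub> el ws"] wdist_triangle[of k0 k "g \<otimes>\<^bsub>W\<^esub> el ws"] g(4) k(4,7) gc
    by linarith
  also have "wdist g k0 \<le> height C g"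
    using wdist_sym[of g k0] wdist_mult_same[OF g(4,5)] slen_le[OF g(6)] g(1,2,4) gc by simp
  also have "wdist k (g \<otimes>\<^bsub>W\<^esub> el ws) \<le> height C (g \<otimes>\<^bsub>W\<^esub> el ws)"
    using wdist_mult_same[OF k(4,5)] slen_le[OF k(6)] k(1,2) by simp
  finally have "slen (el ws) - height C g - height C (g \<otimes>\<^bsub>W\<^esub> el ws) - 1 \<le> wdist k0 k - 1"
    by linarith
  then have "(slen (el ws) - height C g - height C (g \<otimes>\<^bsub>W\<^esub> el ws) - 1) * (R - 1) \<le> (wdist k0 k - 1) * (R - 1)"
    by (intro mult_right_mono) auto
  then show ?thesis using bound by linarith
qed

text \<open>The jumps are filled in with geodesic words. Along such a word the height drops by at
  most \<open>D\<close>, which is the margin demanded of the \<open>h i\<close>.\<close>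

lemma chain_word:
  fixes h :: "nat \<Rightarrow> 'v gword set"
  assumes C: "C \<subseteq> S" and c: "\<And>i. i \<le> J \<Longrightarrow> h i \<in> carrier W"
    and jump: "\<And>i. i < J \<Longrightarrow> wdist (h i) (h (Suc i)) \<le> D"
    and far: "\<And>i. i \<le> J \<Longrightarrow> R + D \<le> height C (h i)"
  shows "\<exists>ws. set ws \<subseteq> S \<and> h J = h 0 \<otimes>\<^bsub>W\<^esub> el ws \<and> length ws \<le> J * D \<and>
    (\<forall>i\<le>length ws. R \<le> height C (h 0 \<otimes>\<^bsub>W\<^esub> el (take i ws)))"
  using assms(2-)
proof (induction J)
  case 0
  then show ?case using 0(3)[of 0] by (intro exI[of _ "[]"]) auto
next
  case (Suc J)
  have "\<exists>ws. set ws \<subseteq> S \<and> h J = h 0 \<otimes>\<^bsub>W\<^esub> el ws \<and> length ws \<le> J * D \<and>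
    (\<forall>i\<le>length ws. R \<le> height C (h 0 \<otimes>\<^bsub>W\<^esub> el (take i ws)))"
    using Suc.prems by (intro Suc.IH) auto
  then obtain ws where ws: "set ws \<subseteq> S" "h J = h 0 \<otimes>\<^bsub>W\<^esub> el ws" "length ws \<le> J * D"
    "\<And>i. i \<le> length ws \<Longrightarrow> R \<le> height C (h 0 \<otimes>\<^bsub>W\<^esub> el (take i ws))" by blast
  have hc: "h 0 \<in> carrier W" "h J \<in> carrier W" "h (Suc J) \<in> carrier W" using Suc.prems by auto
  then obtain vs where vs: "set vs \<subseteq> S" "length vs = wdist (h J) (h (Suc J))"
    "el vs = inv\<^bsub>W\<^esub> (h J) \<otimes>\<^bsub>W\<^esub> h (Suc J)"
    using slen_word[of "inv\<^bsub>W\<^esub> (h J) \<otimes>\<^bsub>W\<^esub> h (Suc J)"] by auto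
  have len: "length vs \<le> D" using vs Suc.prems(2)[of J] by simp
  have el: "el (ws @ take i vs) = el ws \<otimes>\<^bsub>W\<^esub> el (take i vs)" for i
    using ws(1) vs(1) set_take_subset[of i vs] by (intro el_append) auto
  have tk: "set (take i vs) \<subseteq> S" for i using vs(1) by (meson set_take_subset subset_trans)
  have c: "el ws \<in> carrier W" "\<And>i. el (take i vs) \<in> carrier W"
    using el_carrier ws(1) tk by auto
  have hi: "h 0 \<otimes>\<^bsub>W\<^esub> el (ws @ take i vs) = h J \<otimes>\<^bsub>W\<^esub> el (take i vs)" for i
    unfolding el ws(2) using hc c by (simp add: W.m_assoc)
  have far: "R \<le> height C (h 0 \<otimes>\<^bsub>W\<^esub> el (take i (ws @ vs)))" for i
  proof (cases "i \<le> length ws")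
    case False
    let ?x = "h J \<otimes>\<^bsub>W\<^esub> el (take (i - length ws) vs)"
    have "height C (h J) \<le> height C ?x + wdist (h J) ?x"
      using hc c by (intro height_lipschitz[OF C]) auto
    also have "wdist (h J) ?x \<le> D"
    proof -
      have "wdist (h J) ?x = slen (el (take (i - length ws) vs))"
        using hc c by (intro wdist_mult_same)
      also have "\<dots> \<le> length (take (i - length ws) vs)"
        by (intro slen_le tk)
      also have "\<dots> \<le> D" using len by simp
      finally show ?thesis .
    qed
    finally have "R \<le> height C ?x" using Suc.prems(3)[of J] by linarith
    then show ?thesis using False hi[of "i - length ws"] by simp
  qed (use ws in simp)
  have "h 0 \<otimes>\<^bsub>W\<^esub> el (ws @ vs) = h (Suc J)"
    using hi[of "length vs"] vs(3) hc by (simp add: W.m_assoc[symmetric])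
  then show ?case using far ws vs(1) len by (intro exI[of _ "ws @ vs"]) auto
qed

lemma coarse_divergence:
  fixes h :: "nat \<Rightarrow> 'v gword set"
  assumes tf: "triangle_free \<Gamma>" and lc: "link_condition C" and C: "C \<subseteq> S"
    and c: "\<And>i. i \<le> J \<Longrightarrow> h i \<in> carrier W"
    and jump: "\<And>i. i < J \<Longrightarrow> wdist (h i) (h (Suc i)) \<le> D"
    and far: "\<And>i. i \<le> J \<Longrightarrow> R + D \<le> height C (h i)"
  shows "(wdist (h 0) (h J) - height C (h 0) - height C (h J) - 1) * (R - 1) \<le> J * D"
proof -
  obtain ws where ws: "set ws \<subseteq> S" "h J = h 0 \<otimes>\<^bsub>W\<^esub> el ws" "length ws \<le> J * D"
    "\<And>i. i \<le> length ws \<Longrightarrow> R \<le> height C (h 0 \<otimes>\<^bsub>W\<^esub> el (take i ws))"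
    using chain_word[of C J h D R] assms by blast
  have h0: "h 0 \<in> carrier W" using c by blast
  show ?thesis
    using divergence[OF tf lc C h0 ws(1,4)] ws(2,3) wdist_mult_same[OF h0 el_carrier[OF ws(1)]] by simp
qed

lemma chain_wdist:
  fixes h :: "nat \<Rightarrow> 'v gword set"
  assumes c: "\<And>i. i \<le> j \<Longrightarrow> h i \<in> carrier W" and jump: "\<And>i. i < j \<Longrightarrow> wdist (h i) (h (Suc i)) \<le> D"
    and "i \<le> j"
  shows "wdist (h i) (h j) \<le> (j - i) * D"
  using assms(3) assms(1,2)
proof (induction j rule: dec_induct)
  case base
  then show ?case by simp
next
  case (step n)
  have "wdist (h i) (h n) \<le> (n - i) * D" using step.prems by (intro step.IH) auto
  moreover have "wdist (h i) (h (Suc n)) \<le> wdist (h i) (h n) + wdist (h n) (h (Suc n))"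
    using step by (intro wdist_triangle) auto
  moreover have "wdist (h n) (h (Suc n)) \<le> D" using step by auto
  ultimately show ?case using step.hyps by (simp add: Suc_diff_le)
qed

text \<open>A maximal excursion above height \<open>R\<close> starts and ends near height \<open>R\<close>. If it were long, then by
  the divergence estimate its duration would be too large a multiple of the distance between its
  endpoints.\<close>

lemma quasi_geodesic_height_bound:
  fixes D :: nat and l e :: real
  assumes tf: "triangle_free \<Gamma>" and lc: "link_condition C" and C: "C \<subseteq> S" and l: "l > 0"
  shows "\<exists>M. \<forall>h N. (\<forall>i\<le>N. h i \<in> carrier W) \<longrightarrow> (\<forall>i<N. wdist (h i) (h (Suc i)) \<le> D) \<longrightarrow>
    (\<forall>i j. i \<le> j \<longrightarrow> j \<le> N \<longrightarrow> real (j - i) / l - e \<le> real (wdist (h i) (h j))) \<longrightarrow>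
    height C (h 0) = 0 \<longrightarrow> height C (h N) = 0 \<longrightarrow> (\<forall>i\<le>N. real (height C (h i)) \<le> M)"
proof -
  \<comment> \<open>Makes \<open>R - 1\<close> at least \<open>2 l D\<close>: apart from additive
    losses, \<open>J\<close> jumps far from the subgroup would have to cover \<open>2 J D\<close>,
    but they cover at most \<open>J D\<close>.\<close>
  define R :: nat where "R = nat \<lceil>2 * l * real D\<rceil> + 2"
  \<comment> \<open>The additive losses: \<open>e\<close>, a height of at most
    \<open>R + 2 D\<close> at each end of the excursion, and the 1 of the divergence
    estimate.\<close>
  define c :: real where "c = e + 2 * real (R + D) + 2 * real D + 1"
  define M :: real where "M = real (R + D) + real D + \<bar>2 * l * c\<bar> * real D"
  have R: "2 * l * real D \<le> real (R - 1)" "R - 1 \<ge> 1" unfolding R_def by linarith+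
  show ?thesis
  proof (intro exI[of _ M] allI impI)
    fix h :: "nat \<Rightarrow> 'v gword set" and N i
    assume hc: "\<forall>i\<le>N. h i \<in> carrier W" and jump: "\<forall>i<N. wdist (h i) (h (Suc i)) \<le> D"
      and low: "\<forall>i j. i \<le> j \<longrightarrow> j \<le> N \<longrightarrow> real (j - i) / l - e \<le> real (wdist (h i) (h j))"
      and h0: "height C (h 0) = 0" and hN: "height C (h N) = 0" and i: "i \<le> N"
    let ?t = "\<lambda>i. height C (h i)"
    show "real (?t i) \<le> M"
    proof (cases "?t i < R + D")
      case True
      then have "real (?t i) \<le> real (R + D)" by simp
      then show ?thesis unfolding M_def by (smt (verit) mult_nonneg_nonneg of_nat_0_le_iff)
    next
      case False
      \<comment> \<open>The low times closest to \<open>i\<close>. The excursion to be estimated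
        runs from \<open>Suc p\<close> to \<open>q - 1\<close>, entirely at height at least
        \<open>R + D\<close>.\<close>
      define p where "p = (GREATEST j. j \<le> i \<and> ?t j < R + D)"
      define q where "q = (LEAST j. i \<le> j \<and> ?t j < R + D)"
      have RD: "R + D > 0" using R by linarith
      have p: "p \<le> i \<and> ?t p < R + D" unfolding p_def
        by (rule GreatestI_nat[where k = 0 and b = i]) (use h0 RD in auto)
      have pm: "j \<le> p" if "j \<le> i" "?t j < R + D" for j
        unfolding p_def by (rule Greatest_le_nat[where b = i]) (use that in auto)
      have q: "i \<le> q \<and> ?t q < R + D" unfolding q_def
        by (rule LeastI[where k = N]) (use hN i RD in auto)
      have qm: "q \<le> j" if "i \<le> j" "?t j < R + D" for j
        unfolding q_def by (rule Least_le) (use that in auto)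
      have qN: "q \<le> N" using qm[of N] hN i RD by auto
      have pi: "p < i" "i < q" using p q False by (metis le_neq_implies_less)+
      define J where "J = q - 1 - Suc p"
      have far: "R + D \<le> ?t (Suc p + j)" if "j \<le> J" for j
        using pm[of "Suc p + j"] qm[of "Suc p + j"] that pi unfolding J_def
        by (cases "Suc p + j \<le> i") (auto simp: not_less[symmetric])
      have Jq: "Suc p + J = q - 1" using pi unfolding J_def by auto
      have up: "?t (Suc p) \<le> R + D + D"
      proof -
        have pN: "p < N" "h p \<in> carrier W" "h (Suc p) \<in> carrier W" using pi qN hc by auto
        have "wdist (h (Suc p)) (h p) \<le> D" using jump[rule_format, OF pN(1)] wdist_sym[OF pN(2,3)] by linarith
        then show ?thesis using height_lipschitz[OF C pN(3,2)] p by linarith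
      qed
      have up': "?t (q - 1) \<le> R + D + D"
      proof -
        have qN': "q - 1 < N" "h q \<in> carrier W" "h (q - 1) \<in> carrier W" "Suc (q - 1) = q"
          using pi qN hc by auto
        have "wdist (h (q - 1)) (h q) \<le> D" using jump[rule_format, OF qN'(1)] by (simp only: qN'(4))
        then show ?thesis using height_lipschitz[OF C qN'(3,2)] q by linarith
      qed
      have core: "(wdist (h (Suc p)) (h (q - 1)) - ?t (Suc p) - ?t (q - 1) - 1) * (R - 1) \<le> J * D"
        using coarse_divergence[OF tf lc C, of J "\<lambda>j. h (Suc p + j)" D R] far hc jump pi qN Jq by force
      have lo: "real J / l - e \<le> real (wdist (h (Suc p)) (h (q - 1)))"
        using low[rule_format, of "Suc p" "q - 1"] pi qN Jq unfolding J_def by auto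
      \<comment> \<open>Truncation can only increase a difference, so the inequality passes to the
        reals without a case distinction.\<close>
      have "(real (wdist (h (Suc p)) (h (q - 1))) - real (?t (Suc p)) - real (?t (q - 1)) - 1) * real (R - 1)
          \<le> real (wdist (h (Suc p)) (h (q - 1)) - ?t (Suc p) - ?t (q - 1) - 1) * real (R - 1)"
        by (intro mult_right_mono) linarith+
      also have "\<dots> \<le> real (J * D)" using core unfolding of_nat_mult[symmetric] of_nat_le_iff .
      finally have "(real J / l - c) * real (R - 1) \<le> real J * real D"
        using mult_right_mono[of "real J / l - c" "real (wdist (h (Suc p)) (h (q - 1))) - real (?t (Suc p)) - real (?t (q - 1)) - 1" "real (R - 1)"]
          lo up up' unfolding c_def by simp
      also have "\<dots> \<le> real J * (real (R - 1) / (2 * l))"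
        using R l by (intro mult_left_mono) (auto simp: field_simps)
      finally have "(real J / l - c) * real (R - 1) \<le> (real J / (2 * l)) * real (R - 1)" by simp
      then have "real J / l - c \<le> real J / (2 * l)"
        by (rule mult_right_le_imp_le) (use R in linarith)
      then have J: "real J \<le> \<bar>2 * l * c\<bar>" using l by (simp add: field_simps)
      have "wdist (h i) (h (Suc p)) \<le> J * D"
      proof -
        have "wdist (h (Suc p)) (h i) \<le> (i - Suc p) * D"
          using hc jump pi qN by (intro chain_wdist) auto
        also have "\<dots> \<le> J * D" using pi unfolding J_def by (intro mult_right_mono) auto
        finally show ?thesis using wdist_sym[of "h i" "h (Suc p)"] hc i pi by auto
      qed
      then have "?t i \<le> R + D + D + J * D"
        using height_lipschitz[OF C, of "h i" "h (Suc p)"] hc i pi up by fastforce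
      then have "real (?t i) \<le> real (R + D) + real D + real J * real D"
        by (metis of_nat_add of_nat_le_iff of_nat_mult)
      also have "real J * real D \<le> \<bar>2 * l * c\<bar> * real D" using J by (intro mult_right_mono) auto
      finally show ?thesis unfolding M_def by simp
    qed
  qed
qed

end

section \<open>Flats from induced 4-cycles\<close>

context right_angled_coxeter
begin

definition four_cycle_condition :: "'v set \<Rightarrow> bool" where
  "four_cycle_condition C \<longleftrightarrow>
     (\<forall>a b c d. induced_4_cycle \<Gamma> a b c d \<and>
        (\<exists>x\<in>{a, b, c, d} \<inter> C. \<exists>y\<in>{a, b, c, d} \<inter> C. x \<noteq> y \<and> (x, y) \<notin> E) \<longrightarrow> {a, b, c, d} \<subseteq> C)"

lemma induced_4_cycle_rotate: "induced_4_cycle \<Gamma> a b c d \<Longrightarrow> induced_4_cycle \<Gamma> b c d a"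
  unfolding induced_4_cycle_def using E_sym by auto

lemma induced_4_cycle_flip: "induced_4_cycle \<Gamma> a b c d \<Longrightarrow> induced_4_cycle \<Gamma> a d c b"
  unfolding induced_4_cycle_def using E_sym by auto

text \<open>Two neighbours of one vertex are not adjacent in a triangle-free graph. Hence distinct
  \<open>x\<close>, \<open>y\<close> would form an induced 4-cycle with \<open>a\<close>,
  \<open>c\<close>, and condition (2) would put \<open>x\<close> into \<open>C\<close>.\<close>

lemma four_cycle_condition_link:
  assumes tf: "triangle_free \<Gamma>" and fc: "four_cycle_condition C"
  shows "link_condition C"
  unfolding link_condition_def
proof (intro ballI allI impI, elim conjE)
  fix a c x y
  assume ac: "a \<in> C" "c \<in> C" "a \<noteq> c" and e: "(a, x) \<in> E" "(c, x) \<in> E" "(a, y) \<in> E" "(c, y) \<in> E"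
    and x: "x \<notin> C"
  show "x = y"
  proof (rule ccontr)
    assume "x \<noteq> y"
    moreover have nac: "(a, c) \<notin> E" using link_independent[OF tf, of x a c] e E_sym by blast
    moreover have "(x, y) \<notin> E" using link_independent[OF tf, of a x y] e by blast
    ultimately have cyc: "induced_4_cycle \<Gamma> a x c y"
      unfolding induced_4_cycle_def using ac e E_sym E_verts by auto
    have "{a, x, c, y} \<subseteq> C"
      by (rule fc[unfolded four_cycle_condition_def, rule_format, OF conjI, OF cyc])
        (use ac nac in blast)
    then show False using x by blast
  qed
qed

text \<open>Non-adjacent vertices of a 4-cycle are opposite. Rotation turns them into
  \<open>a\<close>, \<open>c\<close>, and a flip moves a missing vertex to \<open>b\<close>.\<close>

lemma four_cycle_condition_fails:
  assumes "\<not> four_cycle_condition C"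
  shows "\<exists>a b c d. induced_4_cycle \<Gamma> a b c d \<and> a \<in> C \<and> c \<in> C \<and> b \<notin> C"
proof -
  have opp: ?thesis if cyc: "induced_4_cycle \<Gamma> a b c d" and "a \<in> C" "c \<in> C" "\<not> {a, b, c, d} \<subseteq> C" for a b c d
    using that induced_4_cycle_flip[OF cyc] by blast
  obtain a b c d x y where cyc: "induced_4_cycle \<Gamma> a b c d" and
    xy: "x \<in> {a, b, c, d}" "x \<in> C" "y \<in> {a, b, c, d}" "y \<in> C" "x \<noteq> y" "(x, y) \<notin> E"
    and n: "\<not> {a, b, c, d} \<subseteq> C"
    using assms unfolding four_cycle_condition_def by blast
  have e: "(a, b) \<in> E" "(b, c) \<in> E" "(c, d) \<in> E" "(d, a) \<in> E"
    using cyc by (auto simp: induced_4_cycle_def)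
  have "(a \<in> C \<and> c \<in> C) \<or> (b \<in> C \<and> d \<in> C)"
    using xy e E_sym by blast
  then show ?thesis
    using opp[OF cyc] opp[OF induced_4_cycle_rotate[OF cyc]] n by blast
qed

lemma el_commute_words:
  assumes "\<And>x y. x \<in> set xs \<Longrightarrow> y \<in> set ys \<Longrightarrow> (x, y) \<in> E" "set xs \<subseteq> S" "set ys \<subseteq> S"
  shows "el xs \<otimes>\<^bsub>W\<^esub> el ys = el ys \<otimes>\<^bsub>W\<^esub> el xs"
  using assms
proof (induction xs)
  case (Cons x xs)
  have c: "el [x] \<in> carrier W" "el xs \<in> carrier W" "el ys \<in> carrier W"
    using Cons.prems el_carrier by auto
  have ex: "el (x # xs) = el [x] \<otimes>\<^bsub>W\<^esub> el xs" using Cons.prems el_append[of "[x]" xs] by simp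
  have "el xs \<otimes>\<^bsub>W\<^esub> el ys = el ys \<otimes>\<^bsub>W\<^esub> el xs" using Cons by auto
  then have "el (x # xs) \<otimes>\<^bsub>W\<^esub> el ys = (el [x] \<otimes>\<^bsub>W\<^esub> el ys) \<otimes>\<^bsub>W\<^esub> el xs"
    using ex c by (simp add: W.m_assoc)
  also have "el [x] \<otimes>\<^bsub>W\<^esub> el ys = el ys \<otimes>\<^bsub>W\<^esub> el [x]"
    using Cons.prems by (intro el_commute_word) auto
  finally show ?case using ex c by (simp add: W.m_assoc)
qed (use el_carrier in auto)

end

section \<open>The flat spanned by an induced 4-cycle\<close>

locale coxeter_flat = right_angled_coxeter +
  fixes a b c d C
  assumes cycle: "induced_4_cycle \<Gamma> a b c d" and aC: "a \<in> C" and cC: "c \<in> C" and bC: "b \<notin> C"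
    and CS: "C \<subseteq> S"
begin

text \<open>The words begin with \<open>b\<close>, so that their first letter lies outside
  \<open>C\<close> whether or not \<open>d\<close> does.\<close>

abbreviation u :: "nat \<Rightarrow> 'a gword set" where "u i \<equiv> el (alternating b d i)"
abbreviation v :: "nat \<Rightarrow> 'a gword set" where "v j \<equiv> el (alternating a c j)"
definition flat :: "nat \<Rightarrow> nat \<Rightarrow> 'a gword set" where "flat i j = u i \<otimes>\<^bsub>W\<^esub> v j"

lemma cycle_facts:
  "a \<in> S" "b \<in> S" "c \<in> S" "d \<in> S" "a \<noteq> c" "b \<noteq> d" "(a, b) \<in> E" "(b, c) \<in> E" "(c, d) \<in> E" "(d, a) \<in> E"
  "(b, a) \<in> E" "(c, b) \<in> E" "(d, c) \<in> E" "(a, d) \<in> E" "(a, c) \<notin> E" "(b, d) \<notin> E" "(c, a) \<notin> E" "(d, b) \<notin> E"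
  "a \<notin> {b, d}" "c \<notin> {b, d}" "b \<notin> {a, c}" "d \<notin> {a, c}"
  using cycle E_sym unfolding induced_4_cycle_def by auto

lemma u_verts: "set (alternating b d i) \<subseteq> S" and v_verts: "set (alternating a c j) \<subseteq> S"
  using set_alternating[of b d i] set_alternating[of a c j] cycle_facts by auto

lemma uv_carrier [simp]: "u i \<in> carrier W" "v j \<in> carrier W" "flat i j \<in> carrier W"
  using el_carrier u_verts v_verts by (auto simp: flat_def)

lemma word_subgroupI: "set xs \<subseteq> B \<Longrightarrow> el xs \<in> word_subgroup B"
  unfolding word_subgroup_def by (intro CollectI exI[of _ xs] conjI HOL.refl)

lemma u_subgroup: "u i \<in> word_subgroup {b, d}" and v_subgroup: "v j \<in> word_subgroup {a, c}"
  by (rule word_subgroupI[OF set_alternating])+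

lemma commute_ac_bd:
  assumes "g \<in> word_subgroup {a, c}" "h \<in> word_subgroup {b, d}"
  shows "g \<otimes>\<^bsub>W\<^esub> h = h \<otimes>\<^bsub>W\<^esub> g"
proof -
  obtain xs ys where xy: "set xs \<subseteq> {a, c}" "set ys \<subseteq> {b, d}" "g = el xs" "h = el ys"
    using assms by (auto simp: word_subgroup_def)
  have "(x, y) \<in> E" if "x \<in> set xs" "y \<in> set ys" for x y
  proof -
    have "x = a \<or> x = c" "y = b \<or> y = d" using xy that by auto
    then show ?thesis using cycle_facts(7-14) by metis
  qed
  moreover have "set xs \<subseteq> S" "set ys \<subseteq> S" using xy cycle_facts(1-4) by auto
  ultimately show ?thesis unfolding xy(3,4) by (rule el_commute_words)
qed

lemma flat_commute: "flat i j = v j \<otimes>\<^bsub>W\<^esub> u i"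
  unfolding flat_def by (rule commute_ac_bd[OF v_subgroup u_subgroup, symmetric])

lemma v_in: "v j \<in> word_subgroup C"
  using set_alternating[of a c j] aC cC by (intro word_subgroupI) auto

lemma height_alternating:
  assumes "x \<in> S" "y \<in> S" "x \<noteq> y" "(x, y) \<notin> E" "x \<notin> B"
  shows "height B (el (alternating x y n)) = n"
proof -
  have sub: "set (alternating x y n) \<subseteq> {x, y}" by (rule set_alternating)
  have ind: "(p, q) \<notin> E" if "p \<in> set (alternating x y n)" "q \<in> set (alternating x y n)" for p q
    using subsetD[OF sub that(1)] subsetD[OF sub that(2)] assms(4) E_sym[of y x] by auto
  have "height B (el (alternating x y n)) = length (alternating x y n)"
  proof (rule height_independent[OF _ _ ind])
    show "set (alternating x y n) \<subseteq> S" using sub assms by auto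
  qed (use assms distinct_adj_alternating hd_alternating[of x y n] in auto)
  then show ?thesis by simp
qed

text \<open>The factor \<open>v j\<close> lies in the subgroup and is dropped on the left; what
  remains is a reduced word starting outside \<open>C\<close>.\<close>

lemma height_flat: "height C (flat i j) = i"
  unfolding flat_commute
  using height_mult_left[OF CS v_in, of "u i" j] height_alternating[of b d C i] cycle_facts bC by simp

lemma flat_quotient:
  "inv\<^bsub>W\<^esub> (flat i j) \<otimes>\<^bsub>W\<^esub> flat i' j' = (inv\<^bsub>W\<^esub> (u i) \<otimes>\<^bsub>W\<^esub> u i') \<otimes>\<^bsub>W\<^esub> (inv\<^bsub>W\<^esub> (v j) \<otimes>\<^bsub>W\<^esub> v j')"
proof -
  have bd: "{b, d} \<subseteq> S" and ac: "{a, c} \<subseteq> S" using cycle_facts by auto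
  have U: "inv\<^bsub>W\<^esub> (u i) \<otimes>\<^bsub>W\<^esub> u i' \<in> word_subgroup {b, d}"
    using word_subgroup_mult[OF bd word_subgroup_inv[OF bd u_subgroup] u_subgroup] .
  have V: "inv\<^bsub>W\<^esub> (v j) \<in> word_subgroup {a, c}" using word_subgroup_inv[OF ac v_subgroup] .
  have "inv\<^bsub>W\<^esub> (flat i j) \<otimes>\<^bsub>W\<^esub> flat i' j' = inv\<^bsub>W\<^esub> (v j) \<otimes>\<^bsub>W\<^esub> (inv\<^bsub>W\<^esub> (u i) \<otimes>\<^bsub>W\<^esub> u i') \<otimes>\<^bsub>W\<^esub> v j'"
    unfolding flat_def by (simp add: W.inv_mult_group W.m_assoc)
  also have "\<dots> = (inv\<^bsub>W\<^esub> (u i) \<otimes>\<^bsub>W\<^esub> u i') \<otimes>\<^bsub>W\<^esub> inv\<^bsub>W\<^esub> (v j) \<otimes>\<^bsub>W\<^esub> v j'"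
    using commute_ac_bd[OF V U] by simp
  finally show ?thesis by (simp add: W.m_assoc)
qed

text \<open>Removing a prefix of odd length exchanges the roles of the two letters.\<close>

lemma alternating_quotient:
  assumes "x \<in> S" "y \<in> S" "j \<le> j'"
  shows "inv\<^bsub>W\<^esub> (el (alternating x y j)) \<otimes>\<^bsub>W\<^esub> el (alternating x y j') =
    (if even j then el (alternating x y (j' - j)) else el (alternating y x (j' - j)))"
proof -
  let ?w = "if even j then alternating x y (j' - j) else alternating y x (j' - j)"
  have w: "set ?w \<subseteq> S" "set (alternating x y j) \<subseteq> S"
    using assms set_alternating[of x y "j' - j"] set_alternating[of y x "j' - j"] set_alternating[of x y j] by auto
  have "alternating x y j' = alternating x y j @ ?w"
    using alternating_add[of x y j "j' - j"] assms(3) by simp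
  then have "el (alternating x y j') = el (alternating x y j) \<otimes>\<^bsub>W\<^esub> el ?w"
    using el_append[OF w(2,1)] by simp
  then show ?thesis using el_carrier[OF w(1)] el_carrier[OF w(2)] by (simp add: W.m_assoc[symmetric])
qed

text \<open>Height with respect to \<open>{b, d}\<close> ignores the \<open>u\<close> part of the
  quotient and measures its \<open>v\<close> part. \<open>wdist_flat_u_le\<close> exchanges the two
  factors.\<close>

lemma wdist_flat_v_le:
  assumes "j \<le> j'"
  shows "j' - j \<le> wdist (flat i j) (flat i' j')"
proof -
  have bd: "{b, d} \<subseteq> S" using cycle_facts by auto
  have U: "inv\<^bsub>W\<^esub> (u i) \<otimes>\<^bsub>W\<^esub> u i' \<in> word_subgroup {b, d}"
    using word_subgroup_mult[OF bd word_subgroup_inv[OF bd u_subgroup] u_subgroup] .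
  have "height {b, d} (inv\<^bsub>W\<^esub> (v j) \<otimes>\<^bsub>W\<^esub> v j') = j' - j"
    using alternating_quotient[of a c j j'] assms cycle_facts height_alternating[of a c "{b, d}" "j' - j"]
      height_alternating[of c a "{b, d}" "j' - j"] by auto
  then have "height {b, d} (inv\<^bsub>W\<^esub> (flat i j) \<otimes>\<^bsub>W\<^esub> flat i' j') = j' - j"
    unfolding flat_quotient using height_mult_left[OF bd U] by simp
  then show ?thesis using height_le_slen[of "inv\<^bsub>W\<^esub> (flat i j) \<otimes>\<^bsub>W\<^esub> flat i' j'" "{b, d}"] by simp
qed

lemma wdist_flat_u_le:
  assumes "i \<le> i'"
  shows "i' - i \<le> wdist (flat i j) (flat i' j')"
proof -
  have ac: "{a, c} \<subseteq> S" and bd: "{b, d} \<subseteq> S" using cycle_facts by auto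
  have U: "inv\<^bsub>W\<^esub> (u i) \<otimes>\<^bsub>W\<^esub> u i' \<in> word_subgroup {b, d}"
    using word_subgroup_mult[OF bd word_subgroup_inv[OF bd u_subgroup] u_subgroup] .
  have V: "inv\<^bsub>W\<^esub> (v j) \<otimes>\<^bsub>W\<^esub> v j' \<in> word_subgroup {a, c}"
    using word_subgroup_mult[OF ac word_subgroup_inv[OF ac v_subgroup] v_subgroup] .
  have "height {a, c} (inv\<^bsub>W\<^esub> (u i) \<otimes>\<^bsub>W\<^esub> u i') = i' - i"
    using alternating_quotient[of b d i i'] assms cycle_facts height_alternating[of b d "{a, c}" "i' - i"]
      height_alternating[of d b "{a, c}" "i' - i"] by auto
  then have "height {a, c} (inv\<^bsub>W\<^esub> (flat i j) \<otimes>\<^bsub>W\<^esub> flat i' j') = i' - i"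
    unfolding flat_quotient commute_ac_bd[OF V U, symmetric] using height_mult_left[OF ac V] by simp
  then show ?thesis using height_le_slen[of "inv\<^bsub>W\<^esub> (flat i j) \<otimes>\<^bsub>W\<^esub> flat i' j'" "{a, c}"] by simp
qed

lemma wdist_flat_lower:
  "\<bar>int i - int i'\<bar> \<le> int (wdist (flat i j) (flat i' j'))" (is ?A)
  "\<bar>int j - int j'\<bar> \<le> int (wdist (flat i j) (flat i' j'))" (is ?B)
proof -
  have sym: "wdist (flat i j) (flat i' j') = wdist (flat i' j') (flat i j)"
    by (rule wdist_sym[OF uv_carrier(3,3)])
  show ?A
  proof (cases "i \<le> i'")
    case True
    then show ?thesis using wdist_flat_u_le[OF True, of j j'] by linarith
  next
    case False
    then show ?thesis using wdist_flat_u_le[of i' i j' j] sym by linarith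
  qed
  show ?B
  proof (cases "j \<le> j'")
    case True
    then show ?thesis using wdist_flat_v_le[OF True, of i i'] by linarith
  next
    case False
    then show ?thesis using wdist_flat_v_le[of j' j i' i] sym by linarith
  qed
qed

lemma flat_0_0 [simp]: "flat 0 0 = \<one>\<^bsub>W\<^esub>"
  by (simp add: flat_def)

lemma flat_0: "flat 0 j \<in> word_subgroup C"
  using v_in by (simp add: flat_def)

lemma wdist_flat_Suc: "wdist (flat i j) (flat (Suc i) j) \<le> 1" "wdist (flat i j) (flat i (Suc j)) \<le> 1"
proof -
  have 1: "wdist (el (alternating x y n)) (el (alternating x y (Suc n))) \<le> 1" if "x \<in> S" "y \<in> S" for x y n
    using alternating_quotient[of x y n "Suc n"] that slen_gen by simp
  have "inv\<^bsub>W\<^esub> (flat i j) \<otimes>\<^bsub>W\<^esub> flat (Suc i) j = inv\<^bsub>W\<^esub> (u i) \<otimes>\<^bsub>W\<^esub> u (Suc i)"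
    unfolding flat_quotient by (simp del: alternating.simps)
  then show "wdist (flat i j) (flat (Suc i) j) \<le> 1" using 1[of b d i] cycle_facts by simp
  have "inv\<^bsub>W\<^esub> (flat i j) \<otimes>\<^bsub>W\<^esub> flat i (Suc j) = inv\<^bsub>W\<^esub> (v j) \<otimes>\<^bsub>W\<^esub> v (Suc j)"
    unfolding flat_quotient by (simp del: alternating.simps)
  then show "wdist (flat i j) (flat i (Suc j)) \<le> 1" using 1[of a c j] cycle_facts by simp
qed

lemma infinite_word_subgroup: "infinite (word_subgroup C)"
proof -
  have "inj (flat 0)"
  proof (rule injI)
    fix j j' assume "flat 0 j = flat 0 j'"
    then show "j = j'" using wdist_flat_lower(2)[of j j' 0 0] by simp
  qed
  then show ?thesis using flat_0 range_inj_infinite finite_subset by (metis image_subsetI)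
qed

end

section \<open>Geometry of the Cayley graph\<close>

lemma mdist_self [simp]: "x \<in> mspace X \<Longrightarrow> mdist X x x = 0"
  by simp

lemma mdist_to_set_le: "a \<in> A \<Longrightarrow> mdist_to_set X x A \<le> mdist X x a"
  unfolding mdist_to_set_def by (intro cINF_lower bdd_belowI[of _ 0]) auto

lemma mdist_to_set_ge: "A \<noteq> {} \<Longrightarrow> (\<And>a. a \<in> A \<Longrightarrow> m \<le> mdist X x a) \<Longrightarrow> m \<le> mdist_to_set X x A"
  unfolding mdist_to_set_def by (intro cINF_greatest)

lemma mdist_to_set_lipschitz:
  assumes "A \<noteq> {}" "A \<subseteq> mspace X" "x \<in> mspace X" "y \<in> mspace X"
  shows "mdist_to_set X x A \<le> mdist X x y + mdist_to_set X y A"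
proof -
  have "mdist_to_set X x A - mdist X x y \<le> mdist X y a" if "a \<in> A" for a
    using mdist_to_set_le[OF that, of X x] mdist_triangle[of x X y a] assms that by force
  then have "mdist_to_set X x A - mdist X x y \<le> mdist_to_set X y A"
    using assms(1) by (intro mdist_to_set_ge)
  then show ?thesis by linarith
qed

text \<open>The metric is an infimum over chains, so it is bounded below by test functions: a vertex
  function that varies by at most 1 along edges becomes 1-Lipschitz on the whole graph.\<close>

definition affine_extension :: "('v \<Rightarrow> real) \<Rightarrow> ('v \<Rightarrow> real) \<Rightarrow> real" where
  "affine_extension f x = (\<Sum>w | x w \<noteq> 0. x w * f w)"

lemma affine_extension_vertex [simp]: "affine_extension f (graph_vertex u) = f u"
proof -
  have "{w. graph_vertex u w \<noteq> 0} = {u}" by (auto simp: graph_vertex_def indicator_def)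
  then show ?thesis by (simp add: affine_extension_def graph_vertex_def)
qed

lemma affine_extension_cell:
  "affine_extension f (\<lambda>w. (1 - t) * graph_vertex u w + t * graph_vertex v w) = (1 - t) * f u + t * f v"
proof -
  let ?x = "\<lambda>w. (1 - t) * graph_vertex u w + t * graph_vertex v w"
  have "{w. ?x w \<noteq> 0} \<subseteq> {u, v}" by (auto simp: graph_vertex_def indicator_def split: if_splits)
  then have "affine_extension f ?x = (\<Sum>w\<in>{u, v}. ?x w * f w)"
    unfolding affine_extension_def by (intro sum.mono_neutral_left) auto
  then show ?thesis by (cases "u = v") (auto simp: graph_vertex_def indicator_def algebra_simps)
qed

lemma edge_dist_cell:
  assumes "u \<noteq> v"
  shows "edge_dist (\<lambda>w. (1 - s) * graph_vertex u w + s * graph_vertex v w)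
    (\<lambda>w. (1 - t) * graph_vertex u w + t * graph_vertex v w) = \<bar>s - t\<bar>"
proof -
  have "edge_dist (\<lambda>w. (1 - s) * graph_vertex u w + s * graph_vertex v w)
    (\<lambda>w. (1 - t) * graph_vertex u w + t * graph_vertex v w) =
    (\<Sum>w\<in>{u, v}. \<bar>((1 - s) * graph_vertex u w + s * graph_vertex v w) -
      ((1 - t) * graph_vertex u w + t * graph_vertex v w)\<bar>) / 2"
    by (rule edge_dist_superset) (auto simp: graph_vertex_def indicator_def split: if_splits)
  also have "\<dots> = \<bar>s - t\<bar>"
    using assms by (auto simp: graph_vertex_def indicator_def)
  finally show ?thesis .
qed

lemma cell_degenerate: "(\<lambda>w. (1 - t) * graph_vertex u w + t * graph_vertex u w) = graph_vertex u"
  by (auto simp: algebra_simps)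

lemma affine_extension_chain:
  assumes "graph_chain \<Gamma> x l y" "\<And>u v. (u, v) \<in> parcs \<Gamma> \<Longrightarrow> \<bar>f u - f v\<bar> \<le> 1"
  shows "\<bar>affine_extension f x - affine_extension f y\<bar> \<le> l"
  using assms(1)
proof (induction rule: graph_chain.induct)
  case (step x l y c z)
  obtain u v where c: "c = graph_cell u v" and uv: "v = u \<or> (u, v) \<in> parcs \<Gamma>"
    using step.hyps(2) by (auto simp: graph_cells_def)
  obtain s where y: "y = (\<lambda>w. (1 - s) * graph_vertex u w + s * graph_vertex v w)"
    using step.hyps(3) c by (auto simp: graph_cell_def)
  obtain t where z: "z = (\<lambda>w. (1 - t) * graph_vertex u w + t * graph_vertex v w)"
    using step.hyps(4) c by (auto simp: graph_cell_def)
  have "\<bar>affine_extension f y - affine_extension f z\<bar> \<le> edge_dist y z"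
  proof (cases "v = u")
    case True
    then show ?thesis using y z cell_degenerate[of _ u] by simp
  next
    case False
    have "affine_extension f y - affine_extension f z = (s - t) * (f v - f u)"
      unfolding y z affine_extension_cell by (simp add: algebra_simps)
    moreover have "\<bar>f v - f u\<bar> \<le> 1" using assms(2)[of u v] uv False by (simp add: abs_minus_commute)
    then have "\<bar>(s - t) * (f v - f u)\<bar> \<le> \<bar>s - t\<bar> * 1" unfolding abs_mult by (intro mult_left_mono) auto
    moreover have "edge_dist y z = \<bar>s - t\<bar>" unfolding y z using False by (intro edge_dist_cell) auto
    ultimately show ?thesis by simp
  qed
  then show ?case using step.IH by linarith
qed simp

section \<open>Vertices of the Cayley graph and the word metric\<close>

locale cayley_coxeter = right_angled_coxeter +
  fixes T
  assumes gen: "finite_generating_set W T"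
begin

abbreviation "X \<equiv> cayley_space W T"
abbreviation "CG \<equiv> cayley_graph W T"
abbreviation "vert \<equiv> graph_vertex :: 'a gword set \<Rightarrow> 'a gword set \<Rightarrow> real"

lemma mspace_X: "mspace X = \<Union> (graph_cells CG)" and mdist_X: "mdist X = graph_dist CG"
  by (rule mspace_cayley_space[OF group_racg gen], rule mdist_cayley_space[OF group_racg gen])

lemma chain_nonempty: "x \<in> mspace X \<Longrightarrow> y \<in> mspace X \<Longrightarrow> \<exists>l. graph_chain CG x l y"
  by (rule graph_chain_exists)
    (use cayley_graph_connected[OF group_racg gen] in \<open>auto simp: cayley_graph_def mspace_X\<close>)

lemma mdist_le_chain: "graph_chain CG x l y \<Longrightarrow> mdist X x y \<le> l"
  using graph_chain_points[of CG x l y] graph_chain_lower[of CG x _ y]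
  unfolding mdist_X graph_dist_def
  by (auto intro!: cInf_lower bdd_belowI[of _ "edge_dist x y"])

lemma mdist_cell: "c \<in> graph_cells CG \<Longrightarrow> x \<in> c \<Longrightarrow> y \<in> c \<Longrightarrow> mdist X x y \<le> edge_dist x y"
  by (intro mdist_le_chain graph_chain_cell)

lemma chain_approx:
  assumes "x \<in> mspace X" "y \<in> mspace X" "mdist X x y < m"
  shows "\<exists>l<m. graph_chain CG x l y"
proof -
  have "Inf {l. graph_chain CG x l y} < m"
    using assms unfolding mdist_X graph_dist_def mspace_X by simp
  moreover have "{l. graph_chain CG x l y} \<noteq> {}" using chain_nonempty assms by auto
  ultimately have "\<exists>l\<in>{l. graph_chain CG x l y}. l < m" by (intro cInf_lessD)
  then show ?thesis by auto
qed

lemma affine_extension_lipschitz: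
  assumes "\<And>u v. (u, v) \<in> parcs CG \<Longrightarrow> \<bar>f u - f v\<bar> \<le> 1" "x \<in> mspace X" "y \<in> mspace X"
  shows "\<bar>affine_extension f x - affine_extension f y\<bar> \<le> mdist X x y"
proof (rule ccontr)
  assume "\<not> ?thesis"
  then obtain l where "l < \<bar>affine_extension f x - affine_extension f y\<bar>" "graph_chain CG x l y"
    using chain_approx[OF assms(2,3)] by force
  then show False using affine_extension_chain[of CG x l y f] assms(1) by fastforce
qed

lemma vert_in_X: "g \<in> carrier W \<Longrightarrow> vert g \<in> mspace X"
  unfolding mspace_X graph_cells_def cayley_graph_def using graph_vertex_in_cell[of g g] by auto

lemma mdist_edge:
  assumes "g \<in> carrier W" "t \<in> T"
  shows "mdist X (vert g) (vert (g \<otimes>\<^bsub>W\<^esub> t)) \<le> 1"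
proof (cases "g = g \<otimes>\<^bsub>W\<^esub> t")
  case True
  then show ?thesis using mdist_self[OF vert_in_X[OF assms(1)]] by simp
next
  case False
  have "t \<in> carrier W" using gen assms by (auto simp: finite_generating_set_def)
  then have c: "graph_cell g (g \<otimes>\<^bsub>W\<^esub> t) \<in> graph_cells CG"
    using False assms unfolding graph_cells_def cayley_graph_def by auto
  have "edge_dist (vert g) (vert (g \<otimes>\<^bsub>W\<^esub> t)) = 1"
    using edge_dist_cell[OF False, of 0 1] by simp
  then show ?thesis using mdist_cell[OF c graph_vertex_in_cell graph_vertex_in_cell'] by simp
qed

text \<open>Uniformity in \<open>g\<close> takes the place of left invariance of the metric and lets
  the bounds of two factors be added.\<close>

lemma mdist_generate:
  assumes "w \<in> generate W T"
  shows "\<exists>n::nat. \<forall>g\<in>carrier W. mdist X (vert g) (vert (g \<otimes>\<^bsub>W\<^esub> w)) \<le> real n"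
  using assms
proof (induction rule: generate.induct)
  case one
  then show ?case using mdist_self[OF vert_in_X] by (intro exI[of _ 0]) simp
next
  case (incl t)
  then show ?case using mdist_edge by (intro exI[of _ 1]) auto
next
  case (inv t)
  have t: "t \<in> carrier W" using gen inv by (auto simp: finite_generating_set_def)
  have "mdist X (vert g) (vert (g \<otimes>\<^bsub>W\<^esub> inv\<^bsub>W\<^esub> t)) \<le> 1" if g: "g \<in> carrier W" for g
    using mdist_edge[of "g \<otimes>\<^bsub>W\<^esub> inv\<^bsub>W\<^esub> t" t] inv t g
      mdist_commute[of X "vert g" "vert (g \<otimes>\<^bsub>W\<^esub> inv\<^bsub>W\<^esub> t)"] by (simp add: W.m_assoc)
  then show ?case by (intro exI[of _ 1]) auto
next
  case (eng h1 h2)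
  have h: "h1 \<in> carrier W" "h2 \<in> carrier W" using eng.hyps gen by (auto simp: finite_generating_set_def)
  obtain n1 n2 :: nat where n: "\<And>g. g \<in> carrier W \<Longrightarrow> mdist X (vert g) (vert (g \<otimes>\<^bsub>W\<^esub> h1)) \<le> real n1"
    "\<And>g. g \<in> carrier W \<Longrightarrow> mdist X (vert g) (vert (g \<otimes>\<^bsub>W\<^esub> h2)) \<le> real n2" using eng.IH by blast
  have "mdist X (vert g) (vert (g \<otimes>\<^bsub>W\<^esub> (h1 \<otimes>\<^bsub>W\<^esub> h2))) \<le> real (n1 + n2)" if g: "g \<in> carrier W" for g
  proof -
    have "mdist X (vert g) (vert (g \<otimes>\<^bsub>W\<^esub> h1 \<otimes>\<^bsub>W\<^esub> h2)) \<le> mdist X (vert g) (vert (g \<otimes>\<^bsub>W\<^esub> h1)) +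
        mdist X (vert (g \<otimes>\<^bsub>W\<^esub> h1)) (vert (g \<otimes>\<^bsub>W\<^esub> h1 \<otimes>\<^bsub>W\<^esub> h2))"
      using g h by (intro mdist_triangle vert_in_X) auto
    also have "\<dots> \<le> real n1 + real n2" using n g h by (intro add_mono) auto
    finally show ?thesis using g h by (simp add: W.m_assoc)
  qed
  then show ?case by blast
qed

lemma mdist_le_wdist: "\<exists>n::nat. \<forall>g\<in>carrier W. \<forall>h\<in>carrier W. mdist X (vert g) (vert h) \<le> real n * real (wdist g h)"
proof -
  have "\<forall>s\<in>S. \<exists>n::nat. \<forall>g\<in>carrier W. mdist X (vert g) (vert (g \<otimes>\<^bsub>W\<^esub> el [s])) \<le> real n"
    using mdist_generate gen el_carrier by (simp add: finite_generating_set_def)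
  then obtain N :: "'a \<Rightarrow> nat" where N: "\<And>s g. s \<in> S \<Longrightarrow> g \<in> carrier W \<Longrightarrow>
      mdist X (vert g) (vert (g \<otimes>\<^bsub>W\<^esub> el [s])) \<le> real (N s)" by metis
  define n where "n = Max (insert 0 (N ` S))"
  have Nn: "N s \<le> n" if "s \<in> S" for s unfolding n_def using finite_S that by (intro Max_ge) auto
  have word: "mdist X (vert g) (vert (g \<otimes>\<^bsub>W\<^esub> el xs)) \<le> real n * real (length xs)"
    if "set xs \<subseteq> S" "g \<in> carrier W" for xs g
    using that
  proof (induction xs arbitrary: g)
    case Nil
    then show ?case using mdist_self[OF vert_in_X] by simp
  next
    case (Cons s xs)
    have s: "s \<in> S" "set xs \<subseteq> S" "el [s] \<in> carrier W" "el xs \<in> carrier W"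
      using Cons.prems el_carrier by auto
    have "mdist X (vert g) (vert (g \<otimes>\<^bsub>W\<^esub> el [s] \<otimes>\<^bsub>W\<^esub> el xs)) \<le> mdist X (vert g) (vert (g \<otimes>\<^bsub>W\<^esub> el [s])) +
        mdist X (vert (g \<otimes>\<^bsub>W\<^esub> el [s])) (vert (g \<otimes>\<^bsub>W\<^esub> el [s] \<otimes>\<^bsub>W\<^esub> el xs))"
      using Cons.prems s by (intro mdist_triangle vert_in_X) auto
    also have "\<dots> \<le> real n + real n * real (length xs)"
      using N[OF s(1) Cons.prems(2)] Nn[OF s(1)] Cons.IH[OF s(2)] Cons.prems s
      by (intro add_mono) (fastforce, simp)
    finally show ?case using Cons.prems s el_append[of "[s]" xs] by (simp add: W.m_assoc algebra_simps)
  qed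
  show ?thesis
  proof (intro exI[of _ n] ballI)
    fix g h assume g: "g \<in> carrier W" and h: "h \<in> carrier W"
    obtain xs where xs: "set xs \<subseteq> S" "length xs = wdist g h" "el xs = inv\<^bsub>W\<^esub> g \<otimes>\<^bsub>W\<^esub> h"
      using slen_word[of "inv\<^bsub>W\<^esub> g \<otimes>\<^bsub>W\<^esub> h"] g h by auto
    have "g \<otimes>\<^bsub>W\<^esub> el xs = h" unfolding xs(3) using g h by (simp add: W.m_assoc[symmetric])
    then show "mdist X (vert g) (vert h) \<le> real n * real (wdist g h)" using word[OF xs(1) g] xs(2) by simp
  qed
qed

text \<open>The test function is the word distance from \<open>g\<close> divided by the maximal
  length of an element of \<open>T\<close>.\<close>

lemma wdist_le_mdist: "\<exists>n::nat. \<forall>g\<in>carrier W. \<forall>h\<in>carrier W. real (wdist g h) \<le> real n * mdist X (vert g) (vert h)"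
proof -
  \<comment> \<open>Inserting 1 keeps the divisor positive if \<open>T\<close> is empty or contains
    only the identity.\<close>
  define n where "n = Max (insert 1 (slen ` T))"
  have fin: "finite T" "T \<subseteq> carrier W" using gen by (auto simp: finite_generating_set_def)
  have n: "slen t \<le> n" if "t \<in> T" for t unfolding n_def using fin that by (intro Max_ge) auto
  have n1: "1 \<le> n" unfolding n_def using fin by (intro Max_ge) auto
  show ?thesis
  proof (intro exI[of _ n] ballI)
    fix g h assume g: "g \<in> carrier W" and h: "h \<in> carrier W"
    define f where "f k = real (wdist g k) / real n" for k
    have step: "wdist g (k \<otimes>\<^bsub>W\<^esub> t) \<le> wdist g k + n \<and> wdist g k \<le> wdist g (k \<otimes>\<^bsub>W\<^esub> t) + n"
      if "k \<in> carrier W" "t \<in> T" for k t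
    proof -
      have t: "t \<in> carrier W" using that fin by auto
      have "wdist k (k \<otimes>\<^bsub>W\<^esub> t) \<le> n" using wdist_mult_same[OF that(1) t] n[OF that(2)] by simp
      then show ?thesis using wdist_triangle[of g k "k \<otimes>\<^bsub>W\<^esub> t"] wdist_triangle[of g "k \<otimes>\<^bsub>W\<^esub> t" k]
          wdist_sym[of k "k \<otimes>\<^bsub>W\<^esub> t"] that g t by simp
    qed
    have f1: "\<bar>f u - f v\<bar> \<le> 1" if "(u, v) \<in> parcs CG" for u v
    proof -
      have "\<bar>real (wdist g u) - real (wdist g v)\<bar> \<le> real n"
        using that step unfolding cayley_graph_def by fastforce
      moreover have "f u - f v = (real (wdist g u) - real (wdist g v)) / real n"
        unfolding f_def by (simp add: diff_divide_distrib)
      ultimately show ?thesis using n1 by (simp add: divide_le_eq_1)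
    qed
    have "\<bar>f g - f h\<bar> \<le> mdist X (vert g) (vert h)"
      using affine_extension_lipschitz[of f "vert g" "vert h"] f1 vert_in_X g h by simp
    then have "real (wdist g h) / real n \<le> mdist X (vert g) (vert h)"
      using g unfolding f_def by simp
    then show "real (wdist g h) \<le> real n * mdist X (vert g) (vert h)"
      using n1 by (simp add: divide_le_eq mult.commute)
  qed
qed

lemma bilipschitz:
  "\<exists>q::nat. q \<ge> 1 \<and> (\<forall>g\<in>carrier W. \<forall>h\<in>carrier W. mdist X (vert g) (vert h) \<le> real q * real (wdist g h) \<and>
     real (wdist g h) \<le> real q * mdist X (vert g) (vert h))"
proof -
  obtain n1 n2 :: nat where n: "\<forall>g\<in>carrier W. \<forall>h\<in>carrier W. mdist X (vert g) (vert h) \<le> real n1 * real (wdist g h)"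
    "\<forall>g\<in>carrier W. \<forall>h\<in>carrier W. real (wdist g h) \<le> real n2 * mdist X (vert g) (vert h)"
    using mdist_le_wdist wdist_le_mdist by blast
  have "mdist X (vert g) (vert h) \<le> real (n1 + n2 + 1) * real (wdist g h) \<and>
     real (wdist g h) \<le> real (n1 + n2 + 1) * mdist X (vert g) (vert h)" if "g \<in> carrier W" "h \<in> carrier W" for g h
    using n that mult_right_mono[of "real n1" "real (n1 + n2 + 1)" "real (wdist g h)"]
      mult_right_mono[of "real n2" "real (n1 + n2 + 1)" "mdist X (vert g) (vert h)"] by force
  then show ?thesis by (intro exI[of _ "n1 + n2 + 1"]) auto
qed

lemma near_vertex:
  assumes "x \<in> mspace X"
  shows "\<exists>g\<in>carrier W. mdist X x (vert g) \<le> 1"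
proof -
  obtain u v where uv: "x \<in> graph_cell u v" "graph_cell u v \<in> graph_cells CG" "u \<in> carrier W"
  proof -
    obtain u v where uv: "x \<in> graph_cell u v" "u \<in> pverts CG" "v = u \<or> (u, v) \<in> parcs CG"
      using assms unfolding mspace_X graph_cells_def by blast
    then have "graph_cell u v \<in> graph_cells CG" "u \<in> carrier W"
      unfolding graph_cells_def by (blast, simp add: cayley_graph_def)
    then show ?thesis using that uv(1) by blast
  qed
  obtain t where t: "0 \<le> t" "t \<le> 1" "x = (\<lambda>w. (1 - t) * graph_vertex u w + t * graph_vertex v w)"
    using uv(1) by (auto simp: graph_cell_def)
  have "edge_dist x (vert u) \<le> 1"
  proof (cases "u = v")
    case True
    then show ?thesis using t cell_degenerate[of t u] by simp
  next
    case False
    then show ?thesis using t edge_dist_cell[OF False, of t 0] by simp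
  qed
  then show ?thesis using mdist_cell[OF uv(2,1) graph_vertex_in_cell] uv(3) by (intro bexI[of _ u]) auto
qed

end

locale bilipschitz_coxeter = cayley_coxeter +
  fixes q :: nat
  assumes q: "q \<ge> 1"
    and mdist_wdist: "\<And>g h. g \<in> carrier W \<Longrightarrow> h \<in> carrier W \<Longrightarrow> mdist X (vert g) (vert h) \<le> real q * real (wdist g h)"
    and wdist_mdist: "\<And>g h. g \<in> carrier W \<Longrightarrow> h \<in> carrier W \<Longrightarrow> real (wdist g h) \<le> real q * mdist X (vert g) (vert h)"
begin

lemma subgroup_in_X: "C \<subseteq> S \<Longrightarrow> vert ` word_subgroup C \<subseteq> mspace X"
  and subgroup_nonempty: "vert ` word_subgroup C \<noteq> {}"
  using word_subgroup_carrier[of C] vert_in_X word_subgroup_one by auto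

lemma dist_subgroup_le_height:
  assumes "C \<subseteq> S" "g \<in> carrier W"
  shows "mdist_to_set X (vert g) (vert ` word_subgroup C) \<le> real q * real (height C g)"
proof -
  obtain k where k: "k \<in> word_subgroup C" "wdist k g \<le> height C g" using height_attained[OF assms] by blast
  have kc: "k \<in> carrier W" using k word_subgroup_carrier[OF assms(1)] by blast
  have "mdist_to_set X (vert g) (vert ` word_subgroup C) \<le> mdist X (vert k) (vert g)"
    using mdist_to_set_le[of "vert k" "vert ` word_subgroup C" X "vert g"] k
      mdist_commute[of X "vert k" "vert g"] by simp
  also have "\<dots> \<le> real q * real (wdist k g)" by (rule mdist_wdist[OF kc assms(2)])
  also have "\<dots> \<le> real q * real (height C g)" using k by (intro mult_left_mono) auto
  finally show ?thesis .
qed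

lemma height_le_dist_subgroup:
  assumes "C \<subseteq> S" "g \<in> carrier W"
  shows "real (height C g) \<le> real q * mdist_to_set X (vert g) (vert ` word_subgroup C)"
proof -
  have "real (height C g) / real q \<le> mdist X (vert g) a" if "a \<in> vert ` word_subgroup C" for a
  proof -
    obtain k where k: "k \<in> word_subgroup C" "a = vert k" using \<open>a \<in> _\<close> by blast
    have kc: "k \<in> carrier W" using k word_subgroup_carrier[OF assms(1)] by blast
    have "real (height C g) \<le> real (wdist k g)" using height_le[OF assms k(1)] by simp
    also have "\<dots> \<le> real q * mdist X (vert k) (vert g)" by (rule wdist_mdist[OF kc assms(2)])
    finally show ?thesis using q k mdist_commute[of X "vert k" "vert g"] by (simp add: divide_le_eq mult.commute)
  qed
  then have "real (height C g) / real q \<le> mdist_to_set X (vert g) (vert ` word_subgroup C)"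
    by (intro mdist_to_set_ge subgroup_nonempty)
  then show ?thesis using q by (simp add: divide_le_eq mult.commute)
qed

lemma dist_subgroup_lipschitz:
  "C \<subseteq> S \<Longrightarrow> x \<in> mspace X \<Longrightarrow> y \<in> mspace X \<Longrightarrow>
    mdist_to_set X x (vert ` word_subgroup C) \<le> mdist X x y + mdist_to_set X y (vert ` word_subgroup C)"
  by (intro mdist_to_set_lipschitz subgroup_in_X subgroup_nonempty)

end

section \<open>Quasi-geodesics and divergence under the 4-cycle condition\<close>

text \<open>A new point \<open>ys (J + 1)\<close> is chosen only once the sequence has moved further than 1 from
  \<open>ys J\<close>, so that the number of chosen points is bounded by the length.\<close>

lemma greedy_chain:
  fixes x :: "nat \<Rightarrow> 'p"
  assumes "\<And>i. i \<le> N \<Longrightarrow> x i \<in> mspace X" "\<And>i. i < N \<Longrightarrow> mdist X (x i) (x (Suc i)) \<le> 1"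
  shows "\<exists>J ys. ys 0 = x 0 \<and> (\<forall>i\<le>J. ys i \<in> x ` {..N}) \<and> (\<forall>i<J. mdist X (ys i) (ys (Suc i)) \<le> 2) \<and>
    mdist X (ys J) (x N) \<le> 1 \<and> real J + mdist X (ys J) (x N) \<le> (\<Sum>i<N. mdist X (x i) (x (Suc i)))"
  using assms
proof (induction N)
  case 0
  then show ?case by (intro exI[of _ 0] exI[of _ x]) simp
next
  case (Suc N)
  let ?s = "\<lambda>n. \<Sum>i<n. mdist X (x i) (x (Suc i))"
  have "\<exists>J ys. ys 0 = x 0 \<and> (\<forall>i\<le>J. ys i \<in> x ` {..N}) \<and> (\<forall>i<J. mdist X (ys i) (ys (Suc i)) \<le> 2) \<and>
    mdist X (ys J) (x N) \<le> 1 \<and> real J + mdist X (ys J) (x N) \<le> ?s N"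
    using Suc.prems by (intro Suc.IH) auto
  then obtain J ys where y0: "ys 0 = x 0" and y: "\<And>i. i \<le> J \<Longrightarrow> ys i \<in> x ` {..N}"
    and jump: "\<And>i. i < J \<Longrightarrow> mdist X (ys i) (ys (Suc i)) \<le> 2"
    and last: "mdist X (ys J) (x N) \<le> 1" "real J + mdist X (ys J) (x N) \<le> ?s N" by blast
  have "ys J \<in> mspace X" using y[of J] Suc.prems(1) by auto
  then have tri: "mdist X (ys J) (x (Suc N)) \<le> mdist X (ys J) (x N) + mdist X (x N) (x (Suc N))"
    using Suc.prems(1) by (intro mdist_triangle) auto
  have new: "mdist X (x N) (x (Suc N)) \<le> 1" using Suc.prems(2) by simp
  show ?case
  proof (cases "mdist X (ys J) (x (Suc N)) \<le> 1")
    case True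
    have "ys i \<in> x ` {..Suc N}" if "i \<le> J" for i using y[OF that] by auto
    then show ?thesis using y0 jump True tri last by (intro exI[of _ J] exI[of _ ys]) auto
  next
    case False
    let ?y = "ys(Suc J := x (Suc N))"
    have "?y i \<in> x ` {..Suc N}" if "i \<le> Suc J" for i using y[of i] that by (cases "i = Suc J") auto
    moreover have "mdist X (?y i) (?y (Suc i)) \<le> 2" if "i < Suc J" for i
      using jump[of i] that tri last new by (cases "i = J") auto
    moreover have "x (Suc N) \<in> mspace X" using Suc.prems(1) by simp
    ultimately show ?thesis using y0 False tri last by (intro exI[of _ "Suc J"] exI[of _ ?y]) auto
  qed
qed

lemma pathin_fine_subdivision:
  assumes p: "pathin (mtopology_of X) p" and "e > 0"
  shows "\<exists>N>0. \<forall>i<N. mdist X (p (real i / real N)) (p (real (Suc i) / real N)) < e"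
proof -
  let ?I = "submetric euclidean_metric {0..1::real}"
  have top: "mtopology_of ?I = top_of_set {0..1}" by (simp add: mtopology_of_submetric)
  have "compact_space (mtopology_of ?I)" unfolding top by (simp add: compact_space_subtopology)
  then have "uniformly_continuous_map ?I X p"
    using p unfolding pathin_def by (intro continuous_imp_uniformly_continuous_map) (simp_all add: top)
  then obtain d where d: "d > 0" "\<And>x y. x \<in> {0..1} \<Longrightarrow> y \<in> {0..1} \<Longrightarrow> dist y x < d \<Longrightarrow> mdist X (p y) (p x) < e"
    unfolding uniformly_continuous_map_def using \<open>e > 0\<close> by (auto simp del: atLeastAtMost_iff)
  obtain N :: nat where N: "1 / d < real N" using reals_Archimedean2 by blast
  have N0: "N > 0" using N d by (intro Nat.gr0I) (auto simp: field_simps)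
  have "mdist X (p (real i / real N)) (p (real (Suc i) / real N)) < e" if "i < N" for i
  proof (rule d(2))
    have "dist (real i / real N) (real (Suc i) / real N) = 1 / real N"
      using N0 by (simp add: dist_real_def field_simps)
    also have "\<dots> < d" using N d N0 by (simp add: field_simps)
    finally show "dist (real i / real N) (real (Suc i) / real N) < d" .
  qed (use that N0 in \<open>auto simp: field_simps\<close>)
  then show ?thesis using N0 by blast
qed

lemma curve_length_subdivision:
  assumes "N > 0"
  shows "ennreal (\<Sum>i<N. mdist X (p (real i / real N)) (p (real (Suc i) / real N))) \<le> curve_length X p"
proof -
  let ?ts = "map (\<lambda>i. real i / real N) [0..<Suc N]"
  have len: "length ?ts - 1 = N" by simp
  have nth: "?ts ! i = real i / real N" if "i \<le> N" for i using that by (simp del: upt_Suc)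
  have mono: "mono (\<lambda>i. real i / real N)" by (intro monoI) (simp add: divide_right_mono)
  have "sorted ?ts"
    by (rule sorted_map_mono[OF sorted_upt]) (use mono in \<open>auto simp: mono_on_def mono_def\<close>)
  moreover have "set ?ts \<subseteq> {0..1}" using assms by (auto simp: divide_le_eq_1)
  ultimately have "(\<Sum>i<length ?ts - 1. ennreal (mdist X (p (?ts ! i)) (p (?ts ! Suc i)))) \<le> curve_length X p"
    unfolding curve_length_def by (intro SUP_upper) auto
  moreover have "(\<Sum>i<length ?ts - 1. ennreal (mdist X (p (?ts ! i)) (p (?ts ! Suc i)))) =
      (\<Sum>i<N. ennreal (mdist X (p (real i / real N)) (p (real (Suc i) / real N))))"
    unfolding len
  proof (intro sum.cong HOL.refl)
    fix i assume "i \<in> {..<N}"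
    then have "i \<le> N" "Suc i \<le> N" by auto
    then show "ennreal (mdist X (p (?ts ! i)) (p (?ts ! Suc i))) =
        ennreal (mdist X (p (real i / real N)) (p (real (Suc i) / real N)))" by (simp only: nth)
  qed
  ultimately show ?thesis by (simp add: sum_ennreal)
qed

text \<open>Uniform continuity gives a fine subdivision, but its number of points is not controlled
  by the length; \<open>greedy_chain\<close> thins it out. The extra \<open>+ 1\<close> is the final
  jump to \<open>p 1\<close>.\<close>

lemma rectifiable_chain:
  assumes p: "pathin (mtopology_of X) p" and l: "curve_length X p \<le> ennreal l" "0 \<le> l"
  shows "\<exists>J ys. ys 0 = p 0 \<and> ys J = p 1 \<and> (\<forall>i\<le>J. ys i \<in> p ` {0..1}) \<and>
    (\<forall>i<J. mdist X (ys i) (ys (Suc i)) \<le> 2) \<and> real J \<le> l + 1"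
proof -
  obtain N where N: "N > 0" "\<And>i. i < N \<Longrightarrow> mdist X (p (real i / real N)) (p (real (Suc i) / real N)) < 1"
    using pathin_fine_subdivision[OF p, of 1] by auto
  let ?x = "\<lambda>i. p (real i / real N)"
  have in01: "real i / real N \<in> {0..1}" if "i \<le> N" for i using that N(1) by (auto simp: divide_le_eq_1)
  have pX: "p t \<in> mspace X" if "t \<in> {0..1}" for t
    using p that unfolding pathin_def continuous_map_def by auto
  have 1: "?x i \<in> mspace X" if "i \<le> N" for i using pX in01[OF that] by blast
  have 2: "mdist X (?x i) (?x (Suc i)) \<le> 1" if "i < N" for i using N(2)[OF that] by simp
  obtain J ys where ys: "ys 0 = ?x 0" "\<And>i. i \<le> J \<Longrightarrow> ys i \<in> ?x ` {..N}"
    "\<And>i. i < J \<Longrightarrow> mdist X (ys i) (ys (Suc i)) \<le> 2" "mdist X (ys J) (?x N) \<le> 1"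
    "real J + mdist X (ys J) (?x N) \<le> (\<Sum>i<N. mdist X (?x i) (?x (Suc i)))"
    using greedy_chain[of N ?x X, OF 1 2] by blast
  have "ennreal (\<Sum>i<N. mdist X (?x i) (?x (Suc i))) \<le> ennreal l"
    using curve_length_subdivision[OF N(1), of X p] l(1) by (rule order_trans)
  then have "(\<Sum>i<N. mdist X (?x i) (?x (Suc i))) \<le> l" using l(2) by (simp add: ennreal_le_iff)
  then have J: "real J \<le> l" using ys(5) mdist_nonneg[of X "ys J" "?x N"] by linarith
  let ?y = "ys(Suc J := p 1)"
  have N1: "?x N = p 1" using N(1) by simp
  have im: "ys i \<in> p ` {0..1}" if "i \<le> J" for i using ys(2)[OF that] in01 by blast
  have "?y i \<in> p ` {0..1}" if "i \<le> Suc J" for i using im[of i] that by (cases "i = Suc J") auto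
  moreover have "mdist X (?y i) (?y (Suc i)) \<le> 2" if "i < Suc J" for i
    using ys(3)[of i] ys(4) N1 that by (cases "i = J") auto
  moreover have "?y 0 = p 0" "?y (Suc J) = p 1" using ys(1) by auto
  ultimately show ?thesis using J by (intro exI[of _ "Suc J"] exI[of _ ?y]) auto
qed

context bilipschitz_coxeter
begin

text \<open>Rounding both ends of a jump adds 2 to \<open>D\<close>. Points that are vertices
  already stay in place, which keeps endpoints in the subgroup at height 0.\<close>

lemma vertex_chain:
  assumes "\<And>i. i \<le> N \<Longrightarrow> xs i \<in> mspace X" "\<And>i. i < N \<Longrightarrow> mdist X (xs i) (xs (Suc i)) \<le> D"
  shows "\<exists>h. (\<forall>i\<le>N. h i \<in> carrier W \<and> mdist X (xs i) (vert (h i)) \<le> 1 \<and>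
      (xs i \<in> vert ` carrier W \<longrightarrow> xs i = vert (h i))) \<and>
    (\<forall>i<N. real (wdist (h i) (h (Suc i))) \<le> real q * (D + 2))"
proof -
  have "\<exists>g\<in>carrier W. mdist X x (vert g) \<le> 1 \<and>
      (x \<in> vert ` carrier W \<longrightarrow> x = vert g)" if "x \<in> mspace X" for x
  proof (cases "x \<in> vert ` carrier W")
    case True
    then obtain g where "g \<in> carrier W" "x = vert g" by blast
    then show ?thesis using mdist_self[OF that] by (intro bexI[of _ g]) auto
  qed (use near_vertex[OF that] in auto)
  then obtain f where f: "\<And>x. x \<in> mspace X \<Longrightarrow> f x \<in> carrier W \<and> mdist X x (vert (f x)) \<le> 1 \<and>
      (x \<in> vert ` carrier W \<longrightarrow> x = vert (f x))" by metis
  have "real (wdist (f (xs i)) (f (xs (Suc i)))) \<le> real q * (D + 2)" if i: "i < N" for i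
  proof -
    have xi: "xs i \<in> mspace X" "xs (Suc i) \<in> mspace X" using assms(1) i by auto
    note fi = f[OF xi(1)] f[OF xi(2)]
    have "mdist X (vert (f (xs i))) (vert (f (xs (Suc i)))) \<le>
      mdist X (vert (f (xs i))) (xs i) + (mdist X (xs i) (xs (Suc i)) + mdist X (xs (Suc i)) (vert (f (xs (Suc i)))))"
      using mdist_triangle[of "vert (f (xs i))" X "xs i" "vert (f (xs (Suc i)))"]
        mdist_triangle[of "xs i" X "xs (Suc i)" "vert (f (xs (Suc i)))"] xi fi vert_in_X by fastforce
    also have "\<dots> \<le> D + 2"
      using fi assms(2)[OF i] mdist_commute[of X "vert (f (xs i))" "xs i"] by linarith
    finally have "real q * mdist X (vert (f (xs i))) (vert (f (xs (Suc i)))) \<le> real q * (D + 2)"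
      by (intro mult_left_mono) auto
    then show ?thesis using wdist_mdist[of "f (xs i)" "f (xs (Suc i))"] fi by linarith
  qed
  then show ?thesis using f assms(1) by (intro exI[of _ "\<lambda>i. f (xs i)"]) blast
qed

text \<open>A quasi-geodesic is sampled at unit times and rounded to vertices, after which
  \<open>quasi_geodesic_height_bound\<close> applies.\<close>

lemma strongly_quasiconvex_if:
  assumes tf: "triangle_free \<Gamma>" and lc: "link_condition C" and C: "C \<subseteq> S"
  shows "strongly_quasiconvex_subset X (vert ` word_subgroup C)"
  unfolding strongly_quasiconvex_subset_def
proof (intro allI impI)
  fix K L :: real assume K: "1 \<le> K" and L: "0 \<le> L"
  let ?A = "vert ` word_subgroup C"
  \<comment> \<open>Samples jump by at most \<open>K + L\<close>, rounding adds 2, and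
    \<open>q\<close> converts to the word metric.\<close>
  define D where "D = nat \<lceil>real q * (K + L + 2)\<rceil>"
  have D: "real q * (K + L + 2) \<le> real D" unfolding D_def by linarith
  have lpos: "K * real q > 0" using K q by simp
  obtain M0 where M0: "\<And>h N i. (\<forall>i\<le>N. h i \<in> carrier W) \<Longrightarrow> (\<forall>i<N. wdist (h i) (h (Suc i)) \<le> D) \<Longrightarrow>
    (\<forall>i j. i \<le> j \<longrightarrow> j \<le> N \<longrightarrow> real (j - i) / (K * real q) - (L + 3) \<le> real (wdist (h i) (h j))) \<Longrightarrow>
    height C (h 0) = 0 \<Longrightarrow> height C (h N) = 0 \<Longrightarrow> i \<le> N \<Longrightarrow> real (height C (h i)) \<le> M0"
    using quasi_geodesic_height_bound[OF tf lc C lpos, of D "L + 3"] by metis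
  show "\<exists>M. \<forall>a b c. a \<le> b \<and> quasi_geodesic X K L {a..b} c \<and> c a \<in> ?A \<and> c b \<in> ?A \<longrightarrow>
    c ` {a..b} \<subseteq> open_nbhd X ?A M"
  \<comment> \<open>\<open>K + L\<close> back to the preceding sample, 1 to its vertex,
    \<open>q |M0|\<close> on to the subgroup, and 1 more for the strict inequality.\<close>
  proof (intro exI[of _ "K + L + 2 + real q * \<bar>M0\<bar>"] allI impI, elim conjE)
    fix a b :: real and c
    assume ab: "a \<le> b" and qg: "quasi_geodesic X K L {a..b} c" and ca: "c a \<in> ?A" and cb: "c b \<in> ?A"
    have cX: "c t \<in> mspace X" if "t \<in> {a..b}" for t using qg that by (auto simp: quasi_geodesic_def)
    have lo: "\<bar>s - t\<bar> / K - L \<le> mdist X (c s) (c t)" and up: "mdist X (c s) (c t) \<le> K * \<bar>s - t\<bar> + L"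
      if "s \<in> {a..b}" "t \<in> {a..b}" for s t
      using qg that by (auto simp: quasi_geodesic_def)
    define N where "N = nat \<lceil>b - a\<rceil>"
    have N: "b - a \<le> real N" "real N < b - a + 1" using ab unfolding N_def by linarith+
    \<comment> \<open>The minimum makes the last sample equal to \<open>b\<close>; the last interval
      may be shorter, which costs the \<open>- 1\<close> in \<open>td\<close>.\<close>
    define t where "t i = min (a + real i) b" for i
    have tI: "t i \<in> {a..b}" for i using ab by (auto simp: t_def)
    have t0: "t 0 = a" and tN: "t N = b" using ab N by (auto simp: t_def)
    have td: "real (j - i) - 1 \<le> \<bar>t i - t j\<bar>" "\<bar>t i - t j\<bar> \<le> real (j - i)" if "i \<le> j" "j \<le> N" for i j
      using that N by (auto simp: t_def min_def of_nat_diff)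
    have jump: "mdist X (c (t i)) (c (t (Suc i))) \<le> K + L" if "i < N" for i
    proof -
      have "K * \<bar>t i - t (Suc i)\<bar> \<le> K * 1" using td(2)[of i "Suc i"] that K by (intro mult_left_mono) auto
      then show ?thesis using up[OF tI[of i] tI[of "Suc i"]] by linarith
    qed
    obtain h where h: "\<And>i. i \<le> N \<Longrightarrow> h i \<in> carrier W \<and> mdist X (c (t i)) (vert (h i)) \<le> 1 \<and>
      (c (t i) \<in> vert ` carrier W \<longrightarrow> c (t i) = vert (h i))"
      "\<And>i. i < N \<Longrightarrow> real (wdist (h i) (h (Suc i))) \<le> real q * (K + L + 2)"
      using vertex_chain[of N "\<lambda>i. c (t i)" "K + L"] cX tI jump by blast
    have h0: "height C (h i) = 0" if "i \<le> N" "c (t i) \<in> ?A" for i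
    proof -
      have "c (t i) = vert (h i)" using h(1)[OF that(1)] that(2) word_subgroup_carrier[OF C] by blast
      then have "mdist_to_set X (vert (h i)) ?A \<le> 0"
        using mdist_to_set_le[OF that(2), of X "c (t i)"] mdist_self[OF cX[OF tI[of i]]] by simp
      then have "real q * mdist_to_set X (vert (h i)) ?A \<le> 0" using q by (simp add: mult_nonneg_nonpos)
      then show ?thesis using height_le_dist_subgroup[OF C, of "h i"] h(1)[OF that(1)] by linarith
    qed
    have low: "real (j - i) / (K * real q) - (L + 3) \<le> real (wdist (h i) (h j))" if ij: "i \<le> j" "j \<le> N" for i j
    proof -
      have hi: "h i \<in> carrier W" "h j \<in> carrier W" "mdist X (c (t i)) (vert (h i)) \<le> 1" "mdist X (c (t j)) (vert (h j)) \<le> 1"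
        using h(1)[of i] h(1)[of j] ij by auto
      have "(real (j - i) - 1) / K - L \<le> \<bar>t i - t j\<bar> / K - L"
        using td(1)[OF ij] K by (simp add: divide_right_mono)
      also have "\<dots> \<le> mdist X (c (t i)) (c (t j))" by (rule lo[OF tI tI])
      also have "\<dots> \<le> mdist X (c (t i)) (vert (h i)) + (mdist X (vert (h i)) (vert (h j)) + mdist X (vert (h j)) (c (t j)))"
        using mdist_triangle[of "c (t i)" X "vert (h i)" "c (t j)"] mdist_triangle[of "vert (h i)" X "vert (h j)" "c (t j)"]
          cX tI vert_in_X hi by fastforce
      also have "\<dots> \<le> 2 + mdist X (vert (h i)) (vert (h j))"
        using hi mdist_commute[of X "vert (h j)" "c (t j)"] by linarith
      finally have "(real (j - i) - 1) / K - L \<le> 2 + real q * real (wdist (h i) (h j))"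
        using mdist_wdist[OF hi(1,2)] by linarith
      then have *: "((real (j - i) - 1) / K - L - 2) / real q \<le> real (wdist (h i) (h j))"
        using q by (simp add: divide_le_eq mult.commute)
      \<comment> \<open>The origin of the additive constant \<open>L + 3\<close>: \<open>L\<close>
        from the quasi-geodesic, 2 from rounding, and at most 1 from the shorter last
        interval.\<close>
      have "(1 / K + L + 2) / real q \<le> (L + 3) / 1"
        using K q L by (intro frac_le) (auto simp: divide_le_eq)
      then have "real (j - i) / (K * real q) - (L + 3) \<le> real (j - i) / (K * real q) - (1 / K + L + 2) / real q"
        by (intro diff_left_mono) simp
      also have "\<dots> = ((real (j - i) - 1) / K - L - 2) / real q"
        using K q by (simp add: field_simps)
      finally show ?thesis using * by (rule order_trans)
    qed
    have jumpD: "wdist (h i) (h (Suc i)) \<le> D" if "i < N" for i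
      using h(2)[OF that] D by linarith
    have bound: "real (height C (h i)) \<le> M0" if "i \<le> N" for i
      using h(1) jumpD low h0[of 0] h0[of N] ca cb t0 tN that by (intro M0[of N h]) auto
    show "c ` {a..b} \<subseteq> open_nbhd X ?A (K + L + 2 + real q * \<bar>M0\<bar>)"
    proof
      fix x assume "x \<in> c ` {a..b}"
      then obtain s where s: "s \<in> {a..b}" "x = c s" by blast
      define i where "i = nat \<lfloor>s - a\<rfloor>"
      have i: "real i \<le> s - a" "s - a < real i + 1" 
      proof -
        have "0 \<le> s - a" using s by simp
        then show "real i \<le> s - a" "s - a < real i + 1" unfolding i_def by linarith+
      qed
      have iN: "i \<le> N" using i(1) N s by auto
      have ti: "\<bar>s - t i\<bar> \<le> 1" using i s by (auto simp: t_def)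
      have hi: "h i \<in> carrier W" "mdist X (c (t i)) (vert (h i)) \<le> 1" using h(1)[OF iN] by auto
      have "mdist X x (c (t i)) \<le> K + L"
      proof -
        have "K * \<bar>s - t i\<bar> \<le> K * 1" using ti K by (intro mult_left_mono) auto
        then show ?thesis using up[OF s(1) tI[of i]] unfolding s(2) by linarith
      qed
      moreover have "mdist_to_set X x ?A \<le> mdist X x (c (t i)) + mdist_to_set X (c (t i)) ?A"
        using s cX tI by (intro dist_subgroup_lipschitz[OF C]) auto
      moreover have "mdist_to_set X (c (t i)) ?A \<le> mdist X (c (t i)) (vert (h i)) + mdist_to_set X (vert (h i)) ?A"
        using cX tI vert_in_X hi by (intro dist_subgroup_lipschitz[OF C]) auto
      moreover have "mdist_to_set X (vert (h i)) ?A \<le> real q * \<bar>M0\<bar>"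
      proof -
        have "real q * real (height C (h i)) \<le> real q * \<bar>M0\<bar>" using bound[OF iN] by (intro mult_left_mono) auto
        then show ?thesis using dist_subgroup_le_height[OF C hi(1)] by linarith
      qed
      ultimately have "mdist_to_set X x ?A < K + L + 2 + real q * \<bar>M0\<bar>" using hi by linarith
      then show "x \<in> open_nbhd X ?A (K + L + 2 + real q * \<bar>M0\<bar>)"
        using s cX by (auto simp: open_nbhd_def)
    qed
  qed
qed

end

section \<open>The quadratic lower bound for the divergence\<close>

lemma ennreal_le_lower_rel_divergence:
  assumes "\<And>p. pathin (mtopology_of X) p \<Longrightarrow> (\<And>t. t \<in> {0..1} \<Longrightarrow> \<rho> * r \<le> mdist_to_set X (p t) A) \<Longrightarrow>
      p 0 \<in> nbhd_boundary X A r \<Longrightarrow> p 1 \<in> nbhd_boundary X A r \<Longrightarrow> real n * r \<le> mdist X (p 0) (p 1) \<Longrightarrow>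
      m \<le> curve_length X p"
  shows "m \<le> lower_rel_divergence X A n \<rho> r"
proof -
  have "m \<le> complement_dist X A (\<rho> * r) x1 x2"
    if x: "x1 \<in> nbhd_boundary X A r" "x2 \<in> nbhd_boundary X A r" "real n * r \<le> mdist X x1 x2" for x1 x2
    unfolding complement_dist_def length_dist_def
  proof (rule INF_greatest)
    fix p assume "p \<in> {p. pathin (subtopology (mtopology_of X) (mspace X - open_nbhd X A (\<rho> * r))) p \<and> p 0 = x1 \<and> p 1 = x2}"
    then have p: "pathin (mtopology_of X) p" "\<And>t. t \<in> {0..1} \<Longrightarrow> p t \<in> mspace X - open_nbhd X A (\<rho> * r)"
      "p 0 = x1" "p 1 = x2" by (auto simp: pathin_subtopology)
    have "\<rho> * r \<le> mdist_to_set X (p t) A" if "t \<in> {0..1}" for t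
      using p(2)[OF that] by (auto simp: open_nbhd_def)
    then show "m \<le> curve_length X p" using assms[OF p(1)] p(3,4) x by simp
  qed
  then show ?thesis unfolding lower_rel_divergence_def by (intro INF_greatest) auto
qed

context bilipschitz_coxeter
begin

text \<open>The path becomes a chain of at most \<open>l + 1\<close> jumps at height at least about
  \<open>\<rho> r / q\<close>, and \<open>coarse_divergence\<close> charges this height for each
  unit of a displacement of order \<open>r\<close>.\<close>

lemma curve_length_lower:
  fixes r \<rho> l :: real
  assumes tf: "triangle_free \<Gamma>" and lc: "link_condition C" and C: "C \<subseteq> S"
    and p: "pathin (mtopology_of X) p" and l: "curve_length X p \<le> ennreal l" "0 \<le> l"
    and far: "\<And>t. t \<in> {0..1} \<Longrightarrow> \<rho> * r \<le> mdist_to_set X (p t) (vert ` word_subgroup C)"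
    and ends: "mdist_to_set X (p 0) (vert ` word_subgroup C) = r" "mdist_to_set X (p 1) (vert ` word_subgroup C) = r"
    and apart: "4 * real q ^ 2 * r \<le> mdist X (p 0) (p 1)"
    and \<rho>: "0 < \<rho>" and r: "14 * real q ^ 2 / \<rho> + 5 < r"
  shows "\<rho> * r ^ 2 \<le> 8 * real q ^ 2 * (l + 1)"
proof -
  let ?A = "vert ` word_subgroup C"
  have q1: "1 \<le> real q" using q by simp
  have pX: "p t \<in> mspace X" if "t \<in> {0..1}" for t
    using p that unfolding pathin_def continuous_map_def by auto
  obtain J ys where ys: "ys 0 = p 0" "ys J = p 1" "\<And>i. i \<le> J \<Longrightarrow> ys i \<in> p ` {0..1}"
    "\<And>i. i < J \<Longrightarrow> mdist X (ys i) (ys (Suc i)) \<le> 2" "real J \<le> l + 1"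
    using rectifiable_chain[OF p l] by blast
  have yX: "ys i \<in> mspace X" if "i \<le> J" for i
  proof -
    obtain t where "t \<in> {0..1}" "ys i = p t" using ys(3)[OF \<open>i \<le> J\<close>] by blast
    then show ?thesis using pX[of t] by simp
  qed
  obtain h where h: "\<And>i. i \<le> J \<Longrightarrow> h i \<in> carrier W \<and> mdist X (ys i) (vert (h i)) \<le> 1"
    "\<And>i. i < J \<Longrightarrow> real (wdist (h i) (h (Suc i))) \<le> real q * (2 + 2)"
    using vertex_chain[of J ys 2] yX ys(4) by blast
  \<comment> \<open>Jumps of length 2, plus 2 for rounding, times \<open>q\<close>.\<close>
  define D where "D = 4 * q"
  \<comment> \<open>The height guaranteed at the rounded points, less the margin \<open>D\<close> of
    \<open>coarse_divergence\<close>.\<close>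
  define R where "R = nat \<lfloor>(\<rho> * r - 1) / real q\<rfloor> - D"
  have jump: "wdist (h i) (h (Suc i)) \<le> D" if "i < J" for i
  proof -
    have "real (wdist (h i) (h (Suc i))) \<le> real D" using h(2)[OF that] unfolding D_def by simp
    then show ?thesis unfolding of_nat_le_iff .
  qed
  \<comment> \<open>Half of \<open>\<rho> r / q\<close> is kept for the conclusion. The other half
    is at least \<open>7 q\<close> and covers the loss of at most \<open>4 q + 3\<close> in
    \<open>R - 1\<close>.\<close>
  have r14: "14 * real q ^ 2 \<le> \<rho> * r"
  proof -
    have "14 * real q ^ 2 / \<rho> \<le> r" using r by linarith
    then show ?thesis using \<rho> by (simp add: divide_le_eq mult.commute)
  qed
  have qq: "real q \<le> real q ^ 2" using q1 by (simp add: power2_eq_square)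
  have frac: "14 * real q - 1 \<le> (\<rho> * r - 1) / real q"
  proof -
    have "(14 * real q - 1) * real q \<le> \<rho> * r - 1"
      using r14 q1 by (simp add: power2_eq_square algebra_simps)
    then show ?thesis using q1 by (simp add: le_divide_eq)
  qed
  have "real R \<ge> (\<rho> * r - 1) / real q - 1 - 4 * real q" unfolding R_def D_def by linarith
  moreover have "\<rho> * r / (2 * real q) \<ge> 7 * real q"
    using r14 q1 by (simp add: le_divide_eq power2_eq_square)
  moreover have "(\<rho> * r - 1) / real q \<ge> \<rho> * r / (2 * real q) + \<rho> * r / (2 * real q) - 1"
  proof -
    have "(\<rho> * r - 1) / real q = \<rho> * r / (2 * real q) + \<rho> * r / (2 * real q) - 1 / real q"
      by (simp add: diff_divide_distrib)
    then show ?thesis using q1 by (simp add: divide_le_eq)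
  qed
  ultimately have R1: "real R - 1 \<ge> \<rho> * r / (2 * real q)" "real R \<ge> 1" using q1 by linarith+
  have far': "R + D \<le> height C (h i)" if i: "i \<le> J" for i
  proof -
    obtain t where t: "t \<in> {0..1}" "ys i = p t" using ys(3)[OF i] by blast
    have hi: "h i \<in> carrier W" "mdist X (ys i) (vert (h i)) \<le> 1" using h(1)[OF i] by auto
    have "\<rho> * r \<le> mdist_to_set X (ys i) ?A" using far[OF t(1)] t(2) by simp
    also have "\<dots> \<le> 1 + mdist_to_set X (vert (h i)) ?A"
      using dist_subgroup_lipschitz[OF C yX[OF i] vert_in_X[OF hi(1)]] hi(2) by linarith
    also have "\<dots> \<le> 1 + real q * real (height C (h i))" using dist_subgroup_le_height[OF C hi(1)] by linarith
    finally have "(\<rho> * r - 1) / real q \<le> real (height C (h i))"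
      using q1 by (simp add: divide_le_eq mult.commute)
    then have "nat \<lfloor>(\<rho> * r - 1) / real q\<rfloor> \<le> height C (h i)" by linarith
    moreover have "D \<le> nat \<lfloor>(\<rho> * r - 1) / real q\<rfloor>" unfolding D_def using frac q1 by linarith
    ultimately show ?thesis unfolding R_def by linarith
  qed
  have end_height: "real (height C (h i)) \<le> real q * (r + 1)" if "i \<le> J" "mdist_to_set X (ys i) ?A = r" for i
  proof -
    have hi: "h i \<in> carrier W" "mdist X (ys i) (vert (h i)) \<le> 1" using h(1)[OF that(1)] by auto
    have "mdist_to_set X (vert (h i)) ?A \<le> r + 1"
      using dist_subgroup_lipschitz[OF C vert_in_X[OF hi(1)] yX[OF that(1)]] hi(2) that(2)
        mdist_commute[of X "vert (h i)" "ys i"] by linarith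
    then have "real q * mdist_to_set X (vert (h i)) ?A \<le> real q * (r + 1)" using q1 by (intro mult_left_mono) auto
    then show ?thesis using height_le_dist_subgroup[OF C hi(1)] by linarith
  qed
  have h0: "h 0 \<in> carrier W" "mdist X (p 0) (vert (h 0)) \<le> 1" and hJ: "h J \<in> carrier W" "mdist X (p 1) (vert (h J)) \<le> 1"
    using h(1)[of 0] h(1)[of J] ys(1,2) by auto
  have r5: "r > 5" using r \<rho> by (smt (verit) divide_nonneg_pos zero_le_power2)
  have "mdist X (p 0) (p 1) \<le> 2 + real q * real (wdist (h 0) (h J))"
  proof -
    have "mdist X (p 0) (p 1) \<le> mdist X (p 0) (vert (h 0)) + (mdist X (vert (h 0)) (vert (h J)) + mdist X (vert (h J)) (p 1))"
      using mdist_triangle[of "p 0" X "vert (h 0)" "p 1"] mdist_triangle[of "vert (h 0)" X "vert (h J)" "p 1"]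
        pX[of 0] pX[of 1] vert_in_X h0 hJ by fastforce
    then show ?thesis using h0 hJ mdist_wdist[OF h0(1) hJ(1)] mdist_commute[of X "vert (h J)" "p 1"] by linarith
  qed
  then have "4 * real q ^ 2 * r - 2 \<le> real q * real (wdist (h 0) (h J))" using apart by linarith
  moreover have "real q * (4 * real q * r - 2) \<le> 4 * real q ^ 2 * r - 2"
    using q1 by (simp add: power2_eq_square algebra_simps)
  ultimately have "real q * (4 * real q * r - 2) \<le> real q * real (wdist (h 0) (h J))" by linarith
  then have "4 * real q * r - 2 \<le> real (wdist (h 0) (h J))" using q1 by simp
  moreover have "real (height C (h 0)) \<le> real q * (r + 1)" "real (height C (h J)) \<le> real q * (r + 1)"
    using end_height[of 0] end_height[of J] ys ends by auto
  \<comment> \<open>The separation \<open>4 q^2 r\<close> is calibrated here: after the heights of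
    both ends are subtracted, a displacement of at least \<open>r\<close> remains.\<close>
  moreover have "r \<le> 4 * real q * r - 2 - real q * (r + 1) - real q * (r + 1) - 1"
  proof -
    have "(2 * real q - 1) * (r - 4) \<ge> 1 * 1" using q1 r5 by (intro mult_mono) auto
    then show ?thesis using q1 by (simp add: algebra_simps)
  qed
  ultimately have "r \<le> real (wdist (h 0) (h J) - height C (h 0) - height C (h J) - 1)" by linarith
  moreover have "\<rho> * r / (2 * real q) \<le> real (R - 1)" using R1 by linarith
  ultimately have "r * (\<rho> * r / (2 * real q)) \<le>
      real (wdist (h 0) (h J) - height C (h 0) - height C (h J) - 1) * real (R - 1)"
    using r5 \<rho> by (intro mult_mono) auto
  also have "\<dots> \<le> real (J * D)"
    using coarse_divergence[OF tf lc C, of J h D R] h(1) jump far'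
    unfolding of_nat_mult[symmetric] of_nat_le_iff by blast
  also have "\<dots> \<le> (l + 1) * (4 * real q)" using ys(5) unfolding D_def by (simp add: mult_right_mono)
  finally show ?thesis using q1 by (simp add: field_simps power2_eq_square)
qed

lemma at_least_quadratic_if:
  assumes tf: "triangle_free \<Gamma>" and lc: "link_condition C" and C: "C \<subseteq> S"
  shows "at_least_quadratic (subgroup_divergence W T (word_subgroup C))"
proof -
  let ?A = "vert ` word_subgroup C"
  have q1: "1 \<le> real q" using q by simp
  \<comment> \<open>As \<open>n\<close> is at least 2, the factor \<open>2 q^2\<close> provides the
    separation \<open>4 q^2 r\<close> for \<open>curve_length_lower\<close>.\<close>
  have "fun_dominated (\<lambda>r. ennreal (r ^ 2)) (lower_rel_divergence X ?A (2 * q ^ 2 * n) \<rho>)"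
    if n: "2 \<le> n" and \<rho>: "0 < \<rho>" "\<rho> \<le> 1" for n \<rho>
  proof -
    \<comment> \<open>The length estimate reads \<open>r^2 \<le> Q (l + 1)\<close>; the surplus
      \<open>Q\<close> goes into the linear error term as soon as \<open>r\<close> exceeds
      it.\<close>
    define Q where "Q = 8 * real q ^ 2 / \<rho>"
    have Q: "Q > 0" unfolding Q_def using q1 \<rho> by simp
    have main: "ennreal ((r ^ 2 - Q) / Q) \<le> lower_rel_divergence X ?A (2 * q ^ 2 * n) \<rho> r"
      if r: "r > 14 * real q ^ 2 / \<rho> + 5" for r
    proof (rule ennreal_le_lower_rel_divergence)
      fix p assume p: "pathin (mtopology_of X) p" "\<And>t. t \<in> {0..1} \<Longrightarrow> \<rho> * r \<le> mdist_to_set X (p t) ?A"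
        "p 0 \<in> nbhd_boundary X ?A r" "p 1 \<in> nbhd_boundary X ?A r"
        "real (2 * q ^ 2 * n) * r \<le> mdist X (p 0) (p 1)"
      show "ennreal ((r ^ 2 - Q) / Q) \<le> curve_length X p"
      proof (cases "curve_length X p")
        case (real l)
        have r0: "r \<ge> 0" using r \<rho> by (smt (verit) divide_nonneg_pos zero_le_power2)
        have "2 * real q ^ 2 * 2 \<le> 2 * real q ^ 2 * real n" using n by (intro mult_left_mono) auto
        then have "4 * real q ^ 2 \<le> real (2 * q ^ 2 * n)" by simp
        then have "4 * real q ^ 2 * r \<le> real (2 * q ^ 2 * n) * r" using r0 by (intro mult_right_mono)
        then have apart: "4 * real q ^ 2 * r \<le> mdist X (p 0) (p 1)" using p(5) by (rule order_trans)
        have "\<rho> * r ^ 2 \<le> 8 * real q ^ 2 * (l + 1)"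
        proof (rule curve_length_lower[OF tf lc C p(1) _ _ p(2) _ _ apart \<rho>(1) r])
          show "mdist_to_set X (p 0) ?A = r" "mdist_to_set X (p 1) ?A = r"
            using p(3,4) by (simp_all only: nbhd_boundary_def mem_Collect_eq)
        qed (use real in simp_all)
        then have "r ^ 2 \<le> Q * (l + 1)" unfolding Q_def using \<rho> by (simp add: field_simps)
        then have "(r ^ 2 - Q) / Q \<le> l" using Q by (simp add: divide_le_eq algebra_simps)
        then show ?thesis using real by (simp add: ennreal_leI)
      qed simp
    qed
    show ?thesis
      unfolding fun_dominated_def
    proof (intro exI conjI allI impI)
      fix r :: real assume r: "r > 14 * real q ^ 2 / \<rho> + 5 + Q"
      have rQ: "Q \<le> r" "1 \<le> r" "r > 14 * real q ^ 2 / \<rho> + 5"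
        using r Q \<rho> by (smt (verit) divide_nonneg_pos zero_le_power2)+
      have nn: "0 \<le> r ^ 2 - Q"
      proof -
        have "r * 1 \<le> r * r" using rQ by (intro mult_left_mono) auto
        then have "r \<le> r ^ 2" by (simp add: power2_eq_square)
        then show ?thesis using rQ(1) by linarith
      qed
      have "ennreal (r ^ 2) = ennreal (Q * ((r ^ 2 - Q) / Q) + Q)" using Q by simp
      also have "\<dots> = ennreal (Q * ((r ^ 2 - Q) / Q)) + ennreal Q"
        using Q nn by (intro ennreal_plus) auto
      also have "ennreal (Q * ((r ^ 2 - Q) / Q)) = ennreal Q * ennreal ((r ^ 2 - Q) / Q)"
        using Q by (intro ennreal_mult') simp
      also have "ennreal Q * ennreal ((r ^ 2 - Q) / Q) + ennreal Q \<le>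
          ennreal Q * lower_rel_divergence X ?A (2 * q ^ 2 * n) \<rho> (1 * r) + ennreal (1 * r)"
        using main[OF rQ(3)] rQ by (intro add_mono mult_left_mono) (auto simp: ennreal_leI)
      finally show "ennreal (r ^ 2) \<le> ennreal Q * lower_rel_divergence X ?A (2 * q ^ 2 * n) \<rho> (1 * r) + ennreal (1 * r)" .
    qed (use Q \<rho> in \<open>auto intro!: add_nonneg_pos\<close>)
  qed
  then show ?thesis
    unfolding at_least_quadratic_def family_dominated_def subgroup_divergence_def
    using q by (intro exI[of _ 1] conjI exI[of _ "2 * q ^ 2"]) auto
qed

end

section \<open>Detours in a flat\<close>

locale bilipschitz_flat = coxeter_flat \<Gamma> a b c d C + bilipschitz_coxeter \<Gamma> T q
  for \<Gamma> :: "'a pair_pre_digraph" and a b c d C T q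
begin

text \<open>Three sides of a square of side \<open>k\<close> in the flat.\<close>

definition side1 :: "nat \<Rightarrow> nat \<Rightarrow> nat" where
  "side1 k i = (if i \<le> k then i else if i \<le> 2 * k then k else 3 * k - i)"

definition side2 :: "nat \<Rightarrow> nat \<Rightarrow> nat" where
  "side2 k i = (if i \<le> k then 0 else if i \<le> 2 * k then i - k else k)"

definition detour :: "nat \<Rightarrow> nat \<Rightarrow> 'a gword set" where
  "detour k i = flat (side1 k i) (side2 k i)"

lemma detour_carrier [simp]: "detour k i \<in> carrier W"
  by (simp add: detour_def)

lemma detour_Suc:
  assumes "i < 3 * k"
  shows "wdist (detour k i) (detour k (Suc i)) \<le> 1"
proof -
  consider "i < k" | "k \<le> i" "i < 2 * k" | "2 * k \<le> i" by linarith
  then show ?thesis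
  proof cases
    case 1
    then show ?thesis using wdist_flat_Suc(1)[of i 0] by (simp add: detour_def side1_def side2_def)
  next
    case 2
    then have "side1 k i = k" "side1 k (Suc i) = k" "side2 k (Suc i) = Suc (side2 k i)"
      by (auto simp: side1_def side2_def)
    then show ?thesis using wdist_flat_Suc(2)[of k "side2 k i"] by (simp only: detour_def)
  next
    case 3
    then have "side2 k i = k" "side2 k (Suc i) = k" "side1 k i = Suc (side1 k (Suc i))"
      using assms by (auto simp: side1_def side2_def)
    then show ?thesis
      using wdist_flat_Suc(1)[of "side1 k (Suc i)" k] wdist_sym[OF detour_carrier detour_carrier, of k i k "Suc i"]
      by (simp only: detour_def)
  qed
qed

text \<open>On one side or on two adjacent sides the elapsed time is the sum of the two coordinate
  differences. On opposite sides the second coordinates differ by \<open>k\<close>, while the time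
  is at most \<open>3 k\<close>.\<close>

lemma detour_lower_ordered:
  assumes "i \<le> j" "j \<le> 3 * k"
  shows "int j - int i \<le> 3 * int (wdist (detour k i) (detour k j))"
proof -
  have side: "int i \<le> int k \<and> int (side1 k i) = int i \<and> int (side2 k i) = 0 \<or>
      int k < int i \<and> int i \<le> 2 * int k \<and> int (side1 k i) = int k \<and> int (side2 k i) = int i - int k \<or>
      2 * int k < int i \<and> int (side1 k i) = 3 * int k - int i \<and> int (side2 k i) = int k"
    if "i \<le> 3 * k" for i
    using that by (auto simp: side1_def side2_def of_nat_diff)
  define w where "w = int (wdist (detour k i) (detour k j))"
  have w: "int (side1 k i) - int (side1 k j) \<le> w" "int (side1 k j) - int (side1 k i) \<le> w"
    "int (side2 k j) - int (side2 k i) \<le> w"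
    using wdist_flat_lower(1)[of "side1 k i" "side1 k j" "side2 k i" "side2 k j"]
      wdist_flat_lower(2)[of "side2 k i" "side2 k j" "side1 k i" "side1 k j"]
    unfolding w_def detour_def abs_le_iff by simp_all
  have ij: "int i \<le> int j" "int j \<le> 3 * int k" "i \<le> 3 * k" using assms by auto
  have "int j - int i \<le> 3 * w"
    using side[OF ij(3)] side[OF assms(2)] w ij(1,2) by (elim disjE conjE) linarith+
  then show ?thesis unfolding w_def .
qed

lemma detour_lower:
  assumes "i \<le> 3 * k" "j \<le> 3 * k"
  shows "\<bar>real i - real j\<bar> \<le> 3 * real (wdist (detour k i) (detour k j))"
proof -
  have *: "real j - real i \<le> 3 * real (wdist (detour k i) (detour k j))" if "i \<le> j" "j \<le> 3 * k" for i j
  proof -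
    have "real_of_int (int j - int i) \<le> real_of_int (3 * int (wdist (detour k i) (detour k j)))"
      using detour_lower_ordered[OF that] by (rule of_int_le_iff[THEN iffD2])
    then show ?thesis by simp
  qed
  show ?thesis
    using *[of i j] *[of j i] assms wdist_sym[OF detour_carrier detour_carrier, of k i k j]
    by (cases "i \<le> j") simp_all
qed

lemma detour_upper:
  assumes "i \<le> 3 * k" "j \<le> 3 * k"
  shows "real (wdist (detour k i) (detour k j)) \<le> \<bar>real i - real j\<bar>"
proof -
  have *: "real (wdist (detour k i) (detour k j)) \<le> real j - real i" if "i \<le> j" "j \<le> 3 * k" for i j
    using chain_wdist[of j "detour k" 1 i] detour_Suc[of _ k] that by simp
  show ?thesis
    using *[of i j] *[of j i] assms wdist_sym[OF detour_carrier detour_carrier, of k i k j]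
    by (cases "i \<le> j") simp_all
qed

lemma not_strongly_quasiconvex: "\<not> strongly_quasiconvex_subset X (vert ` word_subgroup C)"
proof
  let ?A = "vert ` word_subgroup C"
  assume sq: "strongly_quasiconvex_subset X ?A"
  have q1: "1 \<le> real q" using q by simp
  then have "1 \<le> 3 * real q" "0 \<le> real q" by auto
  with sq have "\<exists>M. \<forall>x y f. x \<le> y \<and> quasi_geodesic X (3 * real q) (real q) {x..y} f \<and> f x \<in> ?A \<and> f y \<in> ?A \<longrightarrow>
      f ` {x..y} \<subseteq> open_nbhd X ?A M"
    unfolding strongly_quasiconvex_subset_def by blast
  then obtain M where M: "\<forall>x y f. x \<le> y \<and> quasi_geodesic X (3 * real q) (real q) {x..y} f \<and> f x \<in> ?A \<and> f y \<in> ?A \<longrightarrow>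
      f ` {x..y} \<subseteq> open_nbhd X ?A M"
    by (rule exE)
  \<comment> \<open>The corner \<open>flat k 0\<close> has height \<open>k\<close>, hence distance
    at least \<open>k / q \<ge> M\<close> from the subgroup.\<close>
  define k where "k = nat \<lceil>real q * \<bar>M\<bar>\<rceil>"
  have k: "real q * M \<le> real k"
  proof -
    have "real q * M \<le> real q * \<bar>M\<bar>" by (intro mult_left_mono) auto
    then show ?thesis unfolding k_def by linarith
  qed
  \<comment> \<open>A step function: quasi-geodesics may be discontinuous, and the additive constant
    \<open>q\<close> pays for the jumps of the floor.\<close>
  define f where "f t = vert (detour k (nat \<lfloor>t\<rfloor>))" for t :: real
  have qg: "quasi_geodesic X (3 * real q) (real q) {0..real (3 * k)} f"
    unfolding quasi_geodesic_def
  proof (intro conjI ballI)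
    show "is_interval {0..real (3 * k)}" by (rule is_interval_cc)
    show "f ` {0..real (3 * k)} \<subseteq> mspace X" unfolding f_def using vert_in_X by auto
    fix s t :: real assume st: "s \<in> {0..real (3 * k)}" "t \<in> {0..real (3 * k)}"
    define i j where "i = nat \<lfloor>s\<rfloor>" and "j = nat \<lfloor>t\<rfloor>"
    have fl: "real i \<le> s" "s < real i + 1" "real j \<le> t" "t < real j + 1"
      using st unfolding i_def j_def by auto
    then have ij: "i \<le> 3 * k" "j \<le> 3 * k" using st by auto
    have diff: "\<bar>s - t\<bar> \<le> \<bar>real i - real j\<bar> + 1" "\<bar>real i - real j\<bar> \<le> \<bar>s - t\<bar> + 1"
      using fl by linarith+
    have fs: "f s = vert (detour k i)" "f t = vert (detour k j)" by (simp_all add: f_def i_def j_def)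
    let ?w = "real (wdist (detour k i) (detour k j))"
    have w: "?w \<le> real q * mdist X (f s) (f t)" "mdist X (f s) (f t) \<le> real q * ?w"
      unfolding fs using wdist_mdist mdist_wdist by simp_all
    have "\<bar>s - t\<bar> \<le> 3 * real q * mdist X (f s) (f t) + 1"
      using diff detour_lower[OF ij] w(1) by linarith
    also have "\<dots> \<le> 3 * real q * mdist X (f s) (f t) + 3 * real q * real q"
    proof -
      have "1 * 1 \<le> real q * real q" using q1 by (intro mult_mono) auto
      then show ?thesis by linarith
    qed
    finally have "\<bar>s - t\<bar> \<le> 3 * real q * (mdist X (f s) (f t) + real q)" by (simp add: algebra_simps)
    then show "\<bar>s - t\<bar> / (3 * real q) - real q \<le> mdist X (f s) (f t)"
      using q1 by (simp add: divide_le_eq mult.commute diff_le_eq)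
    have "real q * ?w \<le> real q * (\<bar>s - t\<bar> + 1)"
      using detour_upper[OF ij] diff by (intro mult_left_mono) auto
    also have "\<dots> \<le> 3 * real q * \<bar>s - t\<bar> + real q" by (simp add: algebra_simps)
    finally show "mdist X (f s) (f t) \<le> 3 * real q * \<bar>s - t\<bar> + real q" using w(2) by linarith
  qed
  have fn: "f (real i) = vert (detour k i)" for i by (simp add: f_def)
  have "side1 k 0 = 0" "side1 k (3 * k) = 0" by (auto simp: side1_def)
  then have "detour k 0 \<in> word_subgroup C" "detour k (3 * k) \<in> word_subgroup C"
    unfolding detour_def using flat_0 by metis+
  then have "f 0 \<in> ?A" "f (real (3 * k)) \<in> ?A" using fn[of 0] fn[of "3 * k"] by auto
  then have "f ` {0..real (3 * k)} \<subseteq> open_nbhd X ?A M" using qg by (intro M[rule_format] conjI) auto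
  moreover have "real k \<in> {0..real (3 * k)}" by simp
  ultimately have "f (real k) \<in> open_nbhd X ?A M" by blast
  moreover have "f (real k) = vert (flat k 0)" unfolding fn by (simp add: detour_def side1_def side2_def)
  ultimately have less: "mdist_to_set X (vert (flat k 0)) ?A < M" by (simp add: open_nbhd_def)
  have "real k \<le> real q * mdist_to_set X (vert (flat k 0)) ?A"
    using height_le_dist_subgroup[OF CS, of "flat k 0"] height_flat[of k 0] by simp
  also have "\<dots> < real q * M" using less q1 by (intro mult_strict_left_mono) auto
  finally show False using k by linarith
qed

end

section \<open>Paths of controlled length\<close>

text \<open>At speed at most 1 the parameter interval carries the length bound, so concatenation
  adds the bounds, and curve lengths enter only in \<open>unit_path_length_dist\<close>.\<close>

definition unit_path :: "'p metric \<Rightarrow> 'p set \<Rightarrow> 'p \<Rightarrow> 'p \<Rightarrow> real \<Rightarrow> bool" where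
  "unit_path X Z x y l \<longleftrightarrow> 0 \<le> l \<and> (\<exists>p. p 0 = x \<and> p l = y \<and> (\<forall>t\<in>{0..l}. p t \<in> Z) \<and>
     (\<forall>s\<in>{0..l}. \<forall>t\<in>{0..l}. mdist X (p s) (p t) \<le> \<bar>s - t\<bar>))"

lemma unit_path_refl: "x \<in> Z \<Longrightarrow> Z \<subseteq> mspace X \<Longrightarrow> unit_path X Z x x 0"
  unfolding unit_path_def by (intro conjI exI[of _ "\<lambda>_. x"]) auto

lemma unit_path_mono: "unit_path X Z x y l \<Longrightarrow> Z \<subseteq> Z' \<Longrightarrow> unit_path X Z' x y l"
  unfolding unit_path_def by blast

lemma unit_path_rev:
  assumes "unit_path X Z x y l"
  shows "unit_path X Z y x l"
proof -
  obtain p where l: "0 \<le> l" and p: "p 0 = x" "p l = y" "\<And>t. t \<in> {0..l} \<Longrightarrow> p t \<in> Z"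
    "\<And>s t. s \<in> {0..l} \<Longrightarrow> t \<in> {0..l} \<Longrightarrow> mdist X (p s) (p t) \<le> \<bar>s - t\<bar>"
    using assms unfolding unit_path_def by blast
  have "mdist X (p (l - s)) (p (l - t)) \<le> \<bar>s - t\<bar>" if "s \<in> {0..l}" "t \<in> {0..l}" for s t
    using p(4)[of "l - s" "l - t"] that by auto
  moreover have "p (l - t) \<in> Z" if "t \<in> {0..l}" for t using p(3)[of "l - t"] that by auto
  ultimately show ?thesis unfolding unit_path_def using l p(1,2)
    by (intro conjI exI[of _ "\<lambda>t. p (l - t)"]) auto
qed

lemma unit_path_join:
  assumes "unit_path X Z x y l" "unit_path X Z y z m" "Z \<subseteq> mspace X"
  shows "unit_path X Z x z (l + m)"
proof -
  obtain p where l: "0 \<le> l" and p: "p 0 = x" "p l = y" "\<And>t. t \<in> {0..l} \<Longrightarrow> p t \<in> Z"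
    "\<And>s t. s \<in> {0..l} \<Longrightarrow> t \<in> {0..l} \<Longrightarrow> mdist X (p s) (p t) \<le> \<bar>s - t\<bar>"
    using assms(1) unfolding unit_path_def by blast
  obtain p' where m: "0 \<le> m" and p': "p' 0 = y" "p' m = z" "\<And>t. t \<in> {0..m} \<Longrightarrow> p' t \<in> Z"
    "\<And>s t. s \<in> {0..m} \<Longrightarrow> t \<in> {0..m} \<Longrightarrow> mdist X (p' s) (p' t) \<le> \<bar>s - t\<bar>"
    using assms(2) unfolding unit_path_def by blast
  let ?p = "\<lambda>t. if t \<le> l then p t else p' (t - l)"
  have Z: "?p t \<in> Z" if "t \<in> {0..l + m}" for t
    using p(3)[of t] p'(3)[of "t - l"] that by auto
  have *: "mdist X (?p s) (?p t) \<le> t - s" if st: "s \<in> {0..l + m}" "t \<in> {0..l + m}" "s \<le> t" for s t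
  proof -
    consider "t \<le> l" | "l < s" | "s \<le> l" "l < t" by linarith
    then show ?thesis
    proof cases
      case 1
      then show ?thesis using p(4)[of s t] st by auto
    next
      case 2
      then show ?thesis using p'(4)[of "s - l" "t - l"] st by auto
    next
      case 3
      have "mdist X (p s) y \<le> l - s" using p(4)[of s l] p(2) st 3 by auto
      moreover have "mdist X y (p' (t - l)) \<le> t - l" using p'(4)[of 0 "t - l"] p'(1) st 3 by auto
      moreover have "mdist X (p s) (p' (t - l)) \<le> mdist X (p s) y + mdist X y (p' (t - l))"
        using p(3)[of s] p(3)[of l] p(2) p'(3)[of "t - l"] st 3 l assms(3) by (intro mdist_triangle) auto
      ultimately show ?thesis using 3 by simp
    qed
  qed
  have "mdist X (?p s) (?p t) \<le> \<bar>s - t\<bar>" if "s \<in> {0..l + m}" "t \<in> {0..l + m}" for s t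
    using *[of s t] *[of t s] that mdist_commute[of X "?p s" "?p t"] by (cases "s \<le> t") (simp_all only:, auto)
  moreover have "?p (l + m) = z" using m p(2) p'(1,2) by auto
  ultimately show ?thesis unfolding unit_path_def using l m p(1) Z
    by (intro conjI exI[of _ ?p]) auto
qed

lemma unit_path_near:
  assumes "unit_path X Z x y l"
  shows "unit_path X {z \<in> Z. mdist X x z \<le> l} x y l"
proof -
  obtain p where l: "0 \<le> l" and p: "p 0 = x" "p l = y" "\<And>t. t \<in> {0..l} \<Longrightarrow> p t \<in> Z"
    "\<And>s t. s \<in> {0..l} \<Longrightarrow> t \<in> {0..l} \<Longrightarrow> mdist X (p s) (p t) \<le> \<bar>s - t\<bar>"
    using assms unfolding unit_path_def by blast
  have "mdist X x (p t) \<le> l" if "t \<in> {0..l}" for t using p(4)[of 0 t] p(1) that l by auto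
  then show ?thesis unfolding unit_path_def using l p by (intro conjI exI[of _ p]) auto
qed

text \<open>Rescaled to the unit interval the path is Lipschitz with constant \<open>l\<close>, so
  every polygonal sum is bounded by a telescoping sum of at most \<open>l\<close>.\<close>

lemma unit_path_length_dist:
  assumes "unit_path X Z x y l" "Z \<subseteq> mspace X"
  shows "length_dist X Z x y \<le> ennreal l"
proof -
  obtain p where l: "0 \<le> l" and p: "p 0 = x" "p l = y" "\<And>t. t \<in> {0..l} \<Longrightarrow> p t \<in> Z"
    "\<And>s t. s \<in> {0..l} \<Longrightarrow> t \<in> {0..l} \<Longrightarrow> mdist X (p s) (p t) \<le> \<bar>s - t\<bar>"
    using assms unfolding unit_path_def by blast
  let ?f = "\<lambda>t. p (l * t)"
  have lt: "l * t \<in> {0..l}" if "t \<in> {0..1}" for t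
    using that l mult_left_mono[of t 1 l] by auto
  have lip: "mdist X (?f s) (?f t) \<le> l * \<bar>s - t\<bar>" if "s \<in> {0..1}" "t \<in> {0..1}" for s t
    using p(4)[OF lt[OF that(1)] lt[OF that(2)]] l by (simp add: abs_mult flip: right_diff_distrib)
  have fZ: "?f t \<in> Z" if "t \<in> {0..1}" for t using p(3) lt[OF that] by blast
  have "Lipschitz_continuous_map (submetric euclidean_metric {0..1}) X ?f"
    unfolding Lipschitz_continuous_map_def using fZ assms(2) lip
    by (intro conjI exI[of _ l]) (auto simp: dist_real_def)
  then have "continuous_map (mtopology_of (submetric euclidean_metric {0..1})) (mtopology_of X) ?f"
    by (rule Lipschitz_continuous_imp_continuous_map)
  then have "pathin (subtopology (mtopology_of X) Z) ?f"
    using fZ by (simp add: pathin_subtopology mtopology_of_submetric) (simp add: pathin_def)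
  then have "length_dist X Z x y \<le> curve_length X ?f"
    unfolding length_dist_def using p(1,2) by (intro INF_lower) simp
  also have "\<dots> \<le> ennreal l"
    unfolding curve_length_def
  proof (rule SUP_least)
    fix ts :: "real list" assume ts: "ts \<in> {ts. sorted ts \<and> set ts \<subseteq> {0..1}}"
    let ?n = "length ts - 1"
    have mem: "ts ! i \<in> {0..1}" if "i < length ts" for i using ts that nth_mem by blast
    have step: "mdist X (?f (ts ! i)) (?f (ts ! Suc i)) \<le> l * (ts ! Suc i - ts ! i)" if "i < ?n" for i
    proof -
      have "ts ! i \<le> ts ! Suc i" using ts that by (auto simp: sorted_iff_nth_mono)
      then show ?thesis using lip[OF mem[of i] mem[of "Suc i"]] that by simp
    qed
    have "(\<Sum>i<?n. ennreal (mdist X (?f (ts ! i)) (?f (ts ! Suc i)))) \<le> (\<Sum>i<?n. ennreal (l * (ts ! Suc i - ts ! i)))"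
      using step by (intro sum_mono ennreal_leI) auto
    also have "\<dots> = ennreal (\<Sum>i<?n. l * (ts ! Suc i - ts ! i))"
    proof (rule sum_ennreal)
      fix i assume "i \<in> {..<?n}"
      then show "0 \<le> l * (ts ! Suc i - ts ! i)" using step[of i] mdist_nonneg[of X "?f (ts ! i)" "?f (ts ! Suc i)"]
        by (meson lessThan_iff order_trans)
    qed
    also have "(\<Sum>i<?n. l * (ts ! Suc i - ts ! i)) = l * (ts ! ?n - ts ! 0)"
      by (simp add: sum_lessThan_telescope flip: sum_distrib_left)
    also have "\<dots> \<le> l * 1"
    proof (cases "ts = []")
      case False
      then show ?thesis using mem[of ?n] mem[of 0] l by (intro mult_left_mono) auto
    qed (use l in simp)
    finally show "(\<Sum>i<?n. ennreal (mdist X (?f (ts ! i)) (?f (ts ! Suc i)))) \<le> ennreal l"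
      by (simp add: ennreal_leI)
  qed
  finally show ?thesis .
qed

text \<open>The path is cut at the last time with \<open>f \<le> r\<close>; by the intermediate
  value theorem \<open>f\<close> equals \<open>r\<close> there. This supplies points at distance
  exactly \<open>r\<close> from the subgroup, which vertices need not have.\<close>

lemma unit_path_last_exit:
  fixes f :: "'p \<Rightarrow> real"
  assumes path: "unit_path X Z x y l" and f: "\<And>z w. z \<in> Z \<Longrightarrow> w \<in> Z \<Longrightarrow> f z \<le> mdist X z w + f w"
    and "f x \<le> r" "r \<le> f y"
  shows "\<exists>z m. z \<in> Z \<and> f z = r \<and> m \<le> l \<and> unit_path X {w \<in> Z. r \<le> f w} z y m"
proof -
  obtain p where l: "0 \<le> l" and p: "p 0 = x" "p l = y" "\<And>t. t \<in> {0..l} \<Longrightarrow> p t \<in> Z"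
    "\<And>s t. s \<in> {0..l} \<Longrightarrow> t \<in> {0..l} \<Longrightarrow> mdist X (p s) (p t) \<le> \<bar>s - t\<bar>"
    using path unfolding unit_path_def by blast
  let ?g = "\<lambda>t. f (p t)"
  have g: "\<bar>?g s - ?g t\<bar> \<le> \<bar>s - t\<bar>" if "s \<in> {0..l}" "t \<in> {0..l}" for s t
    using f[OF p(3)[OF that(1)] p(3)[OF that(2)]] f[OF p(3)[OF that(2)] p(3)[OF that(1)]]
      p(4)[OF that] p(4)[OF that(2,1)] by linarith
  have cont: "continuous_on {0..l} ?g"
    unfolding continuous_on_iff using g by (force simp: dist_real_def)
  define U where "U = {t \<in> {0..l}. ?g t \<le> r}"
  have "closed U" unfolding U_def
    by (rule continuous_closed_preimage[OF cont, of "{..r}", simplified vimage_def Int_def mem_Collect_eq atMost_iff]) auto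
  moreover have "bounded U" by (rule bounded_subset[OF bounded_closed_interval[of 0 l]]) (auto simp: U_def)
  ultimately have "compact U" by (simp add: compact_eq_bounded_closed)
  moreover have "U \<noteq> {}" using l p(1) assms(3) unfolding U_def by force
  ultimately obtain t where t: "t \<in> U" "\<And>s. s \<in> U \<Longrightarrow> s \<le> t" using compact_attains_sup by metis
  have tl: "0 \<le> t" "t \<le> l" "?g t \<le> r" using t(1) unfolding U_def by auto
  have "?g t = r"
  proof (rule ccontr)
    assume "?g t \<noteq> r"
    then have "?g t < r" using tl by simp
    moreover have "continuous_on {t..l} ?g" using cont tl by (auto intro: continuous_on_subset)
    ultimately obtain s where "t \<le> s" "s \<le> l" "?g s = r"
      using IVT'[of ?g t r l] tl p(2) assms(4) by auto
    then have "s \<le> t" using t(2)[of s] tl unfolding U_def by auto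
    then show False using \<open>t \<le> s\<close> \<open>?g s = r\<close> \<open>?g t \<noteq> r\<close> by simp
  qed
  moreover have "r \<le> ?g s" if "s \<in> {t..l}" for s
    using t(2)[of s] that tl \<open>?g t = r\<close> unfolding U_def by (cases "s = t") force+
  then have "unit_path X {w \<in> Z. r \<le> f w} (p t) y (l - t)"
    unfolding unit_path_def using p tl
    by (intro conjI exI[of _ "\<lambda>s. p (t + s)"]) (auto intro!: order_trans[OF p(4)])
  ultimately show ?thesis using p(3)[of t] tl by (intro exI[of _ "p t"] exI[of _ "l - t"]) auto
qed

section \<open>Edge chains as paths\<close>

context cayley_coxeter
begin

lemma unit_path_cell:
  assumes "c \<in> graph_cells CG" "x \<in> c" "y \<in> c"
  shows "unit_path X (mspace X) x y (edge_dist x y)"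
proof -
  obtain u v where c: "c = graph_cell u v" using assms(1) by (auto simp: graph_cells_def)
  have cX: "c \<subseteq> mspace X" using assms(1) unfolding mspace_X by blast
  let ?pt = "\<lambda>s. (\<lambda>w. (1 - s) * graph_vertex u w + s * graph_vertex v w)"
  obtain s where s: "0 \<le> s" "s \<le> 1" "x = ?pt s" using assms(2) c by (auto simp: graph_cell_def)
  obtain t where t: "0 \<le> t" "t \<le> 1" "y = ?pt t" using assms(3) c by (auto simp: graph_cell_def)
  show ?thesis
  proof (cases "u = v")
    case True
    then have "x = y" using s t cell_degenerate[of s u] cell_degenerate[of t u] by simp
    then show ?thesis using unit_path_refl[of y "mspace X" X] cX assms by auto
  next
    case False
    have e: "edge_dist (?pt s') (?pt t') = \<bar>s' - t'\<bar>" for s' t' using edge_dist_cell[OF False] .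
    have in_c: "?pt s' \<in> c" if "0 \<le> s'" "s' \<le> 1" for s' using that c by (auto simp: graph_cell_def)
    define \<sigma> where "\<sigma> = (if s \<le> t then 1 else - 1 :: real)"
    let ?p = "\<lambda>w. ?pt (s + \<sigma> * w)"
    have "0 \<le> s + \<sigma> * w \<and> s + \<sigma> * w \<le> 1" if "w \<in> {0..\<bar>s - t\<bar>}" for w
      using that s t unfolding \<sigma>_def by (auto split: if_splits)
    then have pc: "?p w \<in> c" if "w \<in> {0..\<bar>s - t\<bar>}" for w using in_c that by blast
    have "mdist X (?p w) (?p w') \<le> \<bar>w - w'\<bar>" if "w \<in> {0..\<bar>s - t\<bar>}" "w' \<in> {0..\<bar>s - t\<bar>}" for w w'
    proof -
      have "mdist X (?p w) (?p w') \<le> edge_dist (?p w) (?p w')"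
        by (rule mdist_cell[OF assms(1) pc[OF that(1)] pc[OF that(2)]])
      also have "\<dots> = \<bar>w - w'\<bar>" unfolding e unfolding \<sigma>_def by auto
      finally show ?thesis .
    qed
    moreover have "?p 0 = x" "?p \<bar>s - t\<bar> = y" using s t unfolding \<sigma>_def by auto
    moreover have "?p w \<in> mspace X" if "w \<in> {0..\<bar>s - t\<bar>}" for w using pc[OF that] cX by blast
    ultimately have "unit_path X (mspace X) x y \<bar>s - t\<bar>"
      unfolding unit_path_def by (intro conjI exI[of _ ?p]) auto
    then show ?thesis using e[of s t] s t by simp
  qed
qed

lemma unit_path_chain: "graph_chain CG x l y \<Longrightarrow> unit_path X (mspace X) x y l"
proof (induction rule: graph_chain.induct)
  case (start x)
  then show ?case by (intro unit_path_refl) (auto simp: mspace_X)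
next
  case (step x l y c z)
  then show ?case using unit_path_join[OF step.IH unit_path_cell[OF step.hyps(2-4)]] by simp
qed

end

context bilipschitz_coxeter
begin

text \<open>Consecutive vertices have distance at most \<open>q\<close>; the additional 1 leaves
  room for a chain that only approaches the infimum. Each piece stays as close to its starting
  vertex as it is long.\<close>

lemma unit_path_sequence:
  assumes "\<And>i. i \<le> n \<Longrightarrow> h i \<in> carrier W" "\<And>i. i < n \<Longrightarrow> wdist (h i) (h (Suc i)) \<le> 1"
  shows "\<exists>l \<le> real n * (real q + 1).
    unit_path X {z \<in> mspace X. \<exists>i\<le>n. mdist X (vert (h i)) z \<le> real q + 1} (vert (h 0)) (vert (h n)) l"
  using assms
proof (induction n)
  case 0
  have "vert (h 0) \<in> mspace X" using 0 vert_in_X by simp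
  then have "unit_path X {z \<in> mspace X. \<exists>i\<le>0. mdist X (vert (h i)) z \<le> real q + 1} (vert (h 0)) (vert (h 0)) 0"
    using mdist_self[of "vert (h 0)" X] by (intro unit_path_refl) auto
  then show ?case by (intro exI[of _ 0]) simp
next
  case (Suc n)
  let ?Z = "\<lambda>n. {z \<in> mspace X. \<exists>i\<le>n. mdist X (vert (h i)) z \<le> real q + 1}"
  obtain l where l: "l \<le> real n * (real q + 1)" "unit_path X (?Z n) (vert (h 0)) (vert (h n)) l"
    using Suc.IH Suc.prems by force
  have hc: "h n \<in> carrier W" "h (Suc n) \<in> carrier W" using Suc.prems by auto
  have "mdist X (vert (h n)) (vert (h (Suc n))) \<le> real q * real (wdist (h n) (h (Suc n)))" by (rule mdist_wdist[OF hc])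
  also have "\<dots> \<le> real q * 1" using Suc.prems(2)[of n] by (intro mult_left_mono) auto
  finally have "mdist X (vert (h n)) (vert (h (Suc n))) < real q + 1" by simp
  then obtain m where m: "m < real q + 1" "graph_chain CG (vert (h n)) m (vert (h (Suc n)))"
    using chain_approx vert_in_X hc by blast
  have "unit_path X {z \<in> mspace X. mdist X (vert (h n)) z \<le> m} (vert (h n)) (vert (h (Suc n))) m"
    by (rule unit_path_near[OF unit_path_chain[OF m(2)]])
  then have "unit_path X (?Z (Suc n)) (vert (h n)) (vert (h (Suc n))) m"
    by (rule unit_path_mono) (use m(1) in \<open>force intro: exI[of _ n]\<close>)
  moreover have "unit_path X (?Z (Suc n)) (vert (h 0)) (vert (h n)) l"
    by (rule unit_path_mono[OF l(2)]) (auto intro: le_SucI)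
  ultimately have "unit_path X (?Z (Suc n)) (vert (h 0)) (vert (h (Suc n))) (l + m)"
    by (intro unit_path_join) auto
  moreover have "l + m \<le> real (Suc n) * (real q + 1)" using l m by (simp add: algebra_simps)
  ultimately show ?case by blast
qed

end

section \<open>Linear divergence in the presence of a flat\<close>

context bilipschitz_flat
begin

text \<open>The competitor follows three sides of a rectangle in the flat, of height
  \<open>k\<close> and width \<open>m\<close>, with the vertical sides cut where they last leave the
  \<open>r\<close>-neighbourhood.\<close>

lemma divergence_at_most_linear:
  "\<exists>e>0. \<forall>r\<ge>1. lower_rel_divergence X (vert ` word_subgroup C) N 1 r \<le> ennreal (e * r)"
proof -
  let ?A = "vert ` word_subgroup C"
  let ?f = "\<lambda>z. mdist_to_set X z ?A"
  \<comment> \<open>Bounds both the length of a path piece between neighbouring points of the flat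
    and its deviation from them.\<close>
  define Q where "Q = real q + 1"
  define e1 where "e1 = real q * (Q + 1) + 1"
  define e2 where "e2 = real q * (real N + 2 * Q) + 1"
  define e where "e = (2 * e1 + e2) * Q"
  have q1: "1 \<le> real q" using q by simp
  have Q0: "Q > 0" using q1 unfolding Q_def by simp
  have "0 \<le> real q * (Q + 1)" "0 \<le> real q * (real N + 2 * Q)" using Q0 by simp_all
  then have e12: "e1 > 0" "e2 > 0" unfolding e1_def e2_def by linarith+
  then have pos: "Q > 0" "e1 > 0" "e2 > 0" "e > 0" using Q0 unfolding e_def by simp_all
  have "lower_rel_divergence X ?A N 1 r \<le> ennreal (e * r)" if r: "r \<ge> 1" for r
  proof -
    \<comment> \<open>High enough for the top side to stay at distance \<open>r\<close> even after a
      deviation of \<open>Q\<close>.\<close>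
    define k where "k = nat \<lceil>real q * (r + Q)\<rceil>"
    \<comment> \<open>Wide enough for the two cut points, each within \<open>Q\<close> of its
      vertical side, to be \<open>N r\<close> apart.\<close>
    define m where "m = nat \<lceil>real q * (real N * r + 2 * Q)\<rceil>"
    have rQ: "0 \<le> real q * (r + Q)" "0 \<le> real q * (real N * r + 2 * Q)" using r pos q1 by auto
    have k: "real q * (r + Q) \<le> real k" "real k \<le> e1 * r"
    proof -
      show "real q * (r + Q) \<le> real k" unfolding k_def by linarith
      have "real q * Q * 1 \<le> real q * Q * r" using r pos q1 by (intro mult_left_mono) auto
      moreover have "real k \<le> real q * (r + Q) + 1" unfolding k_def using rQ by linarith
      ultimately show "real k \<le> e1 * r" unfolding e1_def using r by (simp add: algebra_simps)
    qed
    have m: "real q * (real N * r + 2 * Q) \<le> real m" "real m \<le> e2 * r"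
    proof -
      show "real q * (real N * r + 2 * Q) \<le> real m" unfolding m_def by linarith
      have "real q * Q * 1 \<le> real q * Q * r" using r pos q1 by (intro mult_left_mono) auto
      moreover have "real m \<le> real q * (real N * r + 2 * Q) + 1" unfolding m_def using rQ by linarith
      ultimately show "real m \<le> e2 * r" unfolding e2_def using r by (simp add: algebra_simps)
    qed
    define Z where "Z h n = {z \<in> mspace X. \<exists>i\<le>n. mdist X (vert (h i)) z \<le> Q}" for h :: "nat \<Rightarrow> 'a gword set" and n :: nat
    have ZX: "Z h n \<subseteq> mspace X" for h n unfolding Z_def by auto
    define Far where "Far = mspace X - open_nbhd X ?A r"
    have Far: "Far = {w \<in> mspace X. r \<le> ?f w}" unfolding Far_def open_nbhd_def by auto
    have FarX: "Far \<subseteq> mspace X" unfolding Far by auto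
    have f_lip: "?f z \<le> mdist X z w + ?f w" if "z \<in> mspace X" "w \<in> mspace X" for z w
      using dist_subgroup_lipschitz[OF CS that] .
    have high: "r + Q \<le> ?f (vert (flat k j))" for j
    proof -
      have "real q * (r + Q) \<le> real q * ?f (vert (flat k j))"
        using height_le_dist_subgroup[OF CS, of "flat k j"] height_flat[of k j] k(1) by simp
      then show ?thesis using q1 by simp
    qed
    have low: "?f (vert (flat 0 j)) \<le> r" for j
    proof -
      have "vert (flat 0 j) \<in> ?A" using flat_0 by blast
      then have "?f (vert (flat 0 j)) \<le> mdist X (vert (flat 0 j)) (vert (flat 0 j))" by (rule mdist_to_set_le)
      then show ?thesis using mdist_self[OF vert_in_X[of "flat 0 j"]] r by simp
    qed
    obtain l2 where l2: "l2 \<le> real m * Q" "unit_path X (Z (flat k) m) (vert (flat k 0)) (vert (flat k m)) l2"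
      using unit_path_sequence[of m "flat k"] wdist_flat_Suc(2) unfolding Z_def Q_def by auto
    have "Z (flat k) m \<subseteq> Far"
    proof
      fix z assume "z \<in> Z (flat k) m"
      then obtain i where zi: "z \<in> mspace X" "mdist X (vert (flat k i)) z \<le> Q" unfolding Z_def by auto
      have "?f (vert (flat k i)) \<le> mdist X (vert (flat k i)) z + ?f z"
        using vert_in_X zi(1) by (intro f_lip) auto
      then show "z \<in> Far" using high[of i] zi unfolding Far by auto
    qed
    then have path2: "unit_path X Far (vert (flat k 0)) (vert (flat k m)) l2" using unit_path_mono[OF l2(2)] by blast
    have side: "\<exists>z i n. z \<in> mspace X \<and> ?f z = r \<and> mdist X (vert (flat i j)) z \<le> Q \<and> n \<le> real k * Q \<and>
        unit_path X Far z (vert (flat k j)) n" for j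
    proof -
      let ?h = "\<lambda>i. flat i j"
      obtain l where l: "l \<le> real k * Q" "unit_path X (Z ?h k) (vert (flat 0 j)) (vert (flat k j)) l"
        using unit_path_sequence[of k ?h] wdist_flat_Suc(1) unfolding Z_def Q_def by auto
      have "r \<le> ?f (vert (flat k j))" using high[of j] pos by linarith
      then obtain z n where z: "z \<in> Z ?h k" "?f z = r" "n \<le> l"
        "unit_path X {w \<in> Z ?h k. r \<le> ?f w} z (vert (flat k j)) n"
        using unit_path_last_exit[OF l(2), of ?f r] f_lip low ZX by blast
      have "unit_path X Far z (vert (flat k j)) n"
        by (rule unit_path_mono[OF z(4)]) (use ZX in \<open>auto simp: Far\<close>)
      moreover obtain i where "z \<in> mspace X" "mdist X (vert (flat i j)) z \<le> Q" using z(1) unfolding Z_def by blast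
      moreover have "n \<le> real k * Q" using z(3) l(1) by linarith
      ultimately show ?thesis using z(2) by blast
    qed
    obtain z1 i1 n1 where z1: "z1 \<in> mspace X" "?f z1 = r" "mdist X (vert (flat i1 0)) z1 \<le> Q" "n1 \<le> real k * Q"
      "unit_path X Far z1 (vert (flat k 0)) n1" using side by blast
    obtain z2 i2 n2 where z2: "z2 \<in> mspace X" "?f z2 = r" "mdist X (vert (flat i2 m)) z2 \<le> Q" "n2 \<le> real k * Q"
      "unit_path X Far z2 (vert (flat k m)) n2" using side by blast
    have "unit_path X Far z1 z2 (n1 + l2 + n2)"
      using unit_path_join[OF unit_path_join[OF z1(5) path2 FarX] unit_path_rev[OF z2(5)] FarX] .
    then have "complement_dist X ?A r z1 z2 \<le> ennreal (n1 + l2 + n2)"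
      unfolding complement_dist_def Far_def[symmetric] by (rule unit_path_length_dist[OF _ FarX])
    also have "\<dots> \<le> ennreal (e * r)"
    proof (rule ennreal_leI)
      have "n1 + l2 + n2 \<le> (2 * real k + real m) * Q" using z1(4) z2(4) l2(1) by (simp add: algebra_simps)
      also have "\<dots> \<le> (2 * (e1 * r) + e2 * r) * Q" using k(2) m(2) pos by (intro mult_right_mono) auto
      finally show "n1 + l2 + n2 \<le> e * r" unfolding e_def by (simp add: algebra_simps)
    qed
    finally have bound: "complement_dist X ?A r z1 z2 \<le> ennreal (e * r)" .
    have "real N * r \<le> mdist X z1 z2"
    proof -
      \<comment> \<open>The second coordinate alone gives this, at whatever heights
        \<open>i1\<close>, \<open>i2\<close> the sides were cut.\<close>
      have "real m \<le> real (wdist (flat i1 0) (flat i2 m))"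
        using wdist_flat_lower(2)[of 0 m i1 i2] by linarith
      also have "\<dots> \<le> real q * mdist X (vert (flat i1 0)) (vert (flat i2 m))" by (intro wdist_mdist) auto
      finally have "real q * (real N * r + 2 * Q) \<le> real q * mdist X (vert (flat i1 0)) (vert (flat i2 m))"
        using m(1) by linarith
      then have "real N * r + 2 * Q \<le> mdist X (vert (flat i1 0)) (vert (flat i2 m))" using q1 by simp
      also have "\<dots> \<le> mdist X (vert (flat i1 0)) z1 + (mdist X z1 z2 + mdist X z2 (vert (flat i2 m)))"
        using mdist_triangle[of "vert (flat i1 0)" X z1 "vert (flat i2 m)"]
          mdist_triangle[of z1 X z2 "vert (flat i2 m)"] vert_in_X z1(1) z2(1) by fastforce
      finally show ?thesis using z1(3) z2(3) mdist_commute[of X z2 "vert (flat i2 m)"] by linarith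
    qed
    moreover have "complement_dist X ?A r z1 z2 < \<infinity>" using bound by (simp add: le_less_trans)
    ultimately have "(z1, z2) \<in> {(x1, x2). x1 \<in> nbhd_boundary X ?A r \<and> x2 \<in> nbhd_boundary X ?A r \<and>
        complement_dist X ?A r x1 x2 < \<infinity> \<and> real N * r \<le> mdist X x1 x2}"
      using z1 z2 by (simp add: nbhd_boundary_def)
    then have "lower_rel_divergence X ?A N 1 r \<le> (case (z1, z2) of (x1, x2) \<Rightarrow> complement_dist X ?A (1 * r) x1 x2)"
      unfolding lower_rel_divergence_def by (rule INF_lower)
    then show ?thesis using bound by simp
  qed
  then show ?thesis using pos by blast
qed

lemma not_at_least_quadratic: "\<not> at_least_quadratic (subgroup_divergence W T (word_subgroup C))"
proof
  assume "at_least_quadratic (subgroup_divergence W T (word_subgroup C))"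
  then obtain M where "\<forall>n\<ge>2. \<forall>\<rho>. 0 < \<rho> \<and> \<rho> \<le> 1 \<longrightarrow>
      fun_dominated (\<lambda>r. ennreal (r ^ 2)) (subgroup_divergence W T (word_subgroup C) (M * n) \<rho>)"
    unfolding at_least_quadratic_def family_dominated_def by blast
  \<comment> \<open>A single instance is refuted: \<open>n = 2\<close> and
    \<open>\<rho> = 1\<close>, where the linear bound is available.\<close>
  then have "fun_dominated (\<lambda>r. ennreal (r ^ 2)) (lower_rel_divergence X (vert ` word_subgroup C) (M * 2) 1)"
    unfolding subgroup_divergence_def by simp
  then obtain A B K D where pos: "A > 0" "B > 0" "K > 0" and dom: "\<And>x. x > D \<Longrightarrow>
      ennreal (x ^ 2) \<le> ennreal A * lower_rel_divergence X (vert ` word_subgroup C) (M * 2) 1 (B * x) + ennreal (K * x)"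
    unfolding fun_dominated_def by blast
  obtain e where e: "e > 0" "\<And>r. r \<ge> 1 \<Longrightarrow>
      lower_rel_divergence X (vert ` word_subgroup C) (M * 2) 1 r \<le> ennreal (e * r)"
    using divergence_at_most_linear by blast
  \<comment> \<open>Ensures \<open>B x \<ge> 1\<close>, where the linear bound holds, and makes
    \<open>x\<close> larger than the total linear coefficient \<open>A e B + K\<close>.\<close>
  define x where "x = max (D + 1) (max (1 / B) (A * e * B + K + 1))"
  have x: "x > D" "1 / B \<le> x" "A * e * B + K + 1 \<le> x" unfolding x_def by auto
  have x0: "x > 0" using x(2) pos by (smt (verit) divide_pos_pos)
  have Bx: "B * x \<ge> 1" using x(2) pos by (simp add: divide_le_eq mult.commute)
  have "ennreal (x ^ 2) \<le> ennreal A * ennreal (e * (B * x)) + ennreal (K * x)"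
    using dom[OF x(1)] e(2)[OF Bx] by (meson add_right_mono mult_left_mono order_trans zero_le)
  also have "\<dots> = ennreal (A * (e * (B * x)) + K * x)"
    using pos e(1) x0 by (simp add: ennreal_mult)
  finally have "x ^ 2 \<le> A * (e * (B * x)) + K * x"
    using pos e(1) x0 by (subst (asm) ennreal_le_iff) auto
  also have "\<dots> = (A * e * B + K) * x" by (simp add: algebra_simps)
  also have "\<dots> < x * x" using x(3) x0 by (intro mult_strict_right_mono) auto
  finally show False by (simp add: power2_eq_square)
qed

end

section \<open>Equivalence of the three conditions\<close>

theorem theorem1p11:
  fixes \<Gamma> :: "'v pair_pre_digraph" and S1 :: "'v set"
    and K :: "'v gword set set" and T :: "'v gword set set"
  assumes "pair_graph \<Gamma>"
    and "triangle_free \<Gamma>"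
    and "S1 \<subseteq> pverts \<Gamma>"
    and "K = generate (racg \<Gamma>) (racg_gen \<Gamma> ` S1)"
    and "finite_generating_set (racg \<Gamma>) T"
  shows "(strongly_quasiconvex (racg \<Gamma>) T K \<longleftrightarrow>
            (\<forall>a b c d. induced_4_cycle \<Gamma> a b c d \<and>
               (\<exists>x\<in>{a, b, c, d} \<inter> S1. \<exists>y\<in>{a, b, c, d} \<inter> S1. x \<noteq> y \<and> (x, y) \<notin> parcs \<Gamma>)
               \<longrightarrow> {a, b, c, d} \<subseteq> S1))
       \<and> (strongly_quasiconvex (racg \<Gamma>) T K \<longleftrightarrow>
            finite K \<or> at_least_quadratic (subgroup_divergence (racg \<Gamma>) T K))"
proof -
  interpret cayley_coxeter \<Gamma> T
    by (intro cayley_coxeter.intro right_angled_coxeter.intro cayley_coxeter_axioms.intro assms)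
  obtain q where q: "q \<ge> 1" "\<And>g h. g \<in> carrier W \<Longrightarrow> h \<in> carrier W \<Longrightarrow> mdist X (vert g) (vert h) \<le> real q * real (wdist g h)"
    "\<And>g h. g \<in> carrier W \<Longrightarrow> h \<in> carrier W \<Longrightarrow> real (wdist g h) \<le> real q * mdist X (vert g) (vert h)"
    using bilipschitz by metis
  interpret bilipschitz_coxeter \<Gamma> T q
    by unfold_locales (use q in auto)
  have K: "K = word_subgroup S1" using word_subgroup_generate assms(3,4) by simp
  have "racg_gen \<Gamma> s \<in> carrier W" if "s \<in> S1" for s
    using el_carrier[of "[s]"] that assms(3) by (auto simp: racg_gen_def racg_word_def)
  then have "subgroup K W" unfolding assms(4) by (intro W.generate_is_subgroup) auto
  then have sq: "strongly_quasiconvex W T K \<longleftrightarrow> strongly_quasiconvex_subset X (vert ` K)"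
    by (simp add: strongly_quasiconvex_def)
  \<comment> \<open>Both equivalences follow from one alternative. Under condition (2)
    quasiconvexity and quadratic divergence hold together, also for finite \<open>K\<close>; if it
    fails, then \<open>K\<close> is infinite and both fail.\<close>
  have yes: "strongly_quasiconvex W T K \<and> at_least_quadratic (subgroup_divergence W T K)"
    if "four_cycle_condition S1"
    using four_cycle_condition_link[OF assms(2) that] assms(2,3) strongly_quasiconvex_if at_least_quadratic_if sq
    unfolding K by blast
  have no: "\<not> strongly_quasiconvex W T K \<and> infinite K \<and> \<not> at_least_quadratic (subgroup_divergence W T K)"
    if nf: "\<not> four_cycle_condition S1"
  proof -
    obtain a b c d where "induced_4_cycle \<Gamma> a b c d" "a \<in> S1" "c \<in> S1" "b \<notin> S1"
      using four_cycle_condition_fails[OF nf] by blast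
    then interpret bilipschitz_flat \<Gamma> a b c d S1 T q
      by unfold_locales (use assms in auto)
    show ?thesis
      using not_strongly_quasiconvex infinite_word_subgroup not_at_least_quadratic sq unfolding K by blast
  qed
  have "strongly_quasiconvex W T K \<longleftrightarrow> four_cycle_condition S1" using yes no by blast
  moreover have "strongly_quasiconvex W T K \<longleftrightarrow> finite K \<or> at_least_quadratic (subgroup_divergence W T K)"
    using yes no by blast
  ultimately show ?thesis unfolding four_cycle_condition_def by blast
qed

end
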